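(* Let $n \geq 2$ be an integer and let $q$ be a prime power. There is a sequence $(q_1, q_2, \dots, q_n)$ of powers of $q$ with $q_1 = q$ such that the locally compact group $\mathrm{Aut}(T_{2q_1}) \times \dots \times \mathrm{Aut}(T_{2q_n})$ contains an infinite strictly ascending chain $\Gamma_0 \subsetneq \Gamma_1 \subsetneq \Gamma_2 \subsetneq \cdots$ of cocompact lattices, each acting transitively on the vertex set $\prod_{i=1}^n V(T_{2q_i})$, and such that for every $k$ and every non-empty proper subset $I \subsetneq \{1, \dots, n\}$, the projection of $\Gamma_k$ to $\prod_{i \in I} \mathrm{Aut}(T_{2q_i})$ has non-discrete image.
   Context: $T_k$ denotes the $k$-regular tree (every vertex has degree $k$). The automorphism group of a locally finite connected graph carries the topology of pointwise convergence on vertices (it is a totally disconnected locally compact group), and products carry the product topology. A lattice in a locally compact group $G$ is a discrete subgroup $\Gamma$ such that $G/\Gamma$ carries a finite $G$-invariant measure; it is cocompact if $G/\Gamma$ is compact. "Power of $q$" means $q^e$ with $e \geq 1$ an integer. A subgroup of a product of tree automorphism groups is vertex-transitive if it acts transitively on the product of the vertex sets. *)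

theory Defs
  imports
    "HOL-Analysis.Analysis"
    "HOL-Algebra.Bij"
    "HOL-Algebra.Left_Coset"
    "HOL-Algebra.Product_Groups"
    "HOL-Number_Theory.Prime_Powers"
begin

section \<open>Graphs and the regular tree\<close>

text \<open>A simple graph on the vertex set \<open>V\<close> is given by its symmetric, irreflexive adjacency
  relation \<open>E\<close>.\<close>

definition simple_graph :: "'a set \<Rightarrow> ('a \<times> 'a) set \<Rightarrow> bool" where
  "simple_graph V E \<longleftrightarrow> E \<subseteq> V \<times> V \<and> sym E \<and> irrefl E"

definition is_cycle :: "('a \<times> 'a) set \<Rightarrow> 'a list \<Rightarrow> bool" where
  "is_cycle E c \<longleftrightarrow> length c \<ge> 3 \<and> distinct c \<and>
     (\<forall>i<length c. (c ! i, c ! (Suc i mod length c)) \<in> E)"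

definition is_tree :: "'a set \<Rightarrow> ('a \<times> 'a) set \<Rightarrow> bool" where
  "is_tree V E \<longleftrightarrow> simple_graph V E \<and> V \<noteq> {} \<and> (\<forall>u\<in>V. \<forall>v\<in>V. (u, v) \<in> E\<^sup>*) \<and> (\<nexists>c. is_cycle E c)"

definition is_regular_tree :: "nat \<Rightarrow> 'a set \<Rightarrow> ('a \<times> 'a) set \<Rightarrow> bool" where
  "is_regular_tree k V E \<longleftrightarrow> is_tree V E \<and> (\<forall>v\<in>V. finite (E `` {v}) \<and> card (E `` {v}) = k)"

text \<open>The \<open>k\<close>-regular tree is unique up to isomorphism. The model used here is the Cayley graph of
  the free product of \<open>k\<close> copies of the group of order 2: the vertices are the reduced words
  over \<open>k\<close> letters (no two consecutive letters agree), and the neighbours of a word are obtained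
  by adding or deleting its first letter. See \<open>is_regular_tree_tree\<close> below.\<close>

definition tree_verts :: "nat \<Rightarrow> nat list set" where
  "tree_verts k = {xs. set xs \<subseteq> {..<k} \<and> distinct_adj xs}"

definition tree_edges :: "nat \<Rightarrow> (nat list \<times> nat list) set" where
  "tree_edges k = {(xs, ys). xs \<in> tree_verts k \<and> ys \<in> tree_verts k \<and>
     ((\<exists>a. ys = a # xs) \<or> (\<exists>a. xs = a # ys))}"

lemma tree_verts_ConsD: "a # xs \<in> tree_verts k \<Longrightarrow> xs \<in> tree_verts k"
  by (auto simp: tree_verts_def dest: distinct_adj_ConsD)

lemma sym_tree_edges: "sym (tree_edges k)"
  by (auto simp: sym_def tree_edges_def)

lemma tree_edges_neighbours:
  assumes "v \<in> tree_verts k"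
  shows "finite (tree_edges k `` {v}) \<and> card (tree_edges k `` {v}) = k"
proof (cases v)
  case Nil
  have "tree_edges k `` {v} = (\<lambda>a. [a]) ` {..<k}"
    using Nil by (auto simp: tree_edges_def tree_verts_def)
  then show ?thesis
    by (simp add: card_image inj_on_def)
next
  case (Cons b w)
  have b: "b < k" and w: "w \<in> tree_verts k"
    using assms Cons tree_verts_ConsD by (auto simp: tree_verts_def)
  have eq: "tree_edges k `` {v} = insert w ((\<lambda>a. a # v) ` ({..<k} - {b}))"
    using Cons assms w by (auto simp: tree_edges_def tree_verts_def distinct_adj_Cons)
  have "w \<notin> (\<lambda>a. a # v) ` ({..<k} - {b})"
    using Cons by auto
  moreover have "card ((\<lambda>a. a # v) ` ({..<k} - {b})) = k - 1"
    using b by (subst card_image) (auto simp: inj_on_def)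
  ultimately show ?thesis
    using b by (simp add: eq)
qed

lemma tree_edges_to_Nil:
  "v \<in> tree_verts k \<Longrightarrow> (v, []) \<in> (tree_edges k)\<^sup>*"
proof (induction v)
  case (Cons a v)
  then have "(a # v, v) \<in> tree_edges k"
    using tree_verts_ConsD by (auto simp: tree_edges_def)
  then show ?case
    using Cons tree_verts_ConsD by (meson converse_rtrancl_into_rtrancl)
qed simp

lemma no_cycle_tree_edges: "\<not> is_cycle (tree_edges k) c"
proof
  assume c: "is_cycle (tree_edges k) c"
  define n where "n = length c"
  have n: "n \<ge> 3" and d: "distinct c"
    and e: "\<And>i. i < n \<Longrightarrow> (c ! i, c ! (Suc i mod n)) \<in> tree_edges k"
    using c by (auto simp: is_cycle_def n_def)
  obtain i where i: "i < n" and max: "\<And>j. j < n \<Longrightarrow> length (c ! j) \<le> length (c ! i)"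
  proof -
    let ?L = "(\<lambda>j. length (c ! j)) ` {..<n}"
    have "Max ?L \<in> ?L"
      using n by (intro Max_in) (auto simp: lessThan_empty_iff)
    then obtain i where "i < n" "length (c ! i) = Max ?L"
      by auto
    then show thesis
      by (intro that[of i]) auto
  qed
  have down: "w = tl (c ! i)"
    if "(c ! i, w) \<in> tree_edges k" "length w \<le> length (c ! i)" for w
    using that by (auto simp: tree_edges_def)
  define s p where "s = Suc i mod n" and "p = (if i = 0 then n - 1 else i - 1)"
  have sp: "s < n" "p < n" "Suc p mod n = i"
    using i n by (auto simp: s_def p_def)
  have "s \<noteq> p"
    using i n by (cases "Suc i = n") (auto simp: s_def p_def)
  moreover have "(c ! i, c ! s) \<in> tree_edges k" "(c ! i, c ! p) \<in> tree_edges k"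
    using e[OF i] e[OF sp(2)] sp(3) sym_tree_edges[of k] by (auto simp: s_def dest: symD)
  ultimately show False
    using down max sp d by (metis n_def nth_eq_iff_index_eq)
qed

lemma is_regular_tree_tree: "is_regular_tree k (tree_verts k) (tree_edges k)"
proof -
  have "(u, v) \<in> (tree_edges k)\<^sup>*" if "u \<in> tree_verts k" "v \<in> tree_verts k" for u v
    using tree_edges_to_Nil that sym_rtrancl[OF sym_tree_edges[of k]]
    by (meson rtrancl_trans symD)
  moreover have "[] \<in> tree_verts k"
    by (simp add: tree_verts_def)
  ultimately show ?thesis
    using no_cycle_tree_edges[of k] tree_edges_neighbours[of _ k] sym_tree_edges[of k]
    by (auto simp: is_regular_tree_def is_tree_def simple_graph_def tree_edges_def irrefl_def)
qed


section \<open>Automorphism groups as topological groups\<close>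

text \<open>Since elements of a \<open>BijGroup\<close> are extensional, automorphisms are
  \<open>undefined\<close> outside the vertex set, and equality of functions is equality of automorphisms.\<close>

definition graph_auts :: "'a set \<Rightarrow> ('a \<times> 'a) set \<Rightarrow> ('a \<Rightarrow> 'a) set" where
  "graph_auts V E = {f \<in> Bij V. \<forall>v\<in>V. \<forall>w\<in>V. (f v, f w) \<in> E \<longleftrightarrow> (v, w) \<in> E}"

definition aut_group :: "'a set \<Rightarrow> ('a \<times> 'a) set \<Rightarrow> ('a \<Rightarrow> 'a) monoid" where
  "aut_group V E = (BijGroup V)\<lparr>carrier := graph_auts V E\<rparr>"

text \<open>The topology of pointwise convergence on the discrete set of vertices.\<close>

definition aut_topology :: "'a set \<Rightarrow> ('a \<times> 'a) set \<Rightarrow> ('a \<Rightarrow> 'a) topology" where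
  "aut_topology V E = subtopology (product_topology (\<lambda>_. discrete_topology V) V) (graph_auts V E)"

lemma topspace_aut_topology: "topspace (aut_topology V E) = carrier (aut_group V E)"
  by (auto simp: aut_topology_def aut_group_def graph_auts_def Bij_def PiE_def bij_betw_def)

lemma group_aut_group: "group (aut_group V E)"
proof -
  interpret B: group "BijGroup V"
    by (rule group_BijGroup)
  have "subgroup (graph_auts V E) (BijGroup V)"
  proof (rule B.subgroupI)
    show "graph_auts V E \<subseteq> carrier (BijGroup V)"
      by (auto simp: graph_auts_def BijGroup_def)
    have "(\<lambda>x\<in>V. x) \<in> graph_auts V E"
      by (auto simp: graph_auts_def id_Bij)
    then show "graph_auts V E \<noteq> {}"
      by blast
  next
    fix f assume f: "f \<in> graph_auts V E"
    then have fB: "f \<in> Bij V"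
      by (simp add: graph_auts_def)
    then have bij: "bij_betw f V V"
      by (simp add: Bij_def)
    have inv: "inv_into V f v \<in> V" "f (inv_into V f v) = v" if "v \<in> V" for v
      using that bij by (auto simp: bij_betw_def f_inv_into_f inv_into_into)
    show "inv\<^bsub>BijGroup V\<^esub> f \<in> graph_auts V E"
      using f inv restrict_inv_into_Bij[OF fB]
      by (simp add: inv_BijGroup[OF fB] graph_auts_def) metis
  next
    fix f g assume "f \<in> graph_auts V E" "g \<in> graph_auts V E"
    then show "f \<otimes>\<^bsub>BijGroup V\<^esub> g \<in> graph_auts V E"
      by (auto simp: graph_auts_def BijGroup_def compose_Bij compose_eq Bij_imp_funcset[THEN funcset_mem])
  qed
  then show ?thesis
    unfolding aut_group_def by (rule B.subgroup_imp_group)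
qed

text \<open>The product of the groups \<open>Aut(T\<^bsub>d i\<^esub>)\<close> over \<open>i \<in> I\<close>.\<close>

definition tree_prod_group :: "nat set \<Rightarrow> (nat \<Rightarrow> nat) \<Rightarrow> (nat \<Rightarrow> nat list \<Rightarrow> nat list) monoid" where
  "tree_prod_group I d = product_group I (\<lambda>i. aut_group (tree_verts (d i)) (tree_edges (d i)))"

definition tree_prod_topology :: "nat set \<Rightarrow> (nat \<Rightarrow> nat) \<Rightarrow> (nat \<Rightarrow> nat list \<Rightarrow> nat list) topology" where
  "tree_prod_topology I d = product_topology (\<lambda>i. aut_topology (tree_verts (d i)) (tree_edges (d i))) I"

lemma group_tree_prod_group: "group (tree_prod_group I d)"
  by (simp add: tree_prod_group_def group_aut_group)

lemma topspace_tree_prod_topology: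
  "topspace (tree_prod_topology I d) = carrier (tree_prod_group I d)"
  by (simp add: tree_prod_topology_def tree_prod_group_def topspace_aut_topology)

definition vertex_transitive ::
    "nat set \<Rightarrow> (nat \<Rightarrow> nat) \<Rightarrow> (nat \<Rightarrow> nat list \<Rightarrow> nat list) set \<Rightarrow> bool" where
  "vertex_transitive I d \<Gamma> \<longleftrightarrow>
     (\<forall>x \<in> (\<Pi>\<^sub>E i\<in>I. tree_verts (d i)). \<forall>y \<in> (\<Pi>\<^sub>E i\<in>I. tree_verts (d i)).
        \<exists>\<gamma>\<in>\<Gamma>. (\<lambda>i\<in>I. \<gamma> i (x i)) = y)"


section \<open>Lattices\<close>

text \<open>In this section \<open>X\<close> is the topology of a topological group \<open>G\<close>, with underlying set
  \<open>carrier G\<close>.\<close>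

definition discrete_subset :: "'a topology \<Rightarrow> 'a set \<Rightarrow> bool" where
  "discrete_subset X S \<longleftrightarrow> subtopology X S = discrete_topology S"

definition coset_topology :: "('a, 'b) monoid_scheme \<Rightarrow> 'a topology \<Rightarrow> 'a set \<Rightarrow> 'a set topology" where
  "coset_topology G X H =
     topology (\<lambda>U. U \<subseteq> lcosets\<^bsub>G\<^esub> H \<and> openin X {g \<in> carrier G. g <#\<^bsub>G\<^esub> H \<in> U})"

lemma openin_coset_topology:
  "openin (coset_topology G X H) U \<longleftrightarrow>
     U \<subseteq> lcosets\<^bsub>G\<^esub> H \<and> openin X {g \<in> carrier G. g <#\<^bsub>G\<^esub> H \<in> U}"
proof -
  let ?p = "\<lambda>U. {g \<in> carrier G. g <#\<^bsub>G\<^esub> H \<in> U}"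
  have "?p (S \<inter> T) = ?p S \<inter> ?p T" for S T
    by auto
  moreover have "?p (\<Union>\<K>) = \<Union>(?p ` \<K>)" for \<K>
    by auto
  ultimately have "istopology (\<lambda>U. U \<subseteq> lcosets\<^bsub>G\<^esub> H \<and> openin X (?p U))"
    unfolding istopology_def by (auto intro!: openin_Union)
  then show ?thesis
    by (simp add: coset_topology_def topology_inverse')
qed

lemma quotient_map_coset_topology:
  assumes "topspace X = carrier G"
  shows "quotient_map X (coset_topology G X H) (\<lambda>g. g <#\<^bsub>G\<^esub> H)"
proof -
  have "openin (coset_topology G X H) (lcosets\<^bsub>G\<^esub> H)"
  proof -
    have "{g \<in> carrier G. g <#\<^bsub>G\<^esub> H \<in> lcosets\<^bsub>G\<^esub> H} = topspace X"
      using assms by (auto simp: LCOSETS_def)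
    then show ?thesis
      by (simp add: openin_coset_topology)
  qed
  then have "topspace (coset_topology G X H) = lcosets\<^bsub>G\<^esub> H"
    by (metis openin_coset_topology openin_subset openin_topspace subset_antisym)
  then show ?thesis
    using assms by (auto simp: quotient_map_def openin_coset_topology LCOSETS_def)
qed

text \<open>A finite \<open>G\<close>-invariant measure is a finite non-zero measure on the Borel sets of
  \<open>G/\<Gamma>\<close> that is invariant under left translation.\<close>

definition finite_invariant_measure ::
    "('a, 'b) monoid_scheme \<Rightarrow> 'a topology \<Rightarrow> 'a set \<Rightarrow> 'a set measure \<Rightarrow> bool" where
  "finite_invariant_measure G X \<Gamma> M \<longleftrightarrow>
     space M = topspace (coset_topology G X \<Gamma>) \<and>
     sets M = sigma_sets (topspace (coset_topology G X \<Gamma>)) {U. openin (coset_topology G X \<Gamma>) U} \<and>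
     finite_measure M \<and> emeasure M (space M) \<noteq> 0 \<and>
     (\<forall>g\<in>carrier G. \<forall>A\<in>sets M. emeasure M ((\<lambda>C. g <#\<^bsub>G\<^esub> C) ` A) = emeasure M A)"

definition lattice_in :: "('a, 'b) monoid_scheme \<Rightarrow> 'a topology \<Rightarrow> 'a set \<Rightarrow> bool" where
  "lattice_in G X \<Gamma> \<longleftrightarrow>
     subgroup \<Gamma> G \<and> discrete_subset X \<Gamma> \<and> (\<exists>M. finite_invariant_measure G X \<Gamma> M)"

definition cocompact_lattice_in :: "('a, 'b) monoid_scheme \<Rightarrow> 'a topology \<Rightarrow> 'a set \<Rightarrow> bool" where
  "cocompact_lattice_in G X \<Gamma> \<longleftrightarrow> lattice_in G X \<Gamma> \<and> compact_space (coset_topology G X \<Gamma>)"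

end

theory Submission
  imports Defs "HOL-Computational_Algebra.Polynomial"
begin

text \<open>Let \<open>L = \<int>[v]\<close> with labels taken modulo \<open>q\<close>, and choose monic polynomials \<open>e\<^sub>i, d\<^sub>i\<close>
  of equal degree \<open>m\<^sub>i\<close>, all pairwise comaximal, with \<open>m\<^sub>1 = 1\<close>; put \<open>q\<^sub>i = q ^ m\<^sub>i\<close>. The polynomial
  part \<open>X\<^sub>i f\<close> of \<open>d\<^sub>i f / e\<^sub>i\<close> defines commuting bijections \<open>X\<^sub>i\<close> of \<open>L\<close> that preserve the polynomials
  of degree \<open>< k\<close>. They describe a cube complex with a single vertex: an element \<open>f\<close> of \<open>L\<close> is a
  configuration at a vertex, its class modulo \<open>(e\<^sub>i, q)\<close> is the label of an edge in direction \<open>i\<close>, and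
  \<open>X\<^sub>i f\<close> is the configuration at the other end of that edge. By the Chinese remainder theorem any two
  adjacent edges lie in exactly one square, so the universal cover is the product of the trees of
  degrees \<open>2 q\<^sub>i\<close> and its fundamental group \<open>\<Gamma>\<close> acts simply transitively on the vertices. Adding \<open>f\<close>
  to the configuration at the root extends to an automorphism that fixes the root, the shift by \<open>f\<close>.
  The group \<open>\<Gamma>\<^sub>k\<close> generated by \<open>\<Gamma>\<close> and the shifts by polynomials of degree \<open>< k\<close> has exactly these
  shifts as root stabilizer, a finite group that grows with \<open>k\<close>. An edge in direction \<open>j\<close> acts on
  the tree \<open>i \<noteq> j\<close> like the multiplication by \<open>d\<^sub>j / e\<^sub>j\<close>, fixing the root and with infinite order,
  which makes all proper projections non-discrete.

  The invariant measure on \<open>G / \<Gamma>\<^sub>k\<close> is the image of the Haar measure of the compact root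
  stabilizer \<open>K\<close>. It is invariant under \<open>G\<close> because \<open>G\<close> is generated by elements that normalize
  arbitrarily small open subgroups of \<open>K\<close>: those of \<open>K\<close>, and the involutions of a single tree that
  come from right multiplication in the free product of groups of order 2.\<close>

section \<open>Invariant measures on quotients of groups with a compact open subgroup\<close>

text \<open>The universal cover is never built. Each generator is given directly as an automaton on
  reduced words (\<open>out\<close>, \<open>nxt\<close>, \<open>act\<close>), and the relations of
  the complex are verified letter by letter. This works because a relation involves a configuration
  \<open>m\<close> only through a few labels, so the Chinese remainder theorem can replace
  \<open>m\<close> by a configuration that also shows the next letter of the word. Equal degrees of
  \<open>e_i\<close> and \<open>d_i\<close> make \<open>X_i\<close> invertible and keep it from
  raising degrees, so each set of shifts is finite modulo \<open>q\<close> and still closed under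
  every \<open>X_i\<close>. A configuration is recovered modulo \<open>q\<close> from its labels
  along a single ray: if all of them vanish, then modulo \<open>q\<close> it is divisible by every
  power of \<open>e_i\<close>, hence zero. This one fact yields both the strictness of the chain and
  the infinite order of the edges, since \<open>d_j^N\<close> and \<open>e_j^N\<close> differ modulo
  \<open>q\<close>. On the measure side the simply transitive group is what identifies
  \<open>G / \<Gamma>\<close> with the root stabilizer \<open>K\<close>; the lattices above it
  inherit their measure from that identification.\<close>

locale filtered_group = group G for G :: "('a, 'b) monoid_scheme" (structure) +
  fixes X :: "'a topology" and K :: "nat \<Rightarrow> 'a set"
  assumes openin_iff: "\<And>U. openin X U \<longleftrightarrow> U \<subseteq> carrier G \<and> (\<forall>g\<in>U. \<exists>m. g <# K m \<subseteq> U)"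
    and subgroup_K: "\<And>m. subgroup (K m) G"
    and decseq_K: "decseq K"
    and normal_K: "\<And>m k u. k \<in> K 0 \<Longrightarrow> u \<in> K m \<Longrightarrow> k \<otimes> u \<otimes> inv k \<in> K m"
    and conj_K: "\<And>m g. g \<in> carrier G \<Longrightarrow> \<exists>M. \<forall>u\<in>K M. g \<otimes> u \<otimes> inv g \<in> K m"
    and compactin_K: "compactin X (K 0)"
    and Inter_K: "(\<Inter>m. K m) = {\<one>}"
begin

lemma K_carrier: "u \<in> K m \<Longrightarrow> u \<in> carrier G"
  using subgroup_K subgroup.subset by blast

lemma K_mono: "m \<le> m' \<Longrightarrow> K m' \<subseteq> K m"
  using decseq_K by (simp add: decseq_def)

lemma K_K0: "u \<in> K m \<Longrightarrow> u \<in> K 0"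
  using K_mono[of 0 m] by auto

lemma topspace_X: "topspace X = carrier G"
proof
  show "topspace X \<subseteq> carrier G"
    using openin_iff[of "topspace X"] by auto
  have "g <# K m \<subseteq> carrier G" if "g \<in> carrier G" for g m
    using that K_carrier by (auto simp: l_coset_def)
  then have "openin X (carrier G)"
    by (simp add: openin_iff)
  then show "carrier G \<subseteq> topspace X"
    by (rule openin_subset)
qed

lemma l_coset_absorb:
  assumes "g \<in> carrier G" "x \<in> g <# K m" "m \<le> m'"
  shows "x <# K m' \<subseteq> g <# K m"
proof
  obtain k where k: "k \<in> K m" "x = g \<otimes> k"
    using assms by (auto simp: l_coset_def)
  fix y assume "y \<in> x <# K m'"
  then obtain k' where "k' \<in> K m'" "y = x \<otimes> k'"
    by (auto simp: l_coset_def)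
  then have "k' \<in> K m" "y = g \<otimes> (k \<otimes> k')"
    using k assms K_mono K_carrier by (auto simp: m_assoc)
  then show "y \<in> g <# K m"
    using k subgroup_K[of m] by (auto simp: l_coset_def intro: subgroup.m_closed)
qed

lemma openin_l_coset:
  assumes "g \<in> carrier G"
  shows "openin X (g <# K m)"
  unfolding openin_iff
proof (intro conjI ballI exI)
  show "g <# K m \<subseteq> carrier G"
    using assms K_carrier by (auto simp: l_coset_def)
  show "x <# K m \<subseteq> g <# K m" if "x \<in> g <# K m" for x
    using that assms l_coset_absorb by blast
qed

text \<open>Sets that are invariant under left multiplication by \<open>K m\<close> are finite unions of
  right cosets; as \<open>K m\<close> is normal in \<open>K 0\<close>, these are also left cosets, hence clopen.\<close>

definition level :: "nat \<Rightarrow> 'a set \<Rightarrow> bool" where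
  "level m A \<longleftrightarrow> A \<subseteq> K 0 \<and> (\<forall>u\<in>K m. \<forall>x\<in>A. u \<otimes> x \<in> A)"

text \<open>Only meaningful for sets of level \<open>m\<close>: such a set contains every right
  coset of \<open>K m\<close> that it meets, so this is its size in units of
  \<open>K m\<close>.\<close>

definition num :: "nat \<Rightarrow> 'a set \<Rightarrow> nat" where
  "num m A = card ((\<lambda>x. K m #> x) ` A)"

lemma level_mono: "level m A \<Longrightarrow> m \<le> m' \<Longrightarrow> level m' A"
  using K_mono by (fastforce simp: level_def)

lemma level_K: "level m (K m)"
  using K_K0 subgroup_K[of m] by (auto simp: level_def intro: subgroup.m_closed)

lemma level_K0: "level m (K 0)"
  using level_mono[OF level_K[of 0]] by simp

text \<open>Normality in \<open>K 0\<close> turns a right factor into a left one: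
  \<open>x u = (x u x^-1) x\<close>.\<close>

lemma level_left:
  assumes "level m A" "x \<in> A"
  shows "x <# K m \<subseteq> A"
proof
  fix y assume "y \<in> x <# K m"
  then obtain u where u: "u \<in> K m" "y = x \<otimes> u"
    by (auto simp: l_coset_def)
  have x: "x \<in> K 0" "x \<in> carrier G"
    using assms K_carrier by (auto simp: level_def)
  have "y = (x \<otimes> u \<otimes> inv x) \<otimes> x"
    using u x K_carrier by (simp add: m_assoc)
  then show "y \<in> A"
    using assms normal_K[OF x(1) u(1)] by (auto simp: level_def)
qed

lemma openin_level:
  assumes "level m A"
  shows "openin X A"
  unfolding openin_iff
proof (intro conjI ballI exI)
  show "A \<subseteq> carrier G"
    using assms K_carrier unfolding level_def by blast
qed (rule level_left[OF assms])

lemma level_Compl: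
  assumes "level m A"
  shows "level m (K 0 - A)"
  unfolding level_def
proof (intro conjI ballI)
  fix u x assume u: "u \<in> K m" and x: "x \<in> K 0 - A"
  have "u \<otimes> x \<in> K 0"
    using u x K_K0 subgroup_K[of 0] by (auto intro: subgroup.m_closed)
  moreover have "u \<otimes> x \<notin> A"
  proof
    assume "u \<otimes> x \<in> A"
    then have "inv u \<otimes> (u \<otimes> x) \<in> A"
      using assms u subgroup_K[of m] by (auto simp: level_def intro: subgroup.m_inv_closed)
    then show False
      using u x K_carrier by (auto simp: m_assoc[symmetric])
  qed
  ultimately show "u \<otimes> x \<in> K 0 - A" by simp
qed auto

lemma level_Int: "level m A \<Longrightarrow> level m B \<Longrightarrow> level m (A \<inter> B)"
  and level_Un: "level m A \<Longrightarrow> level m B \<Longrightarrow> level m (A \<union> B)"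
  by (auto simp: level_def)

lemma rcos_eq_iff:
  assumes "x \<in> carrier G" "y \<in> carrier G"
  shows "K m #> x = K m #> y \<longleftrightarrow> x \<otimes> inv y \<in> K m"
proof -
  have "K m #> x = K m #> y \<longleftrightarrow> x \<in> K m #> y"
    using rcos_self[OF assms(1) subgroup_K[of m]]
      repr_independence[OF _ assms(2) subgroup_K[of m], of x] by auto
  then show ?thesis
    using subgroup.rcos_module[OF subgroup_K is_group assms(2,1)] by simp
qed

text \<open>Compactness covers \<open>K 0\<close> by finitely many left cosets of
  \<open>K m\<close>, and by normality each of them is also a right coset.\<close>

lemma finite_cosets:
  assumes "A \<subseteq> K 0"
  shows "finite ((\<lambda>x. K m #> x) ` A)"
proof -
  have "\<exists>F. finite F \<and> F \<subseteq> (\<lambda>g. g <# K m) ` K 0 \<and> K 0 \<subseteq> \<Union>F"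
    by (rule compactinD[OF compactin_K])
      (use lcos_self[OF _ subgroup_K[of m]] K_carrier openin_l_coset in blast)+
  then obtain F where F: "finite F" "F \<subseteq> (\<lambda>g. g <# K m) ` K 0" "K 0 \<subseteq> \<Union>F"
    by auto
  then obtain S where S: "finite S" "S \<subseteq> K 0" "F = (\<lambda>g. g <# K m) ` S"
    by (meson finite_subset_image)
  have "(\<lambda>x. K m #> x) ` A \<subseteq> (\<lambda>x. K m #> x) ` S"
  proof clarify
    fix x assume "x \<in> A"
    then obtain g u where g: "g \<in> S" "u \<in> K m" "x = g \<otimes> u"
      using F S assms by (auto simp: l_coset_def)
    have "g \<in> K 0" "g \<in> carrier G" "u \<in> carrier G"
      using g S K_carrier by auto
    then have "x \<otimes> inv g \<in> K m" "x \<in> carrier G"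
      using normal_K[of g u m] g by auto
    then show "K m #> x \<in> (\<lambda>x. K m #> x) ` S"
      using g \<open>g \<in> carrier G\<close> rcos_eq_iff by blast
  qed
  then show ?thesis
    using S finite_surj by blast
qed

lemma num_pos: "x \<in> A \<Longrightarrow> A \<subseteq> K 0 \<Longrightarrow> num m A > 0"
  using finite_cosets[of A m] by (auto simp: num_def card_gt_0_iff)

text \<open>Right translation permutes the right cosets of \<open>K m\<close>. This is the source of
  the invariance of the measure.\<close>

lemma num_translate:
  assumes "A \<subseteq> carrier G" "x \<in> carrier G"
  shows "num m (A #> x) = num m A"
proof -
  have "(\<lambda>y. K m #> y) ` (A #> x) = (\<lambda>C. C #> x) ` (\<lambda>y. K m #> y) ` A"
  proof -
    have "K m #> (y \<otimes> x) = (K m #> y) #> x" if "y \<in> A" for y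
      using assms that subgroup.subset[OF subgroup_K, of m] by (simp add: coset_mult_assoc subset_iff)
    then show ?thesis
      by (force simp: r_coset_def[of _ A])
  qed
  moreover have "inj_on (\<lambda>C. C #> x) ((\<lambda>y. K m #> y) ` A)"
  proof (rule inj_on_inverseI)
    fix C assume "C \<in> (\<lambda>y. K m #> y) ` A"
    then have "C \<subseteq> carrier G"
      using assms K_carrier by (auto simp: r_coset_def)
    then show "(C #> x) #> inv x = C"
      using assms by (simp add: coset_mult_assoc)
  qed
  ultimately show ?thesis
    by (simp add: num_def card_image)
qed

text \<open>A right coset of \<open>K m\<close> is a translate of \<open>K m\<close>, so all of them
  split into the same number of cosets of the smaller group \<open>K M\<close>. Quotients of two
  values of \<open>num\<close> therefore do not depend on the level.\<close>

lemma num_refine: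
  assumes "level m A" "m \<le> M"
  shows "num M A = num m A * num M (K m)"
proof -
  let ?C = "\<lambda>x. K m #> x" and ?D = "\<lambda>x. K M #> x"
  have A: "A \<subseteq> K 0" "A \<subseteq> carrier G"
    using assms K_carrier by (auto simp: level_def)
  have sub: "?C x \<subseteq> A" if "x \<in> A" for x
    using that assms by (auto simp: level_def r_coset_def)
  have self: "x \<in> ?C x" if "x \<in> A" for x
    using that A subgroup_K rcos_self by blast
  have D: "?D y \<subseteq> ?C x" if "x \<in> A" "y \<in> ?C x" for x y
  proof -
    have "?C x = ?C y"
      using that A subgroup_K repr_independence by blast
    then show ?thesis
      using K_mono[OF assms(2)] by (auto simp: r_coset_def)
  qed
  have "?D ` A = (\<Union>C\<in>?C ` A. ?D ` C)"
    using sub self by (auto simp: image_iff) blast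
  also have "card \<dots> = (\<Sum>C\<in>?C ` A. card (?D ` C))"
  proof (rule card_UN_disjoint)
    show "finite (?C ` A)"
      using finite_cosets A by simp
    show "\<forall>C\<in>?C ` A. finite (?D ` C)"
      using finite_cosets A(1) sub by (metis (no_types, lifting) dual_order.trans imageE)
    show "\<forall>C\<in>?C ` A. \<forall>C'\<in>?C ` A. C \<noteq> C' \<longrightarrow> ?D ` C \<inter> ?D ` C' = {}"
    proof (intro ballI impI)
      fix C C' assume C: "C \<in> ?C ` A" "C' \<in> ?C ` A" "C \<noteq> C'"
      then obtain x x' where x: "x \<in> A" "x' \<in> A" "C = ?C x" "C' = ?C x'" by auto
      have "False" if "y \<in> C" "y' \<in> C'" "?D y = ?D y'" for y y'
      proof -
        have "y \<in> carrier G"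
          using that sub[of x] x A by auto
        then have "y \<in> C'"
          using that D[of x' y'] x rcos_self[OF _ subgroup_K, of y M] by auto
        then show False
          using that C x A subgroup_K[of m] repr_independence by (metis subsetD)
      qed
      then show "?D ` C \<inter> ?D ` C' = {}" by blast
    qed
  qed
  also have "\<dots> = (\<Sum>C\<in>?C ` A. num M (K m))"
  proof (rule sum.cong[OF refl])
    fix C assume "C \<in> ?C ` A"
    then obtain x where "x \<in> A" "C = ?C x" by auto
    then show "card (?D ` C) = num M (K m)"
      using num_translate[of "K m" x M] A K_carrier by (auto simp: num_def)
  qed
  finally show ?thesis
    by (simp add: num_def)
qed

text \<open>The least level is merely a canonical choice; by \<open>content_level\<close> every
  level of \<open>A\<close> gives the same value.\<close>

definition content :: "'a set \<Rightarrow> real" where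
  "content A = (let m = LEAST m. level m A in num m A / num m (K 0))"

lemma content_level:
  assumes "level m A"
  shows "content A = num m A / num m (K 0)"
proof -
  define m0 where "m0 = (LEAST m. level m A)"
  have m0: "level m0 A" "m0 \<le> m"
    using assms by (auto simp: m0_def intro: LeastI Least_le)
  have "\<one> \<in> K m0"
    using subgroup_K subgroup.one_closed by blast
  then have "num m (K m0) > 0"
    using num_pos K_K0 by blast
  then show ?thesis
    using num_refine[OF m0] num_refine[OF level_K0 m0(2)]
    by (simp add: content_def Let_def m0_def)
qed

definition levels :: "'a set set" where
  "levels = {A. \<exists>m. level m A}"

lemma common_level:
  assumes "A \<in> levels" "B \<in> levels"
  obtains m where "level m A" "level m B"
proof -
  obtain a b where "level a A" "level b B"
    using assms by (auto simp: levels_def)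
  then show thesis
    using that[of "max a b"] level_mono by simp
qed

lemma algebra_levels: "algebra (K 0) levels"
proof (rule algebra.intro)
  show "ring_of_sets (K 0) levels"
  proof (rule ring_of_setsI)
    show "levels \<subseteq> Pow (K 0)" "{} \<in> levels"
      by (auto simp: levels_def level_def)
    fix A B assume AB: "A \<in> levels" "B \<in> levels"
    obtain m where m: "level m A" "level m B"
      by (rule common_level[OF AB])
    show "A \<union> B \<in> levels"
      using m level_Un by (auto simp: levels_def)
    have "A - B = A \<inter> (K 0 - B)"
      using m by (auto simp: level_def)
    then show "A - B \<in> levels"
      using level_Int[OF m(1) level_Compl[OF m(2)]] by (auto simp: levels_def)
  qed
  show "algebra_axioms (K 0) levels"
    using level_K[of 0] by (auto simp: algebra_axioms_def levels_def)
qed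

lemma num_Un:
  assumes "level m A" "level m B" "A \<inter> B = {}"
  shows "num m (A \<union> B) = num m A + num m B"
proof -
  have "K m #> x \<noteq> K m #> y" if "x \<in> A" "y \<in> B" for x y
  proof
    assume eq: "K m #> x = K m #> y"
    have "x \<in> carrier G" "y \<in> carrier G"
      using that assms K_carrier by (auto simp: level_def)
    then have "x \<in> K m #> y"
      using eq rcos_self subgroup_K by blast
    then have "x \<in> B"
      using assms that by (auto simp: level_def r_coset_def)
    then show False
      using that assms by auto
  qed
  then have "(\<lambda>x. K m #> x) ` A \<inter> (\<lambda>x. K m #> x) ` B = {}"
    by auto
  then show ?thesis
    unfolding num_def image_Un using finite_cosets assms
    by (intro card_Un_disjoint) (auto simp: level_def)
qed

text \<open>The complements are open, so an empty intersection would give a finite subcover of the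
  compact group \<open>K 0\<close>, and in a decreasing sequence one member would then be
  empty.\<close>

lemma Inter_levels_nonempty:
  assumes "range A \<subseteq> levels" "decseq A" "\<And>i. A i \<noteq> {}"
  shows "(\<Inter>i. A i) \<noteq> {}"
proof
  assume emp: "(\<Inter>i. A i) = {}"
  let ?U = "(\<lambda>i. K 0 - A i) ` UNIV"
  have lev: "K 0 - A i \<in> levels" "A i \<subseteq> K 0" for i
  proof -
    have "A i \<in> levels"
      using assms(1) by auto
    then obtain m where "level m (A i)"
      by (auto simp: levels_def)
    then show "K 0 - A i \<in> levels" "A i \<subseteq> K 0"
      using level_Compl[of m "A i"] unfolding levels_def by (auto simp: level_def)
  qed
  have "\<exists>F. finite F \<and> F \<subseteq> ?U \<and> K 0 \<subseteq> \<Union>F"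
  proof (rule compactinD[OF compactin_K])
    fix U assume "U \<in> ?U"
    then have "U \<in> levels"
      using lev by blast
    then obtain m where "level m U"
      by (auto simp: levels_def)
    then show "openin X U"
      using openin_level by blast
  qed (use emp in blast)
  then obtain F where F: "finite F" "F \<subseteq> ?U" "K 0 \<subseteq> \<Union>F"
    by blast
  obtain S where "finite S" "F = (\<lambda>i. K 0 - A i) ` S"
    using finite_subset_image[OF F(1,2)] by blast
  then have S: "finite S" "K 0 \<subseteq> (\<Union>i\<in>S. K 0 - A i)"
    using F(3) by auto
  obtain N where N: "\<forall>i\<in>S. i \<le> N"
    using S(1) finite_nat_set_iff_bounded_le by blast
  obtain x where x: "x \<in> A N"
    using assms(3) by blast
  then obtain i where "i \<in> S" "x \<notin> A i"
    using S lev by blast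
  then show False
    using x N assms(2) by (auto simp: decseq_def)
qed

text \<open>Continuity at the empty set, the analytic hypothesis of the Caratheodory extension,
  holds for a trivial reason: a decreasing sequence of level sets with empty intersection is
  eventually empty.\<close>

lemma ex_haar:
  "\<exists>\<mu>. space \<mu> = K 0 \<and> sets \<mu> = sigma_sets (K 0) levels \<and>
     (\<forall>m A. level m A \<longrightarrow> emeasure \<mu> A = ennreal (num m A / num m (K 0)))"
proof -
  interpret L: algebra "K 0" levels
    by (rule algebra_levels)
  let ?f = "\<lambda>A. ennreal (content A)"
  have "\<exists>\<mu>. (\<forall>s\<in>levels. \<mu> s = ?f s) \<and> measure_space (K 0) (sigma_sets (K 0) levels) \<mu>"
  proof (rule L.caratheodory_empty_continuous)
    show "positive levels ?f"
      using content_level[of 0 "{}"] by (auto simp: positive_def level_def num_def)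
    have "?f (A \<union> B) = ?f A + ?f B" if AB: "A \<in> levels" "B \<in> levels" "A \<inter> B = {}" for A B
    proof -
      obtain m where m: "level m A" "level m B"
        by (rule common_level[OF AB(1,2)])
      show ?thesis
        using num_Un[OF m AB(3)]
        by (simp add: content_level[OF m(1)] content_level[OF m(2)] content_level[OF level_Un[OF m]]
            add_divide_distrib flip: ennreal_plus)
    qed
    then show "additive levels ?f"
      by (simp add: additive_def)
    show "?f A \<noteq> \<infinity>" for A by simp
    fix A :: "nat \<Rightarrow> 'a set"
    assume A: "range A \<subseteq> levels" "decseq A" "(\<Inter>i. A i) = {}"
    then obtain i where i: "A i = {}"
      using Inter_levels_nonempty by blast
    have "?f (A j) = 0" if "j \<ge> i" for j
    proof -
      have "A j = {}"
        using that A(2) i by (auto simp: decseq_def)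
      then show ?thesis
        using content_level[of 0 "{}"] by (simp add: level_def num_def)
    qed
    then show "(\<lambda>i. ?f (A i)) \<longlonglongrightarrow> 0"
      by (intro tendsto_eventually) (auto simp: eventually_sequentially)
  qed
  then obtain \<mu> where \<mu>: "\<forall>s\<in>levels. \<mu> s = ?f s"
    "measure_space (K 0) (sigma_sets (K 0) levels) \<mu>" by blast
  let ?M = "measure_of (K 0) levels \<mu>"
  have "levels \<subseteq> Pow (K 0)"
    by (auto simp: levels_def level_def)
  moreover have "emeasure ?M A = \<mu> A" if "A \<in> levels" for A
  proof (rule emeasure_measure_of)
    show "positive (sets ?M) \<mu>" "countably_additive (sets ?M) \<mu>"
      using \<mu>(2) \<open>levels \<subseteq> Pow (K 0)\<close> by (auto simp: measure_space_def)
  qed (use that \<open>levels \<subseteq> Pow (K 0)\<close> in auto)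
  moreover have "\<mu> A = ennreal (num m A / num m (K 0))" if "level m A" for m A
    using \<mu>(1) content_level[OF that] that unfolding levels_def by auto
  moreover have "A \<in> levels" if "level m A" for m A
    using that by (auto simp: levels_def)
  ultimately show ?thesis
    by (intro exI[of _ ?M]) simp
qed

definition haar :: "'a measure" where
  "haar = (SOME \<mu>. space \<mu> = K 0 \<and> sets \<mu> = sigma_sets (K 0) levels \<and>
     (\<forall>m A. level m A \<longrightarrow> emeasure \<mu> A = ennreal (num m A / num m (K 0))))"

lemma haar:
  "space haar = K 0 \<and> sets haar = sigma_sets (K 0) levels \<and>
     (\<forall>m A. level m A \<longrightarrow> emeasure haar A = ennreal (num m A / num m (K 0)))"
  unfolding haar_def by (rule someI_ex[OF ex_haar])

lemma space_haar: "space haar = K 0"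
  and sets_haar: "sets haar = sigma_sets (K 0) levels"
  and emeasure_haar: "level m A \<Longrightarrow> emeasure haar A = ennreal (num m A / num m (K 0))"
  using haar by simp_all

end

section \<open>Elements that normalize arbitrarily small open subgroups\<close>

context filtered_group begin

text \<open>The two inclusions together say \<open>g U g^-1 = U\<close>; containing some
  \<open>K M\<close> makes \<open>U\<close> open.\<close>

definition small_normalized :: "'a \<Rightarrow> 'a set \<Rightarrow> bool" where
  "small_normalized g U \<longleftrightarrow> subgroup U G \<and> (\<exists>M. K M \<subseteq> U) \<and> U \<subseteq> K 0 \<and>
     (\<forall>u\<in>U. g \<otimes> u \<otimes> inv g \<in> U \<and> inv g \<otimes> u \<otimes> g \<in> U)"

text \<open>\<open>U\<close> may depend on \<open>g\<close>, so this set need not be closed under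
  products: two involutions of a tree can multiply to a translation. That is why
  \<open>generate\<close> is applied to it later.\<close>

definition small_normalizer :: "'a set" where
  "small_normalizer = {g \<in> carrier G. \<forall>m. \<exists>U\<subseteq>K m. small_normalized g U}"

lemma small_normalized_inv:
  "g \<in> carrier G \<Longrightarrow> small_normalized g U \<Longrightarrow> small_normalized (inv g) U"
  by (simp add: small_normalized_def)

lemma small_normalizer_inv:
  assumes "g \<in> small_normalizer"
  shows "inv g \<in> small_normalizer"
  unfolding small_normalizer_def mem_Collect_eq
proof (intro conjI allI)
  have g: "g \<in> carrier G"
    using assms by (simp add: small_normalizer_def)
  then show "inv g \<in> carrier G"
    by simp
  fix m
  obtain U where "U \<subseteq> K m" "small_normalized g U"
    using assms unfolding small_normalizer_def by blast
  then show "\<exists>U\<subseteq>K m. small_normalized (inv g) U"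
    using small_normalized_inv[OF g] by blast
qed

lemma small_normalized_Int:
  assumes "small_normalized g U" "small_normalized g U'"
  shows "small_normalized g (U \<inter> U')"
proof -
  obtain M M' where "K M \<subseteq> U" "K M' \<subseteq> U'"
    using assms unfolding small_normalized_def by blast
  then have "K (max M M') \<subseteq> U \<inter> U'"
    using K_mono[of M "max M M'"] K_mono[of M' "max M M'"] by auto
  moreover have "subgroup (U \<inter> U') G"
    using assms subgroups_Inter_pair unfolding small_normalized_def by blast
  ultimately show ?thesis
    using assms unfolding small_normalized_def by blast
qed

lemma K0_subset_small_normalizer: "K 0 \<subseteq> small_normalizer"
proof
  fix g assume g: "g \<in> K 0"
  then have "inv g \<in> K 0" "g \<in> carrier G"
    using subgroup_K[of 0] K_carrier by (auto intro: subgroup.m_inv_closed)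
  then have "small_normalized g (K m)" for m
    using normal_K[OF g, of _ m] normal_K[of "inv g" _ m] subgroup_K[of m] K_mono[of 0 m]
    unfolding small_normalized_def by auto
  then show "g \<in> small_normalizer"
    using \<open>g \<in> carrier G\<close> unfolding small_normalizer_def by blast
qed

lemma rcos_subset:
  assumes "U \<subseteq> K 0" "x \<in> K 0"
  shows "U #> x \<subseteq> K 0"
proof
  fix y assume "y \<in> U #> x"
  then obtain u where "u \<in> U" "y = u \<otimes> x"
    by (auto simp: r_coset_def)
  then show "y \<in> K 0"
    using assms subgroup.m_closed[OF subgroup_K[of 0]] by blast
qed

lemma level_rcos:
  assumes "subgroup U G" "K M \<subseteq> U" "U \<subseteq> K 0" "x \<in> K 0"
  shows "level M (U #> x)"
  unfolding level_def
proof (intro conjI ballI)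
  show "U #> x \<subseteq> K 0"
    using assms rcos_subset by blast
  fix v y assume v: "v \<in> K M" and "y \<in> U #> x"
  then obtain u where u: "u \<in> U" "y = u \<otimes> x"
    by (auto simp: r_coset_def)
  then have "v \<otimes> y = (v \<otimes> u) \<otimes> x" "v \<otimes> u \<in> U"
    using assms v K_carrier by (auto simp: m_assoc subset_iff intro: subgroup.m_closed)
  then show "v \<otimes> y \<in> U #> x"
    by (auto simp: r_coset_def)
qed

lemma emeasure_rcos:
  assumes "small_normalized g U" "x \<in> K 0"
  shows "emeasure haar (U #> x) = emeasure haar U"
proof -
  obtain M where M: "K M \<subseteq> U" and U: "subgroup U G" "U \<subseteq> K 0"
    using assms unfolding small_normalized_def by blast
  have "level M (U #> x)" "level M (U #> \<one>)"
    using level_rcos[OF U(1) M U(2)] assms subgroup.one_closed[OF subgroup_K] by auto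
  moreover have "U #> \<one> = U"
    using U(1) by (simp add: subgroup.subset)
  ultimately show ?thesis
    using num_translate[of U x M] K_carrier[OF assms(2)] subgroup.subset[OF U(1)]
    by (simp add: emeasure_haar)
qed

text \<open>A generating system adapted to \<open>g\<close>: on cosets of subgroups normalized by
  \<open>g\<close>, the effect of \<open>g\<close> on the measure can be read off directly.
  \<open>K 0\<close> serves as the covering set and \<open>{}\<close> provides stability under
  intersections.\<close>

definition small_cosets :: "'a \<Rightarrow> 'a set set" where
  "small_cosets g = insert (K 0) (insert {} {U #> x |U x. small_normalized g U \<and> x \<in> K 0})"

lemma small_cosets_subset: "small_cosets g \<subseteq> levels"
proof
  fix A assume A: "A \<in> small_cosets g"
  have "level 0 {}"
    by (simp add: level_def)
  then show "A \<in> levels"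
    using A level_K0 level_rcos
    unfolding small_cosets_def small_normalized_def levels_def by blast
qed

lemma small_cosets_Pow: "small_cosets g \<subseteq> Pow (K 0)"
  using small_cosets_subset[of g] by (auto simp: levels_def level_def)

text \<open>Two cosets with a common point \<open>z\<close> can both be based at \<open>z\<close>;
  their intersection is then the coset of \<open>U \<inter> V\<close> through
  \<open>z\<close>.\<close>

lemma Int_stable_small_cosets: "Int_stable (small_cosets g)"
proof (rule Int_stableI)
  fix A B assume AB: "A \<in> small_cosets g" "B \<in> small_cosets g"
  have sub: "A \<subseteq> K 0" "B \<subseteq> K 0"
    using AB small_cosets_Pow by auto
  consider "A = K 0" | "B = K 0" | "A = {}" | "B = {}" |
    U x V y where "A = U #> x" "B = V #> y" "small_normalized g U" "small_normalized g V"
      "x \<in> K 0" "y \<in> K 0"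
    using AB unfolding small_cosets_def by blast
  then show "A \<inter> B \<in> small_cosets g"
  proof cases
    case 1 then show ?thesis using sub AB by (simp add: Int_absorb1)
  next
    case 2 then show ?thesis using sub AB by (simp add: Int_absorb2)
  next
    case 5
    show ?thesis
    proof (cases "A \<inter> B = {}")
      case False
      then obtain z where z: "z \<in> A" "z \<in> B" by auto
      have UV: "subgroup U G" "subgroup V G"
        using 5 by (auto simp: small_normalized_def)
      have c: "z \<in> K 0" "z \<in> carrier G" "x \<in> carrier G" "y \<in> carrier G"
        using z sub 5 K_carrier by auto
      have "A = U #> z" "B = V #> z"
        using repr_independence[OF _ c(3) UV(1)] repr_independence[OF _ c(4) UV(2)] z 5 by auto
      moreover have "(U #> z) \<inter> (V #> z) = (U \<inter> V) #> z"
      proof -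
        have "u = v" if "u \<in> U" "v \<in> V" "u \<otimes> z = v \<otimes> z" for u v
          using that c(2) subgroup.mem_carrier[OF UV(1)] subgroup.mem_carrier[OF UV(2)] by simp
        then show ?thesis
          unfolding r_coset_def by blast
      qed
      ultimately have "A \<inter> B = (U \<inter> V) #> z"
        by simp
      then show ?thesis
        using small_normalized_Int 5 c(1) unfolding small_cosets_def by blast
    qed (auto simp: small_cosets_def)
  qed (auto simp: small_cosets_def)
qed

text \<open>A set of level \<open>m\<close> is a union of cosets of any normalized
  \<open>U \<subseteq> K m\<close>. There are finitely many of them, because a coset of
  \<open>U\<close> is determined by any coset of \<open>K M \<subseteq> U\<close> inside it.\<close>

lemma sigma_sets_small_cosets:
  assumes "g \<in> small_normalizer"
  shows "sigma_sets (K 0) levels = sigma_sets (K 0) (small_cosets g)"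
proof (rule sigma_sets_eqI)
  fix A assume "A \<in> levels"
  then obtain m where m: "level m A"
    by (auto simp: levels_def)
  obtain U where U: "U \<subseteq> K m" "small_normalized g U"
    using assms unfolding small_normalizer_def by blast
  then obtain M where M: "K M \<subseteq> U" and sU: "subgroup U G"
    unfolding small_normalized_def by blast
  have A: "A \<subseteq> K 0" "\<And>x. x \<in> A \<Longrightarrow> x \<in> carrier G"
    using m K_carrier by (auto simp: level_def)
  have sub: "U #> x \<subseteq> A" if "x \<in> A" for x
    using that m U by (auto simp: level_def r_coset_def)
  have eq: "U #> x = (\<Union>c\<in>K M #> x. U #> c)" if "x \<in> A" for x
  proof -
    have "U #> c = U #> x" if "c \<in> K M #> x" for c
    proof -
      have "c \<in> U #> x"
        using that M by (auto simp: r_coset_def)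
      then show ?thesis
        using repr_independence[OF _ A(2)[OF \<open>x \<in> A\<close>] sU] by simp
    qed
    moreover have "x \<in> K M #> x"
      using A that subgroup_K rcos_self by blast
    ultimately show ?thesis by blast
  qed
  have "(\<lambda>x. U #> x) ` A \<subseteq> (\<lambda>C. \<Union>c\<in>C. U #> c) ` (\<lambda>x. K M #> x) ` A"
    using eq by auto
  then have "finite ((\<lambda>x. U #> x) ` A)"
    using finite_surj[OF finite_cosets[OF A(1)]] by simp
  moreover have "(\<lambda>x. U #> x) ` A \<subseteq> sigma_sets (K 0) (small_cosets g)"
    using A U(2) unfolding small_cosets_def by (auto intro: sigma_sets.Basic)
  ultimately have "\<Union>((\<lambda>x. U #> x) ` A) \<in> sigma_sets (K 0) (small_cosets g)"
    by (intro sigma_sets_UNION countable_finite) auto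
  moreover have "\<Union>((\<lambda>x. U #> x) ` A) = A"
  proof
    show "\<Union>((\<lambda>x. U #> x) ` A) \<subseteq> A"
      using sub by auto
    show "A \<subseteq> \<Union>((\<lambda>x. U #> x) ` A)"
      using rcos_self[OF A(2) sU] by auto
  qed
  ultimately show "A \<in> sigma_sets (K 0) (small_cosets g)"
    by simp
next
  fix A assume "A \<in> small_cosets g"
  then show "A \<in> sigma_sets (K 0) levels"
    using small_cosets_subset by blast
qed

lemma openin_Int_sets_haar:
  assumes "openin X U"
  shows "U \<inter> K 0 \<in> sets haar"
proof -
  \<comment> \<open>The points of \<open>K 0\<close> whose neighbourhood of size \<open>m\<close>
    lies in \<open>U\<close>. Each \<open>A m\<close> has level \<open>m\<close>, and together they
    exhaust the open set, so a countable union suffices.\<close>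
  define A where "A m = {k \<in> K 0. k <# K m \<subseteq> U}" for m
  have "level m (A m)" for m
    unfolding level_def
  proof (intro conjI ballI)
    fix u x assume u: "u \<in> K m" and x: "x \<in> A m"
    have x0: "x \<in> K 0" "x \<in> carrier G" "u \<in> carrier G" "inv x \<in> K 0"
      using u x K_carrier subgroup_K[of 0] by (auto simp: A_def intro: subgroup.m_inv_closed)
    have "inv x \<otimes> u \<otimes> x \<in> K m"
      using normal_K[OF x0(4) u] x0 by simp
    moreover have "u \<otimes> x = x \<otimes> (inv x \<otimes> u \<otimes> x)"
      using x0 by (simp add: m_assoc[symmetric])
    ultimately have "u \<otimes> x \<in> x <# K m"
      unfolding l_coset_def by blast
    then have "u \<otimes> x <# K m \<subseteq> U"
      using l_coset_absorb[OF x0(2), of "u \<otimes> x" m m] x by (auto simp: A_def)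
    moreover have "u \<otimes> x \<in> K 0"
      using x0 K_K0[OF u] subgroup_K[of 0] by (auto intro: subgroup.m_closed)
    ultimately show "u \<otimes> x \<in> A m"
      by (simp add: A_def)
  qed (auto simp: A_def)
  then have "A m \<in> sets haar" for m
    unfolding sets_haar levels_def by blast
  moreover have "U \<inter> K 0 = (\<Union>m. A m)"
  proof
    show "U \<inter> K 0 \<subseteq> (\<Union>m. A m)"
      using assms unfolding openin_iff A_def by blast
    show "(\<Union>m. A m) \<subseteq> U \<inter> K 0"
    proof
      fix x assume "x \<in> (\<Union>m. A m)"
      then obtain m where "x \<in> K 0" "x <# K m \<subseteq> U"
        by (auto simp: A_def)
      then show "x \<in> U \<inter> K 0"
        using lcos_self[OF K_carrier subgroup_K] by auto
    qed
  qed
  ultimately show ?thesis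
    by auto
qed

end

section \<open>A complement of the compact open subgroup, and the action on its cosets\<close>

locale filtered_group_transversal = filtered_group +
  fixes \<Gamma>\<^sub>0 :: "'a set"
  assumes subgroup_transversal: "subgroup \<Gamma>\<^sub>0 G"
    and ex_transversal: "\<And>g. g \<in> carrier G \<Longrightarrow> \<exists>k\<in>K 0. \<exists>\<gamma>\<in>\<Gamma>\<^sub>0. g = k \<otimes> \<gamma>"
    and transversal_Int: "K 0 \<inter> \<Gamma>\<^sub>0 = {\<one>}"
    and generators: "carrier G = generate G small_normalizer"
begin

definition proj :: "'a \<Rightarrow> 'a" where
  "proj g = (THE k. k \<in> K 0 \<and> (\<exists>\<gamma>\<in>\<Gamma>\<^sub>0. g = k \<otimes> \<gamma>))"

lemma transversal_carrier: "\<gamma> \<in> \<Gamma>\<^sub>0 \<Longrightarrow> \<gamma> \<in> carrier G"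
  by (rule subgroup.mem_carrier[OF subgroup_transversal])

lemma proj_eq:
  assumes "k \<in> K 0" "\<gamma> \<in> \<Gamma>\<^sub>0"
  shows "proj (k \<otimes> \<gamma>) = k"
  unfolding proj_def
proof (rule the_equality)
  fix k' assume k': "k' \<in> K 0 \<and> (\<exists>\<gamma>'\<in>\<Gamma>\<^sub>0. k \<otimes> \<gamma> = k' \<otimes> \<gamma>')"
  then obtain \<gamma>' where \<gamma>': "\<gamma>' \<in> \<Gamma>\<^sub>0" "k \<otimes> \<gamma> = k' \<otimes> \<gamma>'"
    by blast
  have c: "k \<in> carrier G" "k' \<in> carrier G" "\<gamma> \<in> carrier G" "\<gamma>' \<in> carrier G"
    using assms k' \<gamma>' K_carrier transversal_carrier by auto
  have "inv k' \<otimes> k = inv k' \<otimes> (k \<otimes> \<gamma>) \<otimes> inv \<gamma>"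
    using c by (simp add: m_assoc)
  also have "\<dots> = \<gamma>' \<otimes> inv \<gamma>"
    using c by (simp add: \<gamma>'(2) m_assoc[symmetric])
  finally have eq: "inv k' \<otimes> k = \<gamma>' \<otimes> inv \<gamma>" .
  have "inv k' \<otimes> k \<in> K 0"
    using assms k' subgroup_K[of 0] by (auto intro: subgroup.m_closed subgroup.m_inv_closed)
  moreover have "\<gamma>' \<otimes> inv \<gamma> \<in> \<Gamma>\<^sub>0"
    using assms \<gamma>' subgroup_transversal by (auto intro: subgroup.m_closed subgroup.m_inv_closed)
  ultimately have "inv k' \<otimes> k = \<one>"
    using eq transversal_Int by auto
  then have "k' = k' \<otimes> (inv k' \<otimes> k)"
    using c by simp
  also have "\<dots> = k"
    using c by (simp add: m_assoc[symmetric])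
  finally show "k' = k" .
qed (use assms in auto)

lemma proj:
  assumes "g \<in> carrier G"
  shows "proj g \<in> K 0" "\<exists>\<gamma>\<in>\<Gamma>\<^sub>0. g = proj g \<otimes> \<gamma>"
proof -
  obtain k \<gamma> where "k \<in> K 0" "\<gamma> \<in> \<Gamma>\<^sub>0" "g = k \<otimes> \<gamma>"
    using ex_transversal[OF assms] by blast
  then show "proj g \<in> K 0" "\<exists>\<gamma>\<in>\<Gamma>\<^sub>0. g = proj g \<otimes> \<gamma>"
    using proj_eq[of k \<gamma>] by auto
qed

text \<open>The action of \<open>G\<close> on \<open>G / \<Gamma>\<^sub>0\<close>, transported to \<open>K 0\<close>.\<close>

definition act :: "'a \<Rightarrow> 'a \<Rightarrow> 'a" where
  "act g k = proj (g \<otimes> k)"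

lemma act_in: "g \<in> carrier G \<Longrightarrow> k \<in> K 0 \<Longrightarrow> act g k \<in> K 0"
  unfolding act_def by (rule proj(1)[OF m_closed[OF _ K_carrier]])

lemma act_decomp:
  assumes "g \<in> carrier G" "k \<in> K 0"
  obtains \<gamma> where "\<gamma> \<in> \<Gamma>\<^sub>0" "g \<otimes> k = act g k \<otimes> \<gamma>"
  using proj(2)[OF m_closed[OF assms(1) K_carrier[OF assms(2)]]] unfolding act_def by blast

lemma act_act:
  assumes "g \<in> carrier G" "h \<in> carrier G" "k \<in> K 0"
  shows "act (g \<otimes> h) k = act g (act h k)"
proof -
  obtain \<gamma> where \<gamma>: "\<gamma> \<in> \<Gamma>\<^sub>0" "h \<otimes> k = act h k \<otimes> \<gamma>"
    using act_decomp assms by blast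
  have hk: "act h k \<in> K 0"
    using act_in assms by blast
  obtain \<gamma>' where \<gamma>': "\<gamma>' \<in> \<Gamma>\<^sub>0" "g \<otimes> act h k = act g (act h k) \<otimes> \<gamma>'"
    using act_decomp assms hk by blast
  have c: "k \<in> carrier G" "act h k \<in> carrier G" "act g (act h k) \<in> carrier G"
    "\<gamma> \<in> carrier G" "\<gamma>' \<in> carrier G"
    using assms hk \<gamma>(1) \<gamma>'(1) K_carrier[of _ 0] act_in[of g "act h k"] transversal_carrier by simp_all
  have "g \<otimes> h \<otimes> k = g \<otimes> act h k \<otimes> \<gamma>"
    using c assms \<gamma> by (simp add: m_assoc)
  also have "\<dots> = act g (act h k) \<otimes> (\<gamma>' \<otimes> \<gamma>)"
    using c assms \<gamma>' by (simp add: m_assoc)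
  finally have "g \<otimes> h \<otimes> k = act g (act h k) \<otimes> (\<gamma>' \<otimes> \<gamma>)" .
  moreover have "\<gamma>' \<otimes> \<gamma> \<in> \<Gamma>\<^sub>0"
    using \<gamma> \<gamma>' subgroup_transversal by (auto intro: subgroup.m_closed)
  ultimately show ?thesis
    using proj_eq act_in hk assms by (simp add: act_def)
qed

lemma act_one: "k \<in> K 0 \<Longrightarrow> act \<one> k = k"
  using proj_eq[of k \<one>] subgroup.one_closed[OF subgroup_transversal] K_carrier[of k 0]
  by (simp add: act_def)

text \<open>Since \<open>g u g^-1\<close> lies in \<open>K 0\<close>, it can be absorbed into the
  \<open>K 0\<close> part of the decomposition of \<open>g y\<close> without touching the part in
  \<open>\<Gamma>\<^sub>0\<close>.\<close>

lemma act_small: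
  assumes "g \<in> carrier G" "small_normalized g U" "u \<in> U" "y \<in> K 0"
  shows "act g (u \<otimes> y) = (g \<otimes> u \<otimes> inv g) \<otimes> act g y"
proof -
  obtain \<gamma> where \<gamma>: "\<gamma> \<in> \<Gamma>\<^sub>0" "g \<otimes> y = act g y \<otimes> \<gamma>"
    using act_decomp assms by blast
  have v: "g \<otimes> u \<otimes> inv g \<in> K 0" "u \<in> K 0"
    using assms unfolding small_normalized_def by auto
  have c: "u \<in> carrier G" "y \<in> carrier G" "\<gamma> \<in> carrier G" "act g y \<in> carrier G"
    using v(2) assms \<gamma>(1) transversal_carrier act_in[of g y] K_carrier[of _ 0] by simp_all
  have "g \<otimes> (u \<otimes> y) = (g \<otimes> u \<otimes> inv g) \<otimes> (g \<otimes> y)"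
    using c assms by (simp add: m_assoc[symmetric]) (simp add: m_assoc)
  also have "\<dots> = (g \<otimes> u \<otimes> inv g) \<otimes> act g y \<otimes> \<gamma>"
    using c assms \<gamma> by (simp add: m_assoc)
  finally show ?thesis
    using proj_eq[OF subgroup.m_closed[OF subgroup_K v(1) act_in[OF assms(1,4)]] \<gamma>(1)]
    by (simp add: act_def)
qed

lemma act_vimage:
  assumes "g \<in> carrier G" "small_normalized g U" "k \<in> K 0"
  shows "act g -` (U #> k) \<inter> K 0 = U #> act (inv g) k"
proof
  have y: "act (inv g) k \<in> K 0"
    using assms act_in by simp
  have gy: "act g (act (inv g) k) = k"
    using act_act[of g "inv g" k] assms act_one by simp
  show "U #> act (inv g) k \<subseteq> act g -` (U #> k) \<inter> K 0"
  proof
    fix x assume "x \<in> U #> act (inv g) k"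
    then obtain u where u: "u \<in> U" "x = u \<otimes> act (inv g) k"
      by (auto simp: r_coset_def)
    then have "act g x = (g \<otimes> u \<otimes> inv g) \<otimes> k"
      using act_small[OF assms(1,2) u(1) y] gy by simp
    moreover have "g \<otimes> u \<otimes> inv g \<in> U" "u \<in> K 0"
      using assms u unfolding small_normalized_def by auto
    ultimately show "x \<in> act g -` (U #> k) \<inter> K 0"
      using u y subgroup_K[of 0] by (auto simp: r_coset_def intro: subgroup.m_closed)
  qed
  show "act g -` (U #> k) \<inter> K 0 \<subseteq> U #> act (inv g) k"
  proof
    fix x assume "x \<in> act g -` (U #> k) \<inter> K 0"
    then obtain u where u: "u \<in> U" "act g x = u \<otimes> k" "x \<in> K 0"
      by (auto simp: r_coset_def)
    have "x = act (inv g) (act g x)"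
      using act_act[of "inv g" g x] assms u act_one by simp
    also have "\<dots> = (inv g \<otimes> u \<otimes> g) \<otimes> act (inv g) k"
      using act_small[OF _ small_normalized_inv[OF assms(1,2)] u(1) assms(3)] assms(1) u by simp
    finally show "x \<in> U #> act (inv g) k"
      using assms u unfolding small_normalized_def r_coset_def by blast
  qed
qed

definition preserving :: "'a set" where
  "preserving = {g \<in> carrier G. act g \<in> measurable haar haar \<and> distr haar haar (act g) = haar}"

text \<open>If \<open>U\<close> is normalized by \<open>g\<close>, then \<open>act g\<close> permutes the cosets \<open>U #> k\<close>, all of which have
  the same measure. No modular function has to be computed.\<close>

lemma small_normalizer_preserving:
  assumes "g \<in> small_normalizer"
  shows "g \<in> preserving"
proof -
  have g: "g \<in> carrier G"
    using assms by (simp add: small_normalizer_def)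
  have sets: "sets haar = sigma_sets (K 0) (small_cosets g)"
    using sets_haar sigma_sets_small_cosets[OF assms] by simp
  note sub = small_cosets_Pow[of g]
  have vim: "act g -` A \<inter> K 0 \<in> sets haar \<and> emeasure haar (act g -` A \<inter> K 0) = emeasure haar A"
    if A: "A \<in> small_cosets g" for A
  proof -
    consider "A = K 0" | "A = {}" | U x where "A = U #> x" "small_normalized g U" "x \<in> K 0"
      using A unfolding small_cosets_def by blast
    then show ?thesis
    proof cases
      case 1
      then have "act g -` A \<inter> K 0 = K 0"
        using act_in g by auto
      then show ?thesis
        using 1 sets.top[of haar] by (simp add: space_haar)
    next
      case 3
      then have "act (inv g) x \<in> K 0"
        using act_in g by simp
      then have "U #> act (inv g) x \<in> small_cosets g"
        using 3 unfolding small_cosets_def by blast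
      then show ?thesis
        using act_vimage[OF g 3(2,3)] 3 \<open>act (inv g) x \<in> K 0\<close>
        by (auto simp: sets emeasure_rcos)
    qed simp
  qed
  have meas: "act g \<in> measurable haar haar"
    by (rule measurable_sigma_sets[OF sets sub])
      (use vim act_in g in \<open>auto simp: space_haar\<close>)
  moreover have "distr haar haar (act g) = haar"
  proof (rule measure_eqI_generator_eq[OF Int_stable_small_cosets sub, where A = "\<lambda>_. K 0"])
    fix A assume A: "A \<in> small_cosets g"
    then have "A \<in> sets haar"
      by (auto simp: sets)
    then show "emeasure (distr haar haar (act g)) A = emeasure haar A"
      using vim[OF A] by (simp add: emeasure_distr[OF meas] space_haar)
  next
    show "emeasure (distr haar haar (act g)) (K 0) \<noteq> \<infinity>" for i :: nat
    proof -
      have "act g -` K 0 \<inter> K 0 = K 0"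
        using act_in g by auto
      then show ?thesis
        using sets.top[of haar]
        by (simp add: emeasure_distr[OF meas] space_haar emeasure_haar[OF level_K[of 0]])
    qed
  qed (auto simp: sets small_cosets_def)
  ultimately show ?thesis
    using g by (simp add: preserving_def)
qed

lemma preserving_carrier: "carrier G \<subseteq> preserving"
proof
  fix g assume "g \<in> carrier G"
  then have "g \<in> generate G small_normalizer"
    using generators by simp
  then show "g \<in> preserving"
  proof induction
    case one
    have "\<one> \<in> small_normalizer"
      using K0_subset_small_normalizer subgroup.one_closed[OF subgroup_K] by blast
    then show ?case
      by (rule small_normalizer_preserving)
  next
    case (incl h)
    then show ?case by (rule small_normalizer_preserving)
  next
    case (inv h)
    then show ?case by (intro small_normalizer_preserving small_normalizer_inv)
  next
    case (eng h1 h2)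
    then have h: "h1 \<in> carrier G" "h2 \<in> carrier G"
      and m: "act h1 \<in> measurable haar haar" "act h2 \<in> measurable haar haar"
      and d: "distr haar haar (act h1) = haar" "distr haar haar (act h2) = haar"
      by (auto simp: preserving_def)
    have eq: "act (h1 \<otimes> h2) x = (act h1 \<circ> act h2) x" if "x \<in> space haar" for x
      using act_act h that by (simp add: space_haar)
    have "act (h1 \<otimes> h2) \<in> measurable haar haar"
      using measurable_comp[OF m(2,1)] by (subst measurable_cong[OF eq])
    moreover have "distr haar haar (act (h1 \<otimes> h2)) = haar"
      using distr_distr[OF m] d by (subst distr_cong[OF refl refl eq]) auto
    ultimately show ?case
      using h by (simp add: preserving_def)
  qed
qed

section \<open>The invariant measure on the coset space of a larger subgroup\<close>

lemma topspace_coset_topology: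
  "topspace (coset_topology G X \<Gamma>) = lcosets \<Gamma>"
proof -
  have "topspace (coset_topology G X \<Gamma>) = (\<lambda>g. g <# \<Gamma>) ` carrier G"
    using quotient_imp_surjective_map[OF quotient_map_coset_topology[OF topspace_X, of \<Gamma>]]
    unfolding topspace_X by (rule sym)
  then show ?thesis
    by (auto simp: LCOSETS_def)
qed

context
  fixes \<Gamma>
  assumes \<Gamma>: "subgroup \<Gamma> G" "\<Gamma>\<^sub>0 \<subseteq> \<Gamma>"
begin

text \<open>Equivariance of \<open>k \<mapsto> k \<Gamma>\<close>: the factor from
  \<open>\<Gamma>\<^sub>0\<close> by which \<open>g k\<close> and \<open>act g k\<close> differ is
  swallowed by \<open>\<Gamma>\<close>. Invariance of \<open>haar\<close> under \<open>act\<close>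
  thereby descends to the cosets.\<close>

lemma l_coset_act:
  assumes "g \<in> carrier G" "k \<in> K 0"
  shows "act g k <# \<Gamma> = g <# (k <# \<Gamma>)"
proof -
  obtain \<gamma> where \<gamma>: "\<gamma> \<in> \<Gamma>\<^sub>0" "g \<otimes> k = act g k \<otimes> \<gamma>"
    using act_decomp assms by blast
  have c: "act g k \<in> carrier G" "k \<in> carrier G"
    using assms act_in K_carrier by auto
  have "g \<otimes> k \<in> act g k <# \<Gamma>"
    using \<gamma> \<Gamma> by (auto simp: l_coset_def)
  then have "act g k <# \<Gamma> = (g \<otimes> k) <# \<Gamma>"
    using c \<Gamma> by (intro l_repr_independence) auto
  then show ?thesis
    using lcos_m_assoc[OF subgroup.subset[OF \<Gamma>(1)] assms(1) c(2)] by simp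
qed

lemma coset_image_K: "(\<lambda>g. g <# \<Gamma>) ` K 0 = lcosets \<Gamma>"
proof
  show "(\<lambda>g. g <# \<Gamma>) ` K 0 \<subseteq> lcosets \<Gamma>"
    using K_carrier by (auto simp: LCOSETS_def)
  show "lcosets \<Gamma> \<subseteq> (\<lambda>g. g <# \<Gamma>) ` K 0"
  proof
    fix C assume "C \<in> lcosets \<Gamma>"
    then obtain g where g: "g \<in> carrier G" "C = g <# \<Gamma>"
      by (auto simp: LCOSETS_def)
    have "\<one> \<in> K 0"
      using subgroup.one_closed[OF subgroup_K] .
    then have "C = act g \<one> <# \<Gamma>" "act g \<one> \<in> K 0"
      using l_coset_act[of g \<one>] g act_in lcos_mult_one[OF subgroup.subset[OF \<Gamma>(1)]] by auto
    then show "C \<in> (\<lambda>g. g <# \<Gamma>) ` K 0" by blast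
  qed
qed

abbreviation (input) coset_sigma :: "'a set measure" where
  "coset_sigma \<equiv> sigma (lcosets \<Gamma>) {U. openin (coset_topology G X \<Gamma>) U}"

lemma openin_coset_Pow: "{U. openin (coset_topology G X \<Gamma>) U} \<subseteq> Pow (lcosets \<Gamma>)"
  by (auto simp: openin_coset_topology)

lemma measurable_coset: "(\<lambda>k. k <# \<Gamma>) \<in> measurable haar coset_sigma"
proof (rule measurable_measure_of[OF openin_coset_Pow])
  show "(\<lambda>k. k <# \<Gamma>) \<in> space haar \<rightarrow> lcosets \<Gamma>"
    using coset_image_K by (auto simp: space_haar)
  fix U assume "U \<in> {U. openin (coset_topology G X \<Gamma>) U}"
  then have "openin X {g \<in> carrier G. g <# \<Gamma> \<in> U}"
    by (simp add: openin_coset_topology)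
  then have "{g \<in> carrier G. g <# \<Gamma> \<in> U} \<inter> K 0 \<in> sets haar"
    by (rule openin_Int_sets_haar)
  moreover have "{g \<in> carrier G. g <# \<Gamma> \<in> U} \<inter> K 0 = (\<lambda>k. k <# \<Gamma>) -` U \<inter> space haar"
    using K_carrier by (auto simp: space_haar)
  ultimately show "(\<lambda>k. k <# \<Gamma>) -` U \<inter> space haar \<in> sets haar"
    by simp
qed

lemma openin_translate:
  assumes "openin X U" "h \<in> carrier G"
  shows "openin X {x \<in> carrier G. h \<otimes> x \<in> U}"
  unfolding openin_iff
proof (intro conjI ballI)
  fix x assume x: "x \<in> {x \<in> carrier G. h \<otimes> x \<in> U}"
  then obtain m where m: "(h \<otimes> x) <# K m \<subseteq> U"
    using assms unfolding openin_iff by blast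
  have "h \<otimes> (x \<otimes> k) \<in> U" if "k \<in> K m" for k
  proof -
    have "h \<otimes> (x \<otimes> k) = h \<otimes> x \<otimes> k"
      using x assms that K_carrier by (simp add: m_assoc)
    then show ?thesis
      using m that unfolding l_coset_def by auto
  qed
  then have "x <# K m \<subseteq> {x \<in> carrier G. h \<otimes> x \<in> U}"
    using x K_carrier by (auto simp: l_coset_def)
  then show "\<exists>m. x <# K m \<subseteq> {x \<in> carrier G. h \<otimes> x \<in> U}" by blast
qed auto

lemma lcosets_translate:
  assumes "h \<in> carrier G" "C \<in> lcosets \<Gamma>"
  shows "h <# C \<in> lcosets \<Gamma>"
proof -
  obtain g where g: "g \<in> carrier G" "C = g <# \<Gamma>"
    using assms by (auto simp: LCOSETS_def)
  then have "h <# C = (h \<otimes> g) <# \<Gamma>"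
    using lcos_m_assoc[OF subgroup.subset[OF \<Gamma>(1)] assms(1) g(1)] by simp
  then show ?thesis
    using assms g by (auto simp: LCOSETS_def)
qed

lemma measurable_translate:
  assumes "h \<in> carrier G"
  shows "(\<lambda>C. h <# C) \<in> measurable coset_sigma coset_sigma"
proof (rule measurable_measure_of[OF openin_coset_Pow])
  have sp: "space coset_sigma = lcosets \<Gamma>"
    using openin_coset_Pow by (simp add: space_measure_of_conv)
  show "(\<lambda>C. h <# C) \<in> space coset_sigma \<rightarrow> lcosets \<Gamma>"
    using lcosets_translate assms by (auto simp: sp)
  fix U assume U: "U \<in> {U. openin (coset_topology G X \<Gamma>) U}"
  have "openin (coset_topology G X \<Gamma>) ((\<lambda>C. h <# C) -` U \<inter> lcosets \<Gamma>)"
    unfolding openin_coset_topology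
  proof
    have "openin X {x \<in> carrier G. h \<otimes> x \<in> {g \<in> carrier G. g <# \<Gamma> \<in> U}}"
    proof (rule openin_translate[OF _ assms])
      show "openin X {g \<in> carrier G. g <# \<Gamma> \<in> U}"
        using U by (simp add: openin_coset_topology)
    qed
    moreover have "{g \<in> carrier G. g <# \<Gamma> \<in> (\<lambda>C. h <# C) -` U \<inter> lcosets \<Gamma>} =
      {x \<in> carrier G. h \<otimes> x \<in> {g \<in> carrier G. g <# \<Gamma> \<in> U}}"
      using assms lcos_m_assoc[OF subgroup.subset[OF \<Gamma>(1)]] by (auto simp: LCOSETS_def)
    ultimately show "openin X {g \<in> carrier G. g <# \<Gamma> \<in> (\<lambda>C. h <# C) -` U \<inter> lcosets \<Gamma>}"
      by (simp only:)
  qed auto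
  then show "(\<lambda>C. h <# C) -` U \<inter> space coset_sigma \<in> sets coset_sigma"
    using openin_coset_Pow by (auto simp: sp)
qed

lemma ex_finite_invariant_measure:
  "\<exists>M. finite_invariant_measure G X \<Gamma> M"
proof -
  let ?q = "\<lambda>k. k <# \<Gamma>"
  let ?M = "distr haar coset_sigma ?q"
  have sp: "space coset_sigma = lcosets \<Gamma>"
    using openin_coset_Pow by (simp add: space_measure_of_conv)
  have K: "?q -` (lcosets \<Gamma>) \<inter> K 0 = K 0"
    using coset_image_K by auto
  have one: "\<one> \<in> K 0"
    using subgroup.one_closed[OF subgroup_K] .
  have total: "emeasure ?M (space ?M) = 1"
    using num_pos[OF one, of 0] sets.top[of coset_sigma]
    by (simp add: emeasure_distr[OF measurable_coset] sp K space_haar emeasure_haar[OF level_K[of 0]])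
  have "emeasure ?M ((\<lambda>C. g <# C) ` A) = emeasure ?M A"
    if g: "g \<in> carrier G" and A: "A \<in> sets ?M" for g A
  proof -
    have A': "A \<subseteq> lcosets \<Gamma>" "A \<in> sets coset_sigma"
      using A sets.sets_into_space[OF A] by (auto simp: sp)
    have inv: "inv g <# (g <# C) = C" "g <# (inv g <# C) = C" if "C \<in> lcosets \<Gamma>" for C
    proof -
      have "C \<subseteq> carrier G"
        using that subgroup.subset[OF \<Gamma>(1)] by (auto simp: LCOSETS_def l_coset_def)
      then show "inv g <# (g <# C) = C" "g <# (inv g <# C) = C"
        using g by (simp_all add: lcos_m_assoc lcos_mult_one)
    qed
    have img: "(\<lambda>C. g <# C) ` A = (\<lambda>C. inv g <# C) -` A \<inter> lcosets \<Gamma>"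
    proof (intro equalityI subsetI)
      fix C assume "C \<in> (\<lambda>C. g <# C) ` A"
      then obtain D where D: "D \<in> A" "C = g <# D" by blast
      then have "D \<in> lcosets \<Gamma>"
        using A' by blast
      then show "C \<in> (\<lambda>C. inv g <# C) -` A \<inter> lcosets \<Gamma>"
        using D inv(1) lcosets_translate[OF g] by simp
    next
      fix C assume "C \<in> (\<lambda>C. inv g <# C) -` A \<inter> lcosets \<Gamma>"
      then have "inv g <# C \<in> A" "C = g <# (inv g <# C)"
        using inv(2)[of C] by simp_all
      then show "C \<in> (\<lambda>C. g <# C) ` A"
        by (rule rev_image_eqI)
    qed
    have gA: "(\<lambda>C. g <# C) ` A \<in> sets coset_sigma"
      using measurable_sets[OF measurable_translate[OF inv_closed[OF g]] A'(2)]
      unfolding img sp .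
    \<comment> \<open>Equivariance in terms of preimages: translating a set of cosets by
      \<open>g\<close> amounts to pulling its preimage in \<open>K 0\<close> back along
      \<open>act (inv g)\<close>, which preserves \<open>haar\<close>.\<close>
    have "?q -` ((\<lambda>C. g <# C) ` A) \<inter> K 0 = act (inv g) -` (?q -` A \<inter> K 0) \<inter> K 0"
    proof -
      have "?q k \<in> lcosets \<Gamma>" "inv g <# ?q k = ?q (act (inv g) k)" "act (inv g) k \<in> K 0"
        if "k \<in> K 0" for k
        using that g coset_image_K l_coset_act[of "inv g" k] act_in[of "inv g" k] by auto
      then show ?thesis
        unfolding img by blast
    qed
    moreover have "act (inv g) \<in> measurable haar haar" "distr haar haar (act (inv g)) = haar"
      using preserving_carrier g by (auto simp: preserving_def)
    moreover have "?q -` A \<inter> K 0 \<in> sets haar"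
      using measurable_sets[OF measurable_coset A'(2)] by (simp add: space_haar)
    ultimately have "emeasure haar (?q -` ((\<lambda>C. g <# C) ` A) \<inter> K 0) = emeasure haar (?q -` A \<inter> K 0)"
      using emeasure_distr[of "act (inv g)" haar haar "?q -` A \<inter> K 0"] by (simp add: space_haar)
    then show ?thesis
      using A' gA by (simp add: emeasure_distr[OF measurable_coset] space_haar)
  qed
  moreover have "finite_measure ?M"
    by (rule finite_measureI) (simp only: total, simp)
  ultimately have "finite_invariant_measure G X \<Gamma> ?M"
    using total openin_coset_Pow
    by (auto simp: finite_invariant_measure_def topspace_coset_topology sp)
  then show ?thesis by blast
qed

text \<open>The groups \<open>K m\<close> shrink to the identity, so one of them misses the finitely
  many other elements of the stabilizer; its left cosets isolate the points of
  \<open>\<Gamma>\<close>.\<close>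

lemma discrete_subset_finite_stabilizer:
  assumes "finite (\<Gamma> \<inter> K 0)"
  shows "discrete_subset X \<Gamma>"
proof -
  have "\<exists>m. \<Gamma> \<inter> K m \<subseteq> {\<one>}"
  proof -
    have "\<exists>m. \<gamma> \<notin> K m" if "\<gamma> \<noteq> \<one>" for \<gamma>
      using that Inter_K by blast
    then obtain f where f: "\<gamma> \<noteq> \<one> \<Longrightarrow> \<gamma> \<notin> K (f \<gamma>)" for \<gamma>
      by metis
    obtain N where N: "\<forall>i\<in>f ` (\<Gamma> \<inter> K 0). i \<le> N"
      using assms finite_nat_set_iff_bounded_le by blast
    have "\<gamma> = \<one>" if "\<gamma> \<in> \<Gamma> \<inter> K N" for \<gamma>
      using that f[of \<gamma>] N K_mono[of "f \<gamma>" N] K_K0 by auto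
    then show ?thesis by blast
  qed
  then obtain m where m: "\<Gamma> \<inter> K m \<subseteq> {\<one>}" by blast
  have "openin (subtopology X \<Gamma>) {\<gamma>}" if "\<gamma> \<in> \<Gamma>" for \<gamma>
  proof -
    have c: "\<gamma> \<in> carrier G"
      using that \<Gamma> subgroup.subset by blast
    have "(\<gamma> <# K m) \<inter> \<Gamma> = {\<gamma>}"
    proof
      show "(\<gamma> <# K m) \<inter> \<Gamma> \<subseteq> {\<gamma>}"
      proof
        fix x assume "x \<in> (\<gamma> <# K m) \<inter> \<Gamma>"
        then obtain k where k: "k \<in> K m" "x = \<gamma> \<otimes> k" "x \<in> \<Gamma>"
          by (auto simp: l_coset_def)
        have "inv \<gamma> \<otimes> x \<in> \<Gamma>"
            using k(3) that \<Gamma> by (auto intro: subgroup.m_closed subgroup.m_inv_closed)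
          moreover have "k = inv \<gamma> \<otimes> x"
            using c k K_carrier by (simp add: m_assoc[symmetric])
          ultimately have "k \<in> \<Gamma>"
            by simp
          then show "x \<in> {\<gamma>}"
          using m k c by auto
      qed
      show "{\<gamma>} \<subseteq> (\<gamma> <# K m) \<inter> \<Gamma>"
        using that c lcos_self[OF _ subgroup_K] by auto
    qed
    then show ?thesis
      using openin_l_coset[OF c, of m] by (metis openin_subtopology)
  qed
  moreover have "topspace (subtopology X \<Gamma>) = \<Gamma>"
    using subgroup.subset[OF \<Gamma>(1)] by (auto simp: topspace_X)
  ultimately show ?thesis
    unfolding discrete_subset_def by (metis discrete_topology_unique)
qed

theorem cocompact_latticeI:
  assumes "finite (\<Gamma> \<inter> K 0)"
  shows "cocompact_lattice_in G X \<Gamma>"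
proof -
  have "compactin (coset_topology G X \<Gamma>) ((\<lambda>g. g <# \<Gamma>) ` K 0)"
    using compactin_K quotient_imp_continuous_map[OF quotient_map_coset_topology[OF topspace_X]]
    by (rule image_compactin)
  then have "compact_space (coset_topology G X \<Gamma>)"
    unfolding coset_image_K compact_space_def topspace_coset_topology .
  then show ?thesis
    unfolding cocompact_lattice_in_def lattice_in_def
    using \<Gamma> ex_finite_invariant_measure discrete_subset_finite_stabilizer[OF assms] by blast
qed

end

end

section \<open>Products of regular trees\<close>

lemma (in filtered_group) not_discrete_subset:
  assumes "\<one> \<in> S" "\<And>m. \<exists>s\<in>S \<inter> K m. s \<noteq> \<one>"
  shows "\<not> discrete_subset X S"
proof
  assume "discrete_subset X S"
  then have "openin (subtopology X S) {\<one>}"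
    using assms(1) by (simp add: discrete_subset_def)
  then obtain U where U: "openin X U" "{\<one>} = U \<inter> S"
    by (auto simp: openin_subtopology)
  then obtain m where m: "\<one> <# K m \<subseteq> U"
    unfolding openin_iff by blast
  obtain s where s: "s \<in> S" "s \<in> K m" "s \<noteq> \<one>"
    using assms(2)[of m] by blast
  have "\<one> \<otimes> s = s"
    using s(2) K_carrier by simp
  then have "s \<in> \<one> <# K m"
    using s(2) unfolding l_coset_def by force
  then show False
    using s m U(2) by blast
qed

section \<open>Topology of the automorphism group of a tree\<close>

lemma Nil_tree_verts: "[] \<in> tree_verts k"
  by (simp add: tree_verts_def)

lemma finite_tree_ball: "finite {v \<in> tree_verts k. length v \<le> m}"
  by (rule finite_subset[OF _ finite_lists_length_le[of "{..<k}" m]]) (auto simp: tree_verts_def)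

lemma graph_auts_D:
  assumes "f \<in> graph_auts V E"
  shows "f \<in> extensional V" "bij_betw f V V" "\<And>v. v \<in> V \<Longrightarrow> f v \<in> V"
    "\<And>v w. v \<in> V \<Longrightarrow> w \<in> V \<Longrightarrow> (f v, f w) \<in> E \<longleftrightarrow> (v, w) \<in> E"
  using assms by (auto simp: graph_auts_def Bij_def dest: bij_betwE)

lemma graph_auts_I:
  assumes "f \<in> extensional V" "bij_betw f V V"
    "\<And>v w. v \<in> V \<Longrightarrow> w \<in> V \<Longrightarrow> (f v, f w) \<in> E \<longleftrightarrow> (v, w) \<in> E"
  shows "f \<in> graph_auts V E"
  using assms by (auto simp: graph_auts_def Bij_def)

text \<open>The depth changes by one at each step of the path from the root. In particular an
  automorphism that fixes the root maps every ball around it into itself.\<close>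

lemma tree_aut_length_le:
  assumes "f \<in> graph_auts (tree_verts k) (tree_edges k)" "v \<in> tree_verts k"
  shows "length (f v) \<le> length (f []) + length v"
  using assms(2)
proof (induction v)
  case (Cons a v)
  have v: "v \<in> tree_verts k"
    using Cons.prems by (rule tree_verts_ConsD)
  have "(a # v, v) \<in> tree_edges k"
    using Cons.prems v by (auto simp: tree_edges_def)
  then have "(f (a # v), f v) \<in> tree_edges k"
    using graph_auts_D(4)[OF assms(1) Cons.prems v] by simp
  then have "length (f (a # v)) \<le> Suc (length (f v))"
    by (auto simp: tree_edges_def)
  then show ?case
    using Cons.IH[OF v] by simp
qed simp

definition ball_stab :: "nat set \<Rightarrow> (nat \<Rightarrow> nat) \<Rightarrow> nat \<Rightarrow> (nat \<Rightarrow> nat list \<Rightarrow> nat list) set" where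
  "ball_stab I d m = {g \<in> carrier (tree_prod_group I d).
     \<forall>i\<in>I. \<forall>v\<in>tree_verts (d i). length v \<le> m \<longrightarrow> g i v = v}"

text \<open>A basic open set constrains finitely many vertices, and these lie in some ball around
  the root.\<close>

lemma openin_aut_topology_agree:
  assumes "openin (aut_topology (tree_verts k) E) W" "f \<in> W"
  shows "\<exists>m. \<forall>h\<in>graph_auts (tree_verts k) E.
    (\<forall>v\<in>tree_verts k. length v \<le> m \<longrightarrow> h v = f v) \<longrightarrow> h \<in> W"
proof -
  let ?V = "tree_verts k"
  obtain W' where W': "openin (product_topology (\<lambda>_. discrete_topology ?V) ?V) W'"
    "W = W' \<inter> graph_auts ?V E"
    using assms(1) by (auto simp: aut_topology_def openin_subtopology)
  then obtain U where U: "finite {v \<in> ?V. U v \<noteq> ?V}" "f \<in> Pi\<^sub>E ?V U" "Pi\<^sub>E ?V U \<subseteq> W'"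
    using assms(2) unfolding openin_product_topology_alt by fastforce
  obtain m where m: "\<forall>l\<in>length ` {v \<in> ?V. U v \<noteq> ?V}. l \<le> m"
    using U(1) finite_nat_set_iff_bounded_le finite_imageI by meson
  have "h \<in> W" if h: "h \<in> graph_auts ?V E" "\<forall>v\<in>?V. length v \<le> m \<longrightarrow> h v = f v" for h
  proof -
    have "h v \<in> U v" if v: "v \<in> ?V" for v
    proof (cases "U v = ?V")
      case True
      then show ?thesis
        using graph_auts_D(3)[OF h(1) v] by simp
    next
      case False
      then show ?thesis
        using h(2) m v U(2) by auto
    qed
    then have "h \<in> Pi\<^sub>E ?V U"
      using graph_auts_D(1)[OF h(1)] by (simp add: PiE_iff)
    then show ?thesis
      using U(3) W'(2) h(1) by blast
  qed
  then show ?thesis by blast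
qed

lemma openin_aut_topology_ball:
  assumes "f \<in> graph_auts (tree_verts k) E"
  shows "openin (aut_topology (tree_verts k) E)
    {h \<in> graph_auts (tree_verts k) E. \<forall>v\<in>tree_verts k. length v \<le> m \<longrightarrow> h v = f v}"
proof -
  let ?V = "tree_verts k"
  let ?U = "\<lambda>v. if v \<in> ?V \<and> length v \<le> m then {f v} else ?V"
  have "openin (product_topology (\<lambda>_. discrete_topology ?V) ?V) (Pi\<^sub>E ?V ?U)"
  proof (rule product_topology_basis)
    show "openin (discrete_topology ?V) (?U v)" for v
      using graph_auts_D(3)[OF assms] by simp
    have "{v. ?U v \<noteq> topspace (discrete_topology ?V)} \<subseteq> {v \<in> ?V. length v \<le> m}"
      by auto
    then show "finite {v. ?U v \<noteq> topspace (discrete_topology ?V)}"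
      by (rule finite_subset[OF _ finite_tree_ball])
  qed
  moreover have "{h \<in> graph_auts ?V E. \<forall>v\<in>?V. length v \<le> m \<longrightarrow> h v = f v} =
    Pi\<^sub>E ?V ?U \<inter> graph_auts ?V E"
    using graph_auts_D(1,3)[of _ ?V E] by (auto simp: PiE_iff extensional_def split: if_splits)
  ultimately show ?thesis
    unfolding aut_topology_def openin_subtopology by blast
qed

lemma closedin_function_pair:
  assumes "v \<in> V" "w \<in> V"
  shows "closedin (product_topology (\<lambda>_. discrete_topology V) V)
    {f \<in> topspace (product_topology (\<lambda>_. discrete_topology V) V). R (f v) (f w)}"
proof -
  let ?P = "product_topology (\<lambda>_. discrete_topology V) V"
  have op: "openin ?P {f \<in> topspace ?P. f u \<in> {a}}" if "u \<in> V" "a \<in> V" for u a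
    by (rule openin_continuous_map_preimage[OF continuous_map_product_projection[OF that(1)]])
      (use that in simp)
  have "openin ?P (\<Union>(a, b)\<in>{(a, b). a \<in> V \<and> b \<in> V \<and> \<not> R a b}.
      {f \<in> topspace ?P. f v \<in> {a}} \<inter> {f \<in> topspace ?P. f w \<in> {b}})"
    using op assms by (intro openin_Union openin_Int) auto
  moreover have "(\<Union>(a, b)\<in>{(a, b). a \<in> V \<and> b \<in> V \<and> \<not> R a b}.
      {f \<in> topspace ?P. f v \<in> {a}} \<inter> {f \<in> topspace ?P. f w \<in> {b}}) =
      topspace ?P - {f \<in> topspace ?P. R (f v) (f w)}"
    using assms by (auto simp: PiE_iff extensional_def)
  ultimately show ?thesis
    unfolding closedin_def by auto
qed

text \<open>This is a closed subset of a product of finite balls: injectivity and preservation of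
  adjacency are conditions on two values at a time, and surjectivity comes for free, as each finite
  ball is mapped injectively into itself.\<close>

lemma compactin_root_stab:
  "compactin (aut_topology (tree_verts k) (tree_edges k))
     {f \<in> graph_auts (tree_verts k) (tree_edges k). f [] = []}"
proof -
  let ?V = "tree_verts k" and ?E = "tree_edges k"
  let ?P = "product_topology (\<lambda>_. discrete_topology ?V) ?V"
  define B where "B = (\<Pi>\<^sub>E v\<in>?V. {w \<in> ?V. length w \<le> length v})"
  define C where "C v w = {f \<in> topspace ?P. (f v = f w \<longrightarrow> v = w) \<and> ((f v, f w) \<in> ?E \<longleftrightarrow> (v, w) \<in> ?E)}" for v w
  have B: "compactin ?P B"
    unfolding B_def compactin_PiE using finite_tree_ball by (auto simp: compactin_discrete_topology)
  have "closedin ?P B"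
    unfolding B_def closedin_product_topology by auto
  moreover have "closedin ?P (C v w)" if "v \<in> ?V" "w \<in> ?V" for v w
    unfolding C_def using closedin_function_pair[OF that,
        of "\<lambda>a b. (a = b \<longrightarrow> v = w) \<and> ((a, b) \<in> ?E \<longleftrightarrow> (v, w) \<in> ?E)"] by simp
  ultimately have "closedin ?P (\<Inter>(insert B {C v w |v w. v \<in> ?V \<and> w \<in> ?V}))"
    by (intro closedin_Inter) auto
  then have comp: "compactin ?P (\<Inter>(insert B {C v w |v w. v \<in> ?V \<and> w \<in> ?V}))"
    by (rule closed_compactin[OF B, rotated]) auto
  have "\<Inter>(insert B {C v w |v w. v \<in> ?V \<and> w \<in> ?V}) = {f \<in> graph_auts ?V ?E. f [] = []}"
  proof (intro equalityI subsetI)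
    fix f assume f: "f \<in> \<Inter>(insert B {C v w |v w. v \<in> ?V \<and> w \<in> ?V})"
    then have fB: "f \<in> B" and fC: "\<And>v w. v \<in> ?V \<Longrightarrow> w \<in> ?V \<Longrightarrow> f \<in> C v w"
      by blast+
    have ball: "f v \<in> ?V" "length (f v) \<le> length v" if "v \<in> ?V" for v
      using fB that unfolding B_def by auto
    have inj: "inj_on f ?V"
      using fC unfolding C_def inj_on_def by simp
    have "w \<in> f ` ?V" if w: "w \<in> ?V" for w
    proof -
      let ?A = "{v \<in> ?V. length v \<le> length w}"
      have "f ` ?A \<subseteq> ?A"
        using ball by fastforce
      moreover have "inj_on f ?A"
        using inj by (rule inj_on_subset) auto
      ultimately have "f ` ?A = ?A"
        by (intro endo_inj_surj finite_tree_ball)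
      then show ?thesis
        using w by blast
    qed
    then have "bij_betw f ?V ?V"
      using inj ball unfolding bij_betw_def by blast
    moreover have "f \<in> extensional ?V"
      using fB unfolding B_def by (simp add: PiE_iff)
    ultimately have "f \<in> graph_auts ?V ?E"
      using fC unfolding C_def by (intro graph_auts_I) auto
    moreover have "f [] = []"
      using ball(2)[OF Nil_tree_verts] by simp
    ultimately show "f \<in> {f \<in> graph_auts ?V ?E. f [] = []}" by simp
  next
    fix f assume f: "f \<in> {f \<in> graph_auts ?V ?E. f [] = []}"
    then have a: "f \<in> graph_auts ?V ?E" by simp
    have "f \<in> B"
      unfolding B_def using graph_auts_D(1,3)[OF a] tree_aut_length_le[OF a] f by (auto simp: PiE_iff)
    moreover have "f \<in> C v w" if "v \<in> ?V" "w \<in> ?V" for v w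
      unfolding C_def using that graph_auts_D[OF a] by (auto simp: PiE_iff bij_betw_def dest: inj_onD)
    ultimately show "f \<in> \<Inter>(insert B {C v w |v w. v \<in> ?V \<and> w \<in> ?V})" by blast
  qed
  then show ?thesis
    using comp unfolding aut_topology_def by (auto simp: compactin_subtopology)
qed

section \<open>Products of trees, filtered by the pointwise stabilizers of balls\<close>

locale tree_product =
  fixes I :: "nat set" and d :: "nat \<Rightarrow> nat"
  assumes finite_I: "finite I"
begin

abbreviation (input) G where "G \<equiv> tree_prod_group I d"
abbreviation (input) T where "T \<equiv> tree_prod_topology I d"
abbreviation (input) V where "V i \<equiv> tree_verts (d i)"

lemma carrier_iff:
  "g \<in> carrier G \<longleftrightarrow> g \<in> (\<Pi>\<^sub>E i\<in>I. graph_auts (V i) (tree_edges (d i)))"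
  by (simp add: tree_prod_group_def aut_group_def)

lemma carrierD: "g \<in> carrier G \<Longrightarrow> i \<in> I \<Longrightarrow> g i \<in> graph_auts (V i) (tree_edges (d i))"
  by (auto simp: carrier_iff)

lemma apply_in: "g \<in> carrier G \<Longrightarrow> i \<in> I \<Longrightarrow> v \<in> V i \<Longrightarrow> g i v \<in> V i"
  using graph_auts_D(3)[OF carrierD] .

lemma mult_apply:
  assumes "g \<in> carrier G" "h \<in> carrier G" "i \<in> I" "v \<in> V i"
  shows "(g \<otimes>\<^bsub>G\<^esub> h) i v = g i (h i v)"
proof -
  have "g i \<in> Bij (V i)" "h i \<in> Bij (V i)"
    using carrierD[OF assms(1,3)] carrierD[OF assms(2,3)] by (simp_all add: graph_auts_def)
  then show ?thesis
    using assms by (simp add: tree_prod_group_def aut_group_def BijGroup_def compose_eq)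
qed

lemma one_apply: "i \<in> I \<Longrightarrow> v \<in> V i \<Longrightarrow> \<one>\<^bsub>G\<^esub> i v = v"
  by (simp add: tree_prod_group_def aut_group_def BijGroup_def)

lemma eqI:
  assumes "g \<in> carrier G" "h \<in> carrier G" "\<And>i v. i \<in> I \<Longrightarrow> v \<in> V i \<Longrightarrow> g i v = h i v"
  shows "g = h"
proof (rule PiE_ext)
  show "g \<in> (\<Pi>\<^sub>E i\<in>I. graph_auts (V i) (tree_edges (d i)))"
    "h \<in> (\<Pi>\<^sub>E i\<in>I. graph_auts (V i) (tree_edges (d i)))"
    using assms carrier_iff by auto
  fix i assume i: "i \<in> I"
  show "g i = h i"
    by (rule extensionalityI[OF graph_auts_D(1)[OF carrierD[OF assms(1) i]]
          graph_auts_D(1)[OF carrierD[OF assms(2) i]]]) (use assms(3) i in auto)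
qed

sublocale group G
  by (rule group_tree_prod_group)

lemma inv_apply:
  assumes "g \<in> carrier G" "i \<in> I" "v \<in> V i"
  shows "(inv\<^bsub>G\<^esub> g) i (g i v) = v" "g i ((inv\<^bsub>G\<^esub> g) i v) = v"
proof -
  show "(inv\<^bsub>G\<^esub> g) i (g i v) = v"
    using mult_apply[OF inv_closed[OF assms(1)] assms]
    unfolding l_inv[OF assms(1)] one_apply[OF assms(2,3)] by simp
  show "g i ((inv\<^bsub>G\<^esub> g) i v) = v"
    using mult_apply[OF assms(1) inv_closed[OF assms(1)] assms(2,3)]
    unfolding r_inv[OF assms(1)] one_apply[OF assms(2,3)] by simp
qed

lemma ball_stabD:
  assumes "g \<in> ball_stab I d m"
  shows "g \<in> carrier G" "\<And>i v. i \<in> I \<Longrightarrow> v \<in> V i \<Longrightarrow> length v \<le> m \<Longrightarrow> g i v = v"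
  using assms by (auto simp: ball_stab_def)

lemma ball_stab_inv:
  assumes "g \<in> ball_stab I d m"
  shows "inv\<^bsub>G\<^esub> g \<in> ball_stab I d m"
proof -
  note g = ball_stabD[OF assms]
  have "(inv\<^bsub>G\<^esub> g) i v = v" if "i \<in> I" "v \<in> V i" "length v \<le> m" for i v
    using inv_apply(1)[OF g(1) that(1,2)] g(2)[OF that] by simp
  then show ?thesis
    using g(1) by (simp add: ball_stab_def)
qed

lemma subgroup_ball_stab: "subgroup (ball_stab I d m) G"
proof (rule subgroupI)
  show "ball_stab I d m \<subseteq> carrier G"
    by (auto simp: ball_stab_def)
  have "\<one>\<^bsub>G\<^esub> \<in> ball_stab I d m"
    by (auto simp: ball_stab_def one_apply)
  then show "ball_stab I d m \<noteq> {}" by blast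
  show "inv\<^bsub>G\<^esub> g \<in> ball_stab I d m" if "g \<in> ball_stab I d m" for g
    using that by (rule ball_stab_inv)
  fix g h assume "g \<in> ball_stab I d m" "h \<in> ball_stab I d m"
  then show "g \<otimes>\<^bsub>G\<^esub> h \<in> ball_stab I d m"
    by (auto simp: ball_stab_def mult_apply)
qed

lemma length_apply_le:
  assumes "g \<in> carrier G" "i \<in> I" "v \<in> V i"
  shows "length (g i v) \<le> length (g i []) + length v"
  by (rule tree_aut_length_le[OF carrierD[OF assms(1,2)] assms(3)])

lemma mem_l_coset_iff:
  assumes "g \<in> carrier G"
  shows "x \<in> g <#\<^bsub>G\<^esub> ball_stab I d m \<longleftrightarrow>
    x \<in> carrier G \<and> (\<forall>i\<in>I. \<forall>v\<in>V i. length v \<le> m \<longrightarrow> x i v = g i v)"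
proof
  assume "x \<in> g <#\<^bsub>G\<^esub> ball_stab I d m"
  then obtain u where "u \<in> ball_stab I d m" "x = g \<otimes>\<^bsub>G\<^esub> u"
    by (auto simp: l_coset_def)
  then show "x \<in> carrier G \<and> (\<forall>i\<in>I. \<forall>v\<in>V i. length v \<le> m \<longrightarrow> x i v = g i v)"
    using assms by (auto simp: ball_stab_def mult_apply)
next
  assume x: "x \<in> carrier G \<and> (\<forall>i\<in>I. \<forall>v\<in>V i. length v \<le> m \<longrightarrow> x i v = g i v)"
  have "(inv\<^bsub>G\<^esub> g \<otimes>\<^bsub>G\<^esub> x) i v = v" if "i \<in> I" "v \<in> V i" "length v \<le> m" for i v
    using x that assms by (simp add: mult_apply inv_apply)
  then have "inv\<^bsub>G\<^esub> g \<otimes>\<^bsub>G\<^esub> x \<in> ball_stab I d m"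
    using x assms by (simp add: ball_stab_def)
  moreover have "x = g \<otimes>\<^bsub>G\<^esub> (inv\<^bsub>G\<^esub> g \<otimes>\<^bsub>G\<^esub> x)"
    using x assms by (simp add: m_assoc[symmetric])
  ultimately show "x \<in> g <#\<^bsub>G\<^esub> ball_stab I d m"
    unfolding l_coset_def by blast
qed

lemma openin_l_coset_ball_stab:
  assumes g: "g \<in> carrier G"
  shows "openin T (g <#\<^bsub>G\<^esub> ball_stab I d m)"
proof -
  let ?S = "\<lambda>i. {h \<in> graph_auts (V i) (tree_edges (d i)). \<forall>v\<in>V i. length v \<le> m \<longrightarrow> h v = g i v}"
  have "g <#\<^bsub>G\<^esub> ball_stab I d m = Pi\<^sub>E I ?S"
    by (rule Set.set_eqI) (auto simp: mem_l_coset_iff[OF g] carrier_iff PiE_iff)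
  moreover have "openin T (Pi\<^sub>E I ?S)"
    unfolding tree_prod_topology_def openin_PiE[OF finite_I]
    using openin_aut_topology_ball[OF carrierD[OF g]] by blast
  ultimately show ?thesis by simp
qed

lemma openin_tree_prod_iff:
  "openin T U \<longleftrightarrow> U \<subseteq> carrier G \<and> (\<forall>g\<in>U. \<exists>m. g <#\<^bsub>G\<^esub> ball_stab I d m \<subseteq> U)"
proof
  assume U: "openin T U"
  then have sub: "U \<subseteq> carrier G"
    using openin_subset[OF U] topspace_tree_prod_topology by simp
  have "\<exists>m. g <#\<^bsub>G\<^esub> ball_stab I d m \<subseteq> U" if gU: "g \<in> U" for g
  proof -
    obtain W where W: "\<forall>i\<in>I. openin (aut_topology (V i) (tree_edges (d i))) (W i)"
      "g \<in> Pi\<^sub>E I W" "Pi\<^sub>E I W \<subseteq> U"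
      using bspec[OF U[unfolded tree_prod_topology_def openin_product_topology_alt] gU] by blast
    have "\<forall>i\<in>I. \<exists>m. \<forall>h\<in>graph_auts (V i) (tree_edges (d i)).
        (\<forall>v\<in>V i. length v \<le> m \<longrightarrow> h v = g i v) \<longrightarrow> h \<in> W i"
      using openin_aut_topology_agree[OF bspec[OF W(1)] PiE_mem[OF W(2)]] by blast
    then obtain m where m: "\<forall>i\<in>I. \<forall>h\<in>graph_auts (V i) (tree_edges (d i)).
        (\<forall>v\<in>V i. length v \<le> m i \<longrightarrow> h v = g i v) \<longrightarrow> h \<in> W i"
      by (auto simp: bchoice_iff)
    obtain M where M: "\<forall>l\<in>m ` I. l \<le> M"
      using finite_imageI[OF finite_I, of m] unfolding finite_nat_set_iff_bounded_le by blast
    have g: "g \<in> carrier G"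
      using gU sub by blast
    have "x \<in> U" if "x \<in> g <#\<^bsub>G\<^esub> ball_stab I d M" for x
    proof -
      have x: "x \<in> carrier G" "\<forall>i\<in>I. \<forall>v\<in>V i. length v \<le> M \<longrightarrow> x i v = g i v"
        using that mem_l_coset_iff[OF g] by auto
      have "x i \<in> W i" if "i \<in> I" for i
      proof -
        have "\<forall>v\<in>V i. length v \<le> m i \<longrightarrow> x i v = g i v"
        proof -
          have "m i \<le> M"
            using M that by blast
          then show ?thesis
            using x(2) that by simp
        qed
        then show ?thesis
          using m carrierD[OF x(1) that] that by blast
      qed
      then have "x \<in> Pi\<^sub>E I W"
        using x(1) by (simp add: carrier_iff PiE_iff)
      then show ?thesis
        using W(3) by blast
    qed
    then show ?thesis by blast
  qed
  then show "U \<subseteq> carrier G \<and> (\<forall>g\<in>U. \<exists>m. g <#\<^bsub>G\<^esub> ball_stab I d m \<subseteq> U)"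
    using sub by blast
next
  assume R: "U \<subseteq> carrier G \<and> (\<forall>g\<in>U. \<exists>m. g <#\<^bsub>G\<^esub> ball_stab I d m \<subseteq> U)"
  show "openin T U"
  proof (subst openin_subopen, rule ballI)
    fix g assume gU: "g \<in> U"
    then obtain m where m: "g <#\<^bsub>G\<^esub> ball_stab I d m \<subseteq> U" and g: "g \<in> carrier G"
      using R by blast
    have "g \<in> g <#\<^bsub>G\<^esub> ball_stab I d m"
      using g mem_l_coset_iff[OF g] by simp
    then show "\<exists>S. openin T S \<and> g \<in> S \<and> S \<subseteq> U"
      using m openin_l_coset_ball_stab[OF g] by blast
  qed
qed

sublocale filtered_group G T "ball_stab I d"
proof (rule filtered_group.intro[OF group_tree_prod_group filtered_group_axioms.intro], goal_cases)
  case (1 U)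
  then show ?case by (rule openin_tree_prod_iff)
next
  case (2 m)
  then show ?case by (rule subgroup_ball_stab)
next
  case 3
  show ?case
    by (auto simp: decseq_def ball_stab_def)
next
  case (4 m k u)
  note k = ball_stabD[OF 4(1)] and k' = ball_stabD[OF ball_stab_inv[OF 4(1)]]
    and u = ball_stabD[OF 4(2)]
  have "(k \<otimes>\<^bsub>G\<^esub> u \<otimes>\<^bsub>G\<^esub> inv\<^bsub>G\<^esub> k) i v = v" if "i \<in> I" "v \<in> V i" "length v \<le> m" for i v
  proof -
    have v': "(inv\<^bsub>G\<^esub> k) i v \<in> V i"
      using apply_in[OF k'(1) that(1,2)] .
    \<comment> \<open>\<open>k\<close> fixes all roots, hence so does its inverse, which therefore
      does not increase depth.\<close>
    moreover have "length ((inv\<^bsub>G\<^esub> k) i v) \<le> m"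
      using length_apply_le[OF k'(1) that(1,2)] k'(2)[OF that(1) Nil_tree_verts] that(3) by simp
    ultimately show ?thesis
      using k u that by (simp add: mult_apply inv_apply)
  qed
  then show ?case
    using k(1) u(1) by (simp add: ball_stab_def)
next
  case (5 m g)
  \<comment> \<open>\<open>inv g\<close> moves the ball of radius \<open>m\<close> in factor
    \<open>i\<close> by at most the displacement of its root; the sum over all factors bounds these
    displacements uniformly.\<close>
  let ?M = "m + (\<Sum>i\<in>I. length ((inv\<^bsub>G\<^esub> g) i []))"
  have "g \<otimes>\<^bsub>G\<^esub> u \<otimes>\<^bsub>G\<^esub> inv\<^bsub>G\<^esub> g \<in> ball_stab I d m" if "u \<in> ball_stab I d ?M" for u
  proof -
    note u = ball_stabD[OF that]
    have "(g \<otimes>\<^bsub>G\<^esub> u \<otimes>\<^bsub>G\<^esub> inv\<^bsub>G\<^esub> g) i v = v" if iv: "i \<in> I" "v \<in> V i" "length v \<le> m" for i v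
    proof -
      have v': "(inv\<^bsub>G\<^esub> g) i v \<in> V i"
        using apply_in[OF inv_closed[OF 5] iv(1,2)] .
      have "length ((inv\<^bsub>G\<^esub> g) i []) \<le> (\<Sum>i\<in>I. length ((inv\<^bsub>G\<^esub> g) i []))"
        using finite_I iv(1) by (intro member_le_sum) auto
      then have "length ((inv\<^bsub>G\<^esub> g) i v) \<le> ?M"
        using length_apply_le[OF inv_closed[OF 5] iv(1,2)] iv(3) by simp
      then have "u i ((inv\<^bsub>G\<^esub> g) i v) = (inv\<^bsub>G\<^esub> g) i v"
        using u(2)[OF iv(1) v'] by blast
      then show ?thesis
        using 5 u(1) iv v' by (simp add: mult_apply inv_apply)
    qed
    then show ?thesis
      using 5 u(1) by (simp add: ball_stab_def)
  qed
  then show ?case by blast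
next
  case 6
  have "ball_stab I d 0 = Pi\<^sub>E I (\<lambda>i. {f \<in> graph_auts (V i) (tree_edges (d i)). f [] = []})"
    by (rule Set.set_eqI) (auto simp: ball_stab_def carrier_iff PiE_iff Nil_tree_verts)
  moreover have "compactin T (Pi\<^sub>E I (\<lambda>i. {f \<in> graph_auts (V i) (tree_edges (d i)). f [] = []}))"
    unfolding tree_prod_topology_def compactin_PiE using compactin_root_stab by blast
  ultimately show ?case by simp
next
  case 7
  show ?case
  proof (intro equalityI subsetI)
    fix g assume g: "g \<in> (\<Inter>m. ball_stab I d m)"
    then have "g \<in> carrier G" by (auto simp: ball_stab_def)
    moreover have "g i v = v" if "i \<in> I" "v \<in> V i" for i v
      using g that ball_stabD(2)[of g "length v" i v] by blast
    ultimately have "g = \<one>\<^bsub>G\<^esub>"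
      by (intro eqI) (auto simp: one_apply)
    then show "g \<in> {\<one>\<^bsub>G\<^esub>}" by simp
  qed (auto simp: ball_stab_def one_apply)
qed

end

text \<open>Right multiplication by a generator in the free product of copies of the group of order 2
  whose Cayley graph is the tree: an involution exchanging the root and its neighbour \<open>[x]\<close>.\<close>

definition rmul :: "nat \<Rightarrow> nat list \<Rightarrow> nat list" where
  "rmul x v = (if v \<noteq> [] \<and> last v = x then butlast v else v @ [x])"

lemma rmul_in:
  assumes "x < k" "v \<in> tree_verts k"
  shows "rmul x v \<in> tree_verts k"
proof (cases v rule: rev_cases)
  case Nil
  then show ?thesis
    using assms by (simp add: rmul_def tree_verts_def)
next
  case (snoc w y)
  then show ?thesis
    using assms by (auto simp: rmul_def tree_verts_def distinct_adj_append_iff)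
qed

lemma rmul_rmul:
  assumes "v \<in> tree_verts k"
  shows "rmul x (rmul x v) = v"
proof (cases v rule: rev_cases)
  case Nil
  then show ?thesis
    by (simp add: rmul_def)
next
  case (snoc w y)
  have "w \<noteq> [] \<longrightarrow> last w \<noteq> y"
    using assms snoc by (auto simp: tree_verts_def distinct_adj_append_iff)
  then show ?thesis
    using snoc by (auto simp: rmul_def butlast_append)
qed

lemma length_rmul_le: "length (rmul x v) \<le> Suc (length v)"
  by (auto simp: rmul_def)

text \<open>Edges change the front of a word and \<open>rmul\<close> its rear, so they commute
  except when the word is empty; this makes \<open>rmul\<close> an automorphism.\<close>

lemma rmul_Cons: "v \<noteq> [] \<Longrightarrow> rmul x (a # v) = a # rmul x v"
  by (simp add: rmul_def)

lemma rmul_edge_aux: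
  assumes "x < k" "v \<in> tree_verts k" "a # v \<in> tree_verts k"
  shows "(rmul x v, rmul x (a # v)) \<in> tree_edges k \<and> (rmul x (a # v), rmul x v) \<in> tree_edges k"
proof (cases "v = []")
  case True
  then show ?thesis
    using assms rmul_in[OF assms(1,2)] rmul_in[OF assms(1,3)]
    by (auto simp: rmul_def tree_edges_def)
next
  case False
  then show ?thesis
    using rmul_in[OF assms(1,2)] rmul_in[OF assms(1,3)]
    by (simp add: rmul_Cons tree_edges_def)
qed

lemma rmul_edge:
  assumes "x < k" "(v, w) \<in> tree_edges k"
  shows "(rmul x v, rmul x w) \<in> tree_edges k"
proof -
  consider a where "w = a # v" | a where "v = a # w"
    using assms(2) by (auto simp: tree_edges_def)
  then show ?thesis
    using assms rmul_edge_aux by cases (auto simp: tree_edges_def)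
qed

lemma rmul_aut:
  assumes "x < k"
  shows "restrict (rmul x) (tree_verts k) \<in> graph_auts (tree_verts k) (tree_edges k)"
proof (rule graph_auts_I)
  let ?f = "restrict (rmul x) (tree_verts k)"
  show "?f \<in> extensional (tree_verts k)" by simp
  show "bij_betw ?f (tree_verts k) (tree_verts k)"
    by (rule bij_betw_byWitness[where f' = ?f]) (use rmul_in[OF assms] rmul_rmul in auto)
  fix v w assume vw: "v \<in> tree_verts k" "w \<in> tree_verts k"
  have "(v, w) \<in> tree_edges k" if "(rmul x v, rmul x w) \<in> tree_edges k"
    using rmul_edge[OF assms that] rmul_rmul[OF vw(1)] rmul_rmul[OF vw(2)] by simp
  then show "(?f v, ?f w) \<in> tree_edges k \<longleftrightarrow> (v, w) \<in> tree_edges k"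
    using vw rmul_edge[OF assms] by auto
qed

lemma sum_length_upd:
  assumes "finite I" "i \<in> I" "length (w i) = Suc (length v)" "(\<Sum>j\<in>I. length (w j)) = Suc n"
  shows "(\<Sum>j\<in>I. length ((w(i := v)) j)) = n"
proof -
  have "(\<Sum>j\<in>I - {i}. length ((w(i := v)) j)) = (\<Sum>j\<in>I - {i}. length (w j))"
    by (intro sum.cong) auto
  then show ?thesis
    using assms by (simp add: sum.remove[of I i])
qed

lemma restrict_id_aut: "(\<lambda>v\<in>V. v) \<in> graph_auts V E"
  by (rule graph_auts_I) (auto simp: bij_betw_def inj_on_def)

section \<open>Generation by root stabilizers and involutions; the lattice criterion\<close>

context tree_product
begin

definition rmul_at :: "nat \<Rightarrow> nat \<Rightarrow> nat \<Rightarrow> nat list \<Rightarrow> nat list" where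
  "rmul_at i x = (\<lambda>j\<in>I. \<lambda>v\<in>tree_verts (d j). if j = i then rmul x v else v)"

lemma rmul_at_carrier:
  assumes "x < d i"
  shows "rmul_at i x \<in> carrier G"
  unfolding carrier_iff
proof (rule PiE_I)
  fix j assume j: "j \<in> I"
  show "rmul_at i x j \<in> graph_auts (V j) (tree_edges (d j))"
  proof (cases "j = i")
    case True
    then have "rmul_at i x j = restrict (rmul x) (V i)"
      using j by (simp add: rmul_at_def)
    then show ?thesis
      using True rmul_aut[OF assms] by simp
  next
    case False
    then have "rmul_at i x j = (\<lambda>v\<in>V j. v)"
      using j by (simp add: rmul_at_def)
    then show ?thesis
      using restrict_id_aut by simp
  qed
qed (simp add: rmul_at_def)

lemma rmul_at_apply:
  "j \<in> I \<Longrightarrow> v \<in> V j \<Longrightarrow> rmul_at i x j v = (if j = i then rmul x v else v)"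
  by (simp add: rmul_at_def)

lemma rmul_at_square:
  assumes "x < d i"
  shows "rmul_at i x \<otimes>\<^bsub>G\<^esub> rmul_at i x = \<one>\<^bsub>G\<^esub>"
proof (rule eqI)
  note c = rmul_at_carrier[OF assms]
  show "rmul_at i x \<otimes>\<^bsub>G\<^esub> rmul_at i x \<in> carrier G"
    using c by simp
  fix j v assume jv: "j \<in> I" "v \<in> V j"
  then show "(rmul_at i x \<otimes>\<^bsub>G\<^esub> rmul_at i x) j v = \<one>\<^bsub>G\<^esub> j v"
    using c assms rmul_in[of x "d i" v] rmul_rmul[of v "d i" x]
    by (auto simp: mult_apply rmul_at_apply one_apply)
qed simp

text \<open>The intersection of a ball stabilizer with its conjugate by an involution is normalized
  by that involution. It is open, as it contains the stabilizer of the ball of radius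
  \<open>Suc m\<close>: the involution raises depth by at most one.\<close>

lemma rmul_at_small_normalizer:
  assumes "x < d i"
  shows "rmul_at i x \<in> small_normalizer"
proof -
  let ?s = "rmul_at i x"
  note c = rmul_at_carrier[OF assms]
  have inv: "inv\<^bsub>G\<^esub> ?s = ?s"
    using inv_equality[OF rmul_at_square[OF assms] c c] .
  have "\<exists>U\<subseteq>ball_stab I d m. small_normalized ?s U" for m
  proof -
    define U where "U = {u \<in> ball_stab I d m. ?s \<otimes>\<^bsub>G\<^esub> u \<otimes>\<^bsub>G\<^esub> ?s \<in> ball_stab I d m}"
    have Uc: "u \<in> carrier G" if "u \<in> U" for u
      using that by (simp add: U_def ball_stab_def)
    have ss: "?s \<otimes>\<^bsub>G\<^esub> (?s \<otimes>\<^bsub>G\<^esub> u) = u" if "u \<in> carrier G" for u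
      using that c by (simp add: m_assoc[symmetric] rmul_at_square[OF assms])
    have "subgroup U G"
    proof (rule subgroupI)
      show "U \<subseteq> carrier G"
        using Uc by blast
      have "\<one>\<^bsub>G\<^esub> \<in> U"
        using c rmul_at_square[OF assms] subgroup.one_closed[OF subgroup_ball_stab]
        by (simp add: U_def)
      then show "U \<noteq> {}" by blast
      fix u assume u: "u \<in> U"
      have "?s \<otimes>\<^bsub>G\<^esub> inv\<^bsub>G\<^esub> u \<otimes>\<^bsub>G\<^esub> ?s = inv\<^bsub>G\<^esub> (?s \<otimes>\<^bsub>G\<^esub> u \<otimes>\<^bsub>G\<^esub> ?s)"
        using Uc[OF u] c by (simp add: inv_mult_group inv m_assoc)
      then show "inv\<^bsub>G\<^esub> u \<in> U"
        using u ball_stab_inv by (simp add: U_def)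
      fix w assume w: "w \<in> U"
      have "?s \<otimes>\<^bsub>G\<^esub> (u \<otimes>\<^bsub>G\<^esub> w) \<otimes>\<^bsub>G\<^esub> ?s = (?s \<otimes>\<^bsub>G\<^esub> u \<otimes>\<^bsub>G\<^esub> ?s) \<otimes>\<^bsub>G\<^esub> (?s \<otimes>\<^bsub>G\<^esub> w \<otimes>\<^bsub>G\<^esub> ?s)"
        using Uc[OF u] Uc[OF w] c by (simp add: m_assoc ss)
      then show "u \<otimes>\<^bsub>G\<^esub> w \<in> U"
        using u w subgroup.m_closed[OF subgroup_ball_stab] by (simp add: U_def)
    qed
    moreover have "ball_stab I d (Suc m) \<subseteq> U"
    proof
      fix u assume "u \<in> ball_stab I d (Suc m)"
      note u = ball_stabD[OF this]
      have "(?s \<otimes>\<^bsub>G\<^esub> u \<otimes>\<^bsub>G\<^esub> ?s) j v = v" if jv: "j \<in> I" "v \<in> V j" "length v \<le> m" for j v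
      proof -
        have sv: "?s j v \<in> V j"
          using apply_in[OF c jv(1,2)] .
        have "length (?s j v) \<le> Suc m"
          using jv length_rmul_le[of x v] by (simp add: rmul_at_apply)
        then have usv: "u j (?s j v) = ?s j v"
          using u(2)[OF jv(1) sv] by blast
        have "?s j (?s j v) = v"
          using mult_apply[OF c c jv(1,2)] one_apply[OF jv(1,2)] rmul_at_square[OF assms] by simp
        then show ?thesis
          using c u(1) jv sv usv by (simp add: mult_apply)
      qed
      then have "?s \<otimes>\<^bsub>G\<^esub> u \<otimes>\<^bsub>G\<^esub> ?s \<in> ball_stab I d m"
        using c u(1) by (simp add: ball_stab_def)
      moreover have "u \<in> ball_stab I d m"
        using u by (simp add: ball_stab_def)
      ultimately show "u \<in> U"
        by (simp add: U_def)
    qed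
    moreover have "?s \<otimes>\<^bsub>G\<^esub> u \<otimes>\<^bsub>G\<^esub> ?s \<in> U" if "u \<in> U" for u
    proof -
      have "?s \<otimes>\<^bsub>G\<^esub> (?s \<otimes>\<^bsub>G\<^esub> u \<otimes>\<^bsub>G\<^esub> ?s) \<otimes>\<^bsub>G\<^esub> ?s = u"
        using Uc[OF that] c rmul_at_square[OF assms] by (simp add: m_assoc ss)
      then show ?thesis
        using that by (simp add: U_def)
    qed
    moreover have "U \<subseteq> ball_stab I d m"
      by (auto simp: U_def)
    moreover have "ball_stab I d m \<subseteq> ball_stab I d 0"
      by (auto simp: ball_stab_def)
    ultimately show ?thesis
      unfolding small_normalized_def inv by blast
  qed
  then show ?thesis
    using c unfolding small_normalizer_def by blast
qed

text \<open>Induction on the total length of the words: the last letter \<open>x\<close> of a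
  nonempty \<open>w i\<close> is removed, and \<open>rmul_at i x\<close> restores it
  afterwards.\<close>

lemma generate_transitive:
  "(\<forall>i\<in>I. w i \<in> V i) \<Longrightarrow> (\<Sum>i\<in>I. length (w i)) = n \<Longrightarrow>
    \<exists>t\<in>generate G small_normalizer. \<forall>i\<in>I. t i [] = w i"
proof (induction n arbitrary: w)
  case 0
  then have "\<forall>i\<in>I. w i = []"
    using finite_I by simp
  then show ?case
    using generate.one[of G] Nil_tree_verts by (intro bexI[of _ "\<one>\<^bsub>G\<^esub>"]) (auto simp: one_apply)
next
  case (Suc n)
  have "\<exists>i\<in>I. w i \<noteq> []"
  proof (rule ccontr)
    assume "\<not> ?thesis"
    then have "(\<Sum>i\<in>I. length (w i)) = 0" by simp
    then show False using Suc.prems by simp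
  qed
  then obtain i where i: "i \<in> I" "w i \<noteq> []" by blast
  then obtain u x where ux: "w i = u @ [x]"
    by (metis append_butlast_last_id)
  have wi: "w i \<in> V i"
    using Suc.prems i by blast
  have x: "x < d i" and u: "u \<in> V i" "u \<noteq> [] \<longrightarrow> last u \<noteq> x"
    using wi ux by (auto simp: tree_verts_def distinct_adj_append_iff)
  have "(\<Sum>j\<in>I. length ((w(i := u)) j)) = n"
    using Suc.prems(2) ux by (intro sum_length_upd[OF finite_I i(1)]) auto
  moreover have "\<forall>j\<in>I. (w(i := u)) j \<in> V j"
    using Suc.prems(1) u(1) by simp
  ultimately obtain t where t: "t \<in> generate G small_normalizer" "\<forall>j\<in>I. t j [] = (w(i := u)) j"
    using Suc.IH[of "w(i := u)"] by blast
  have tc: "t \<in> carrier G"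
    using generate_in_carrier[OF _ t(1)] by (auto simp: small_normalizer_def)
  have "rmul_at i x \<otimes>\<^bsub>G\<^esub> t \<in> generate G small_normalizer"
    using generate.incl[OF rmul_at_small_normalizer[OF x]] t(1) by (rule generate.eng)
  moreover have "(rmul_at i x \<otimes>\<^bsub>G\<^esub> t) j [] = w j" if j: "j \<in> I" for j
  proof -
    have "(rmul_at i x \<otimes>\<^bsub>G\<^esub> t) j [] = rmul_at i x j (t j [])"
      using mult_apply[OF rmul_at_carrier[OF x] tc j Nil_tree_verts] .
    also have "\<dots> = (if j = i then rmul x u else w j)"
      using t(2) j u Suc.prems(1) by (simp add: rmul_at_apply)
    also have "\<dots> = w j"
      using u ux by (auto simp: rmul_def)
    finally show ?thesis .
  qed
  ultimately show ?case by blast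
qed

text \<open>After a product of involutions has carried the roots to the right place, the remaining
  factor fixes all roots and lies in \<open>small_normalizer\<close> itself.\<close>

lemma carrier_eq_generate: "carrier G = generate G small_normalizer"
proof (intro equalityI subsetI)
  fix g assume g: "g \<in> carrier G"
  obtain t where t: "t \<in> generate G small_normalizer" "\<forall>i\<in>I. t i [] = g i []"
    using generate_transitive[of "\<lambda>i. g i []", OF _ refl] apply_in[OF g _ Nil_tree_verts] by auto
  have tc: "t \<in> carrier G"
    using generate_in_carrier[OF _ t(1)] by (auto simp: small_normalizer_def)
  have "(inv\<^bsub>G\<^esub> t \<otimes>\<^bsub>G\<^esub> g) i [] = []" if "i \<in> I" for i
    using mult_apply[OF inv_closed[OF tc] g that Nil_tree_verts] t(2) that
      inv_apply(1)[OF tc that Nil_tree_verts] by simp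
  then have "inv\<^bsub>G\<^esub> t \<otimes>\<^bsub>G\<^esub> g \<in> ball_stab I d 0"
    using g tc by (simp add: ball_stab_def)
  then have "inv\<^bsub>G\<^esub> t \<otimes>\<^bsub>G\<^esub> g \<in> small_normalizer"
    using K0_subset_small_normalizer by blast
  then have "t \<otimes>\<^bsub>G\<^esub> (inv\<^bsub>G\<^esub> t \<otimes>\<^bsub>G\<^esub> g) \<in> generate G small_normalizer"
    by (intro generate.eng[OF t(1)] generate.incl)
  moreover have "t \<otimes>\<^bsub>G\<^esub> (inv\<^bsub>G\<^esub> t \<otimes>\<^bsub>G\<^esub> g) = g"
    using g tc by (simp add: m_assoc[symmetric])
  ultimately show "g \<in> generate G small_normalizer" by simp
next
  fix g assume "g \<in> generate G small_normalizer"
  then show "g \<in> carrier G"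
    by (rule generate_in_carrier[rotated]) (auto simp: small_normalizer_def)
qed

lemma vertex_transitive_iff:
  assumes "subgroup \<Gamma> G"
  shows "vertex_transitive I d \<Gamma> \<longleftrightarrow> (\<forall>w\<in>(\<Pi>\<^sub>E i\<in>I. V i). \<exists>\<gamma>\<in>\<Gamma>. \<forall>i\<in>I. \<gamma> i [] = w i)"
proof
  assume R: "\<forall>w\<in>(\<Pi>\<^sub>E i\<in>I. V i). \<exists>\<gamma>\<in>\<Gamma>. \<forall>i\<in>I. \<gamma> i [] = w i"
  show "vertex_transitive I d \<Gamma>"
    unfolding vertex_transitive_def
  proof (intro ballI)
    fix x y assume xy: "x \<in> (\<Pi>\<^sub>E i\<in>I. V i)" "y \<in> (\<Pi>\<^sub>E i\<in>I. V i)"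
    obtain \<alpha> where a: "\<alpha> \<in> \<Gamma>" "\<forall>i\<in>I. \<alpha> i [] = x i"
      using bspec[OF R xy(1)] by blast
    obtain \<beta> where b: "\<beta> \<in> \<Gamma>" "\<forall>i\<in>I. \<beta> i [] = y i"
      using bspec[OF R xy(2)] by blast
    note ab = a b
    have c: "\<alpha> \<in> carrier G" "\<beta> \<in> carrier G"
      using ab subgroup.mem_carrier[OF assms] by auto
    have "(\<beta> \<otimes>\<^bsub>G\<^esub> inv\<^bsub>G\<^esub> \<alpha>) i (x i) = y i" if i: "i \<in> I" for i
    proof -
      have "x i \<in> V i"
        using xy(1) i by auto
      then have "(\<beta> \<otimes>\<^bsub>G\<^esub> inv\<^bsub>G\<^esub> \<alpha>) i (x i) = \<beta> i ((inv\<^bsub>G\<^esub> \<alpha>) i (\<alpha> i []))"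
        using mult_apply[OF c(2) inv_closed[OF c(1)] i] ab i by simp
      then show ?thesis
        using inv_apply(1)[OF c(1) i Nil_tree_verts] ab i by simp
    qed
    then have "(\<lambda>i\<in>I. (\<beta> \<otimes>\<^bsub>G\<^esub> inv\<^bsub>G\<^esub> \<alpha>) i (x i)) = y"
      using xy(2) by (intro extensionalityI[of _ I]) (auto simp: PiE_iff)
    moreover have "\<beta> \<otimes>\<^bsub>G\<^esub> inv\<^bsub>G\<^esub> \<alpha> \<in> \<Gamma>"
      using ab subgroup.m_closed[OF assms] subgroup.m_inv_closed[OF assms] by simp
    ultimately show "\<exists>\<gamma>\<in>\<Gamma>. (\<lambda>i\<in>I. \<gamma> i (x i)) = y" by blast
  qed
next
  assume L: "vertex_transitive I d \<Gamma>"
  show "\<forall>w\<in>(\<Pi>\<^sub>E i\<in>I. V i). \<exists>\<gamma>\<in>\<Gamma>. \<forall>i\<in>I. \<gamma> i [] = w i"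
  proof
    fix w assume w: "w \<in> (\<Pi>\<^sub>E i\<in>I. V i)"
    have "(\<lambda>i\<in>I. []) \<in> (\<Pi>\<^sub>E i\<in>I. V i)"
      using Nil_tree_verts by auto
    then obtain \<gamma> where \<gamma>: "\<gamma> \<in> \<Gamma>" "(\<lambda>i\<in>I. \<gamma> i ((\<lambda>i\<in>I. []) i)) = w"
      using L w unfolding vertex_transitive_def by blast
    have "\<gamma> i [] = w i" if "i \<in> I" for i
      using \<gamma>(2) that by auto
    then show "\<exists>\<gamma>\<in>\<Gamma>. \<forall>i\<in>I. \<gamma> i [] = w i"
      using \<gamma>(1) by blast
  qed
qed

text \<open>A simply transitive \<open>\<Gamma>\<^sub>0\<close> is a complement of the root
  stabilizer: if \<open>\<gamma>\<close> moves the roots as \<open>inv g\<close> does, then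
  \<open>g \<gamma>\<close> fixes them. For the larger group only the finiteness of its root
  stabilizer remains to be known.\<close>

theorem cocompact_lattice_criterion:
  assumes "subgroup \<Gamma> G" "subgroup \<Gamma>\<^sub>0 G" "\<Gamma>\<^sub>0 \<subseteq> \<Gamma>" "vertex_transitive I d \<Gamma>\<^sub>0"
    and "ball_stab I d 0 \<inter> \<Gamma>\<^sub>0 = {\<one>\<^bsub>G\<^esub>}" "finite (\<Gamma> \<inter> ball_stab I d 0)"
  shows "cocompact_lattice_in G T \<Gamma>"
proof -
  have "filtered_group_transversal G T (ball_stab I d) \<Gamma>\<^sub>0"
  proof (rule filtered_group_transversal.intro[OF filtered_group_axioms
        filtered_group_transversal_axioms.intro])
    show "subgroup \<Gamma>\<^sub>0 G" by fact
    show "ball_stab I d 0 \<inter> \<Gamma>\<^sub>0 = {\<one>\<^bsub>G\<^esub>}" by fact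
    show "carrier G = generate G small_normalizer"
      by (rule carrier_eq_generate)
    fix g assume g: "g \<in> carrier G"
    have "(\<lambda>i\<in>I. (inv\<^bsub>G\<^esub> g) i []) \<in> (\<Pi>\<^sub>E i\<in>I. V i)"
      using apply_in[OF inv_closed[OF g] _ Nil_tree_verts] by auto
    then have "\<exists>\<gamma>\<in>\<Gamma>\<^sub>0. \<forall>i\<in>I. \<gamma> i [] = (\<lambda>i\<in>I. (inv\<^bsub>G\<^esub> g) i []) i"
      by (rule bspec[OF assms(4)[unfolded vertex_transitive_iff[OF assms(2)]]])
    then obtain \<gamma> where \<gamma>: "\<gamma> \<in> \<Gamma>\<^sub>0" "\<forall>i\<in>I. \<gamma> i [] = (inv\<^bsub>G\<^esub> g) i []"
      by auto
    have c: "\<gamma> \<in> carrier G"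
      using \<gamma>(1) subgroup.mem_carrier[OF assms(2)] by blast
    have "(g \<otimes>\<^bsub>G\<^esub> \<gamma>) i [] = []" if "i \<in> I" for i
      using mult_apply[OF g c that Nil_tree_verts] \<gamma>(2) that inv_apply(2)[OF g that Nil_tree_verts]
      by simp
    then have "g \<otimes>\<^bsub>G\<^esub> \<gamma> \<in> ball_stab I d 0"
      using g c by (simp add: ball_stab_def)
    moreover have "g = (g \<otimes>\<^bsub>G\<^esub> \<gamma>) \<otimes>\<^bsub>G\<^esub> inv\<^bsub>G\<^esub> \<gamma>"
      using g c by (simp add: m_assoc)
    moreover have "inv\<^bsub>G\<^esub> \<gamma> \<in> \<Gamma>\<^sub>0"
      using \<gamma>(1) subgroup.m_inv_closed[OF assms(2)] by blast
    ultimately show "\<exists>k\<in>ball_stab I d 0. \<exists>\<gamma>\<in>\<Gamma>\<^sub>0. g = k \<otimes>\<^bsub>G\<^esub> \<gamma>" by blast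
  qed
  then show ?thesis
    using assms(1,3,6) by (rule filtered_group_transversal.cocompact_latticeI)
qed

end

section \<open>Cube complexes with one vertex\<close>

abbreviation opp :: "'i \<times> bool \<Rightarrow> 'i \<times> bool" where
  "opp a \<equiv> (fst a, \<not> snd a)"

text \<open>The free group of rank \<open>k\<close>, as reduced words: a letter is an orientation
  with a label, and flipping the orientation inverts it. Its Cayley graph is the tree of degree
  \<open>2 * k\<close>.\<close>

definition red_words :: "nat \<Rightarrow> (bool \<times> nat) list set" where
  "red_words k = {w. (\<forall>p\<in>set w. snd p < k) \<and> successively (\<lambda>p q. q \<noteq> (\<not> fst p, snd p)) w}"

text \<open>Left multiplication by a letter in the free group, with cancellation.\<close>

definition lcons :: "bool \<times> nat \<Rightarrow> (bool \<times> nat) list \<Rightarrow> (bool \<times> nat) list" where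
  "lcons p w = (if w \<noteq> [] \<and> hd w = (\<not> fst p, snd p) then tl w else p # w)"

text \<open>On reduced words, adjacency in the Cayley graph: multiplication by a letter on the
  right, which commutes with \<open>lcons\<close>.\<close>

definition nbr :: "'a list \<Rightarrow> 'a list \<Rightarrow> bool" where
  "nbr u v \<longleftrightarrow> (\<exists>a. v = u @ [a]) \<or> (\<exists>a. u = v @ [a])"

lemma Nil_red_words [simp]: "[] \<in> red_words k"
  by (simp add: red_words_def)

lemma red_words_Cons:
  "p # w \<in> red_words k \<longleftrightarrow>
     snd p < k \<and> w \<in> red_words k \<and> (w \<noteq> [] \<longrightarrow> hd w \<noteq> (\<not> fst p, snd p))"
  by (auto simp: red_words_def successively_Cons)

lemma lcons_in: "w \<in> red_words k \<Longrightarrow> snd p < k \<Longrightarrow> lcons p w \<in> red_words k"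
  by (cases w) (auto simp: lcons_def red_words_Cons)

lemma lcons_cancel: "w \<in> red_words k \<Longrightarrow> lcons p (lcons (\<not> fst p, snd p) w) = w"
proof (cases w)
  case (Cons q u)
  assume "w \<in> red_words k"
  then have "u \<noteq> [] \<longrightarrow> hd u \<noteq> (\<not> fst q, snd q)"
    using Cons by (simp add: red_words_Cons)
  then show ?thesis
    using Cons by (auto simp: lcons_def)
qed (simp add: lcons_def)

lemma lcons_nbr: "nbr (lcons p w) (lcons p (w @ [a]))"
  by (cases w) (auto simp: lcons_def nbr_def)

text \<open>Crossing an edge backwards must repeat its letter in \<open>tree_verts (2 * k)\<close>, but it flips the
  orientation; hence a letter is below \<open>k\<close> iff the orientation agrees with the parity of the
  depth.\<close>

fun enc :: "nat \<Rightarrow> bool \<Rightarrow> (bool \<times> nat) list \<Rightarrow> nat list" where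
  "enc k b [] = []"
| "enc k b (p # w) = (snd p + (if fst p = b then 0 else k)) # enc k (\<not> b) w"

fun dec :: "nat \<Rightarrow> bool \<Rightarrow> nat list \<Rightarrow> (bool \<times> nat) list" where
  "dec k b [] = []"
| "dec k b (x # xs) = ((x < k) = b, x mod k) # dec k (\<not> b) xs"

lemma dec_enc: "\<forall>p\<in>set w. snd p < k \<Longrightarrow> dec k b (enc k b w) = w"
  by (induction w arbitrary: b) auto

lemma enc_dec: "set xs \<subseteq> {..<2 * k} \<Longrightarrow> enc k b (dec k b xs) = xs"
  by (induction xs arbitrary: b) (auto simp: mod_if)

lemma enc_labels: "\<forall>p\<in>set w. snd p < k \<Longrightarrow> set (enc k b w) \<subseteq> {..<2 * k}"
  by (induction w arbitrary: b) auto

lemma dec_labels: "set xs \<subseteq> {..<2 * k} \<Longrightarrow> p \<in> set (dec k b xs) \<Longrightarrow> snd p < k"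
  by (induction xs arbitrary: b) auto

lemma distinct_adj_enc:
  assumes "\<forall>p\<in>set w. snd p < k"
  shows "distinct_adj (enc k b w) \<longleftrightarrow> successively (\<lambda>p q. q \<noteq> (\<not> fst p, snd p)) w"
  using assms
proof (induction w arbitrary: b)
  case (Cons p w)
  show ?case
  proof (cases w)
    case w: (Cons q u)
    have "snd p < k" "snd q < k"
      using Cons.prems w by auto
    then have "snd p + (if fst p = b then 0 else k) \<noteq> snd q + (if fst q = (\<not> b) then 0 else k) \<longleftrightarrow>
        q \<noteq> (\<not> fst p, snd p)"
      by (cases p; cases q) auto
    moreover have "distinct_adj (enc k (\<not> b) w) \<longleftrightarrow> successively (\<lambda>p q. q \<noteq> (\<not> fst p, snd p)) w"
      using Cons by simp
    ultimately show ?thesis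
      by (simp add: w)
  qed simp
qed simp

lemma enc_snoc: "\<exists>c. enc k b (w @ [a]) = enc k b w @ [c]"
  by (induction w arbitrary: b) auto

lemma dec_snoc: "\<exists>c. dec k b (xs @ [x]) = dec k b xs @ [c]"
  by (induction xs arbitrary: b) auto

text \<open>Paths from the root grow at the end of a word in \<open>red_words\<close> but at the
  front of a word in \<open>tree_verts\<close>, hence the reversal.\<close>

definition encode :: "nat \<Rightarrow> (bool \<times> nat) list \<Rightarrow> nat list" where
  "encode k w = rev (enc k True w)"

definition decode :: "nat \<Rightarrow> nat list \<Rightarrow> (bool \<times> nat) list" where
  "decode k v = dec k True (rev v)"

lemma decode_encode: "w \<in> red_words k \<Longrightarrow> decode k (encode k w) = w"
  by (simp add: red_words_def encode_def decode_def dec_enc)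

lemma encode_decode: "v \<in> tree_verts (2 * k) \<Longrightarrow> encode k (decode k v) = v"
  by (simp add: tree_verts_def encode_def decode_def enc_dec)

lemma encode_in: "w \<in> red_words k \<Longrightarrow> encode k w \<in> tree_verts (2 * k)"
  using enc_labels[of w k True] distinct_adj_enc[of w k True]
  by (auto simp: red_words_def encode_def tree_verts_def)

lemma decode_in:
  assumes "v \<in> tree_verts (2 * k)"
  shows "decode k v \<in> red_words k"
proof -
  have s: "set (rev v) \<subseteq> {..<2 * k}"
    using assms by (simp add: tree_verts_def)
  have l: "\<forall>p\<in>set (decode k v). snd p < k"
    unfolding decode_def using dec_labels[OF s] by blast
  have "enc k True (decode k v) = rev v"
    unfolding decode_def by (rule enc_dec[OF s])
  then have "distinct_adj (enc k True (decode k v))"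
    using assms by (simp add: tree_verts_def)
  then show ?thesis
    using l distinct_adj_enc[OF l] by (simp add: red_words_def)
qed

lemma encode_Nil [simp]: "encode k [] = []"
  and decode_Nil [simp]: "decode k [] = []"
  by (simp_all add: encode_def decode_def)

lemma encode_nbr:
  assumes "u \<in> red_words k" "w \<in> red_words k" "nbr u w"
  shows "(encode k u, encode k w) \<in> tree_edges (2 * k)"
proof -
  have "\<exists>c. encode k (x @ [a]) = c # encode k x" for x a
    using enc_snoc[of k True x a] by (auto simp: encode_def)
  then show ?thesis
    using assms encode_in unfolding tree_edges_def nbr_def by blast
qed

lemma decode_nbr:
  assumes "(v, v') \<in> tree_edges (2 * k)"
  shows "nbr (decode k v) (decode k v')"
proof -
  have "\<exists>c. decode k (a # x) = decode k x @ [c]" for x a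
    using dec_snoc[of k True "rev x" a] by (auto simp: decode_def)
  then show ?thesis
    using assms unfolding tree_edges_def nbr_def by blast
qed

definition tree_map :: "nat \<Rightarrow> ((bool \<times> nat) list \<Rightarrow> (bool \<times> nat) list) \<Rightarrow> nat list \<Rightarrow> nat list" where
  "tree_map k \<phi> = (\<lambda>v\<in>tree_verts (2 * k). encode k (\<phi> (decode k v)))"

lemma tree_map_aut:
  assumes "\<And>w. w \<in> red_words k \<Longrightarrow> \<phi> w \<in> red_words k \<and> \<psi> w \<in> red_words k \<and> \<phi> (\<psi> w) = w \<and> \<psi> (\<phi> w) = w"
    and "\<And>w a. w @ [a] \<in> red_words k \<Longrightarrow> nbr (\<phi> w) (\<phi> (w @ [a])) \<and> nbr (\<psi> w) (\<psi> (w @ [a]))"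
  shows "tree_map k \<phi> \<in> graph_auts (tree_verts (2 * k)) (tree_edges (2 * k))"
proof -
  have comp: "tree_map k \<alpha> (tree_map k \<beta> v) = v" "tree_map k \<beta> v \<in> tree_verts (2 * k)"
    if "\<And>w. w \<in> red_words k \<Longrightarrow> \<beta> w \<in> red_words k \<and> \<alpha> (\<beta> w) = w" "v \<in> tree_verts (2 * k)" for \<alpha> \<beta> v
  proof -
    have d: "decode k v \<in> red_words k"
      using decode_in that(2) .
    show "tree_map k \<beta> v \<in> tree_verts (2 * k)"
      using that encode_in d by (simp add: tree_map_def)
    then show "tree_map k \<alpha> (tree_map k \<beta> v) = v"
      using that d by (simp add: tree_map_def decode_encode encode_decode)
  qed
  have edge: "(tree_map k \<alpha> v, tree_map k \<alpha> v') \<in> tree_edges (2 * k)"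
    if \<alpha>: "\<And>w. w \<in> red_words k \<Longrightarrow> \<alpha> w \<in> red_words k"
      "\<And>w a. w @ [a] \<in> red_words k \<Longrightarrow> nbr (\<alpha> w) (\<alpha> (w @ [a]))"
      and e: "(v, v') \<in> tree_edges (2 * k)" for \<alpha> v v'
  proof -
    have v: "v \<in> tree_verts (2 * k)" "v' \<in> tree_verts (2 * k)"
      using e by (auto simp: tree_edges_def)
    have "nbr (\<alpha> (decode k v)) (\<alpha> (decode k v'))"
      using decode_nbr[OF e] \<alpha>(2) decode_in[OF v(1)] decode_in[OF v(2)]
      unfolding nbr_def by metis
    then show ?thesis
      using encode_nbr \<alpha>(1) decode_in v by (simp add: tree_map_def)
  qed
  show ?thesis
  proof (rule graph_auts_I)
    show "tree_map k \<phi> \<in> extensional (tree_verts (2 * k))"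
      by (simp add: tree_map_def)
    show "bij_betw (tree_map k \<phi>) (tree_verts (2 * k)) (tree_verts (2 * k))"
    proof (rule bij_betw_byWitness[where f' = "tree_map k \<psi>"])
      show "\<forall>v\<in>tree_verts (2 * k). tree_map k \<psi> (tree_map k \<phi> v) = v"
        "tree_map k \<phi> ` tree_verts (2 * k) \<subseteq> tree_verts (2 * k)"
        using comp[of \<phi> \<psi>] assms(1) by auto
      show "\<forall>v\<in>tree_verts (2 * k). tree_map k \<phi> (tree_map k \<psi> v) = v"
        "tree_map k \<psi> ` tree_verts (2 * k) \<subseteq> tree_verts (2 * k)"
        using comp[of \<psi> \<phi>] assms(1) by auto
    qed
    fix v w assume vw: "v \<in> tree_verts (2 * k)" "w \<in> tree_verts (2 * k)"
    have "(v, w) \<in> tree_edges (2 * k)" if "(tree_map k \<phi> v, tree_map k \<phi> w) \<in> tree_edges (2 * k)"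
    proof -
      have "(tree_map k \<psi> (tree_map k \<phi> v), tree_map k \<psi> (tree_map k \<phi> w)) \<in> tree_edges (2 * k)"
        by (rule edge[OF _ _ that]) (use assms in auto)
      then show ?thesis
        using comp(1)[of \<phi> \<psi>] assms(1) vw by simp
    qed
    moreover have "(tree_map k \<phi> v, tree_map k \<phi> w) \<in> tree_edges (2 * k)" if "(v, w) \<in> tree_edges (2 * k)"
      by (rule edge[OF _ _ that]) (use assms in auto)
    ultimately show "(tree_map k \<phi> v, tree_map k \<phi> w) \<in> tree_edges (2 * k) \<longleftrightarrow> (v, w) \<in> tree_edges (2 * k)"
      by blast
  qed
qed

section \<open>The automaton defined by the squares of the complex\<close>

datatype 'c gen = Sh 'c | Ed "nat \<times> bool" nat

text \<open>\<open>lab_opp\<close> says that an edge shows the same label at both ends.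
  \<open>lab_X\<close> abstracts the fact that on configurations of zero label \<open>X a\<close> is
  multiplication by \<open>d / e\<close>, where \<open>d\<close> and \<open>e\<close> are units for
  every other direction. \<open>lab_crt\<close> is the Chinese remainder theorem, and
  \<open>a = b\<close> is allowed in it. Together they say that two edges of different directions at
  a corner span one square.\<close>

locale cube =
  fixes X :: "nat \<times> bool \<Rightarrow> 'c::ab_group_add \<Rightarrow> 'c"
    and Q :: "nat \<Rightarrow> nat"
    and lab :: "nat \<times> bool \<Rightarrow> 'c \<Rightarrow> nat"
  assumes X_add: "X a (f + g) = X a f + X a g"
    and X_opp: "X (opp a) (X a f) = f"
    and X_comm: "X a (X b f) = X b (X a f)"
    and lab_less: "lab a f < Q (fst a)"
    and lab_surj: "y < Q (fst a) \<Longrightarrow> \<exists>f. lab a f = y"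
    and lab_eq: "lab a f = lab a g \<longleftrightarrow> lab a (f - g) = lab a 0"
    and lab_opp: "lab (opp a) (X a f) = lab a f"
    and lab_X: "fst a \<noteq> fst b \<Longrightarrow> lab a f = lab a 0 \<Longrightarrow> lab b (X a f) = lab b 0 \<longleftrightarrow> lab b f = lab b 0"
    and lab_crt: "fst c \<noteq> fst a \<Longrightarrow> fst c \<noteq> fst b \<Longrightarrow>
      \<exists>g. lab a g = lab a 0 \<and> lab b g = lab b 0 \<and> lab c g = lab c f"
begin

lemma X_0 [simp]: "X a 0 = 0"
  using X_add[of a 0 0] by simp

lemma X_minus: "X a (- f) = - X a f"
  using X_add[of a f "- f"] by (simp add: eq_neg_iff_add_eq_0 add.commute)

lemma X_diff: "X a (f - g) = X a f - X a g"
  using X_add[of a f "- g"] by (simp add: X_minus)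

lemma X_opp': "X a (X (opp a) f) = f"
  using X_opp[of "opp a" f] by simp

lemma lab_opp': "lab a (X (opp a) f) = lab (opp a) f"
  using lab_opp[of "opp a" f] by simp

lemma lab_add_eq: "lab a g = lab a 0 \<Longrightarrow> lab a (f + g) = lab a f"
  using lab_eq[of a "f + g" f] by simp

lemma lab_add_cong: "lab a f = lab a f' \<Longrightarrow> lab a (f + g) = lab a (f' + g)"
  using lab_eq[of a "f + g" "f' + g"] lab_eq[of a f f'] by simp

lemma lab_X_cong:
  assumes "fst a \<noteq> fst b" "lab a f = lab a g"
  shows "lab b (X a f) = lab b (X a g) \<longleftrightarrow> lab b f = lab b g"
  using lab_X[OF assms(1), of "f - g"] assms(2) lab_eq[of a f g] lab_eq[of b f g]
    lab_eq[of b "X a f" "X a g"] by (simp add: X_diff)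

lemma ex_lab2:
  assumes "fst c \<noteq> fst a" "y < Q (fst c)"
  shows "\<exists>m'. lab a m' = lab a m \<and> lab c m' = y"
proof -
  obtain t where t: "lab c t = y"
    using lab_surj assms(2) by blast
  obtain g where g: "lab a g = lab a 0" "lab c g = lab c (t - m)"
    using lab_crt[OF assms(1,1)] by blast
  have "lab c (m + g) = lab c (m + (t - m))"
    using lab_add_cong[OF g(2), of m] by (simp add: add.commute)
  then show ?thesis
    using t lab_add_eq[OF g(1), of m] by auto
qed

text \<open>This is \<open>ex_lab2\<close> at the far end of the edge, where the edge is read as
  \<open>opp a\<close>; the configuration found there is then carried back.\<close>

lemma ex_lab2_X:
  assumes "fst c \<noteq> fst a" "y < Q (fst c)"
  shows "\<exists>m'. lab a m' = lab a m \<and> lab c (X a m') = y"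
proof -
  obtain h where h: "lab (opp a) h = lab (opp a) (X a m)" "lab c h = y"
    using ex_lab2[of c "opp a" y "X a m"] assms by auto
  have "lab a (X (opp a) h) = lab a m"
    unfolding lab_opp' h(1) by (rule lab_opp)
  then show ?thesis
    using h(2) by (intro exI[of _ "X (opp a) h"]) (simp add: X_opp')
qed

text \<open>The correction \<open>h\<close> is prescribed at the far corner of the square, with zero
  labels towards \<open>a\<close> and \<open>b\<close>. Carried back along both edges it still has
  zero labels there, so the four sides of the square are unchanged while the label \<open>c\<close>
  at the far corner is free.\<close>

lemma ex_lab3_X:
  assumes "fst c \<noteq> fst a" "fst c \<noteq> fst b" "fst a \<noteq> fst b" "y < Q (fst c)"
  shows "\<exists>m'. lab a m' = lab a m \<and> lab b m' = lab b m \<and> lab a (X b m') = lab a (X b m) \<and>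
    lab b (X a m') = lab b (X a m) \<and> lab c (X a (X b m')) = y"
proof -
  obtain t where t: "lab c t = y"
    using lab_surj assms(4) by blast
  let ?m = "X a (X b m)"
  obtain h where h: "lab (opp a) h = lab (opp a) 0" "lab (opp b) h = lab (opp b) 0"
    "lab c h = lab c (t - ?m)"
    using lab_crt[of c "opp a" "opp b"] assms(1,2) by auto
  define g where "g = X (opp a) (X (opp b) h)"
  have g': "g = X (opp b) (X (opp a) h)"
    by (simp add: g_def X_comm[of "opp a"])
  have "lab (opp a) (X (opp b) h) = lab (opp a) 0"
    using lab_X[of "opp b" "opp a" h] h assms(3) by simp
  then have ga: "lab a g = lab a 0"
    using lab_opp[of a 0] by (simp add: g_def lab_opp')
  have "lab (opp b) (X (opp a) h) = lab (opp b) 0"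
    using lab_X[of "opp a" "opp b" h] h assms(3) by simp
  then have gb: "lab b g = lab b 0"
    using lab_opp[of b 0] by (simp add: g' lab_opp')
  have "X a (X b g) = h"
    unfolding g' by (simp add: X_opp')
  then have "lab c (X a (X b (m + g))) = lab c (h + ?m)"
    by (simp add: X_add add.commute)
  also have "\<dots> = y"
    using lab_add_cong[OF h(3), of ?m] t by simp
  finally have "lab c (X a (X b (m + g))) = y" .
  moreover have "lab a (m + g) = lab a m" "lab b (m + g) = lab b m"
    using lab_add_eq ga gb by auto
  ultimately show ?thesis
    using lab_X_cong[of b a "m + g" m] lab_X_cong[of a b "m + g" m] assms(3)
    by (intro exI[of _ "m + g"]) auto
qed

text \<open>A generator \<open>g\<close> carries configurations \<open>\<mu>\<close> to configurations \<open>m\<close> with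
  \<open>conf g \<mu> m\<close>: a shift adds a constant, and crossing the edge with direction \<open>a\<close> and label \<open>b\<close>
  moves the configuration at its far end to the one at its near end.\<close>

primrec conf :: "'c gen \<Rightarrow> 'c \<Rightarrow> 'c \<Rightarrow> bool" where
  "conf (Sh f) \<mu> m \<longleftrightarrow> m = \<mu> + f"
| "conf (Ed a b) \<mu> m \<longleftrightarrow> \<mu> = X a m \<and> lab a m = b"

primrec valid :: "nat \<Rightarrow> 'c gen \<Rightarrow> bool" where
  "valid l (Sh f) \<longleftrightarrow> True"
| "valid l (Ed a b) \<longleftrightarrow> fst a \<noteq> l \<and> b < Q (fst a)"

text \<open>A Mealy automaton whose states are the generators: on reading the letter
  \<open>y\<close> in direction \<open>c\<close>, state \<open>g\<close> writes
  \<open>out c g y\<close> and becomes \<open>nxt c g y\<close>. For an edge these are the sides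
  opposite to the letter and to the edge in a square. The choice by \<open>SOME\<close> is harmless,
  because all admissible configurations give the same label.\<close>

definition out :: "nat \<times> bool \<Rightarrow> 'c gen \<Rightarrow> nat \<Rightarrow> nat" where
  "out c g y = (SOME z. \<exists>\<mu> m. conf g \<mu> m \<and> lab c \<mu> = y \<and> z = lab c m)"

primrec nxt :: "nat \<times> bool \<Rightarrow> 'c gen \<Rightarrow> nat \<Rightarrow> 'c gen" where
  "nxt c (Sh f) y = Sh (X c f)"
| "nxt c (Ed a b) y = Ed a (SOME z. \<exists>m. lab a m = b \<and> lab c (X a m) = y \<and> z = lab a (X c m))"

fun act :: "nat \<Rightarrow> 'c gen \<Rightarrow> (bool \<times> nat) list \<Rightarrow> (bool \<times> nat) list" where
  "act l g [] = []"
| "act l g (p # w) = (fst p, out (l, fst p) g (snd p)) # act l (nxt (l, fst p) g (snd p)) w"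

text \<open>For an edge: once one side of a square in direction \<open>fst a\<close> is fixed, the
  two sides in the other direction determine each other.\<close>

lemma conf_lab:
  assumes "valid (fst c) g" "conf g \<mu> m" "conf g \<mu>' m'"
  shows "lab c \<mu> = lab c \<mu>' \<longleftrightarrow> lab c m = lab c m'"
proof (cases g)
  case (Sh f)
  then show ?thesis
    using assms lab_eq[of c \<mu> \<mu>'] lab_eq[of c m m'] by simp
next
  case (Ed a b)
  then show ?thesis
    using assms lab_X_cong[of a c m m'] by simp
qed

lemma out_conf:
  assumes "valid (fst c) g" "conf g \<mu> m"
  shows "out c g (lab c \<mu>) = lab c m"
  unfolding out_def
  by (rule some_equality) (use assms conf_lab[OF assms(1)] in blast)+

lemma out_Sh: "out c (Sh f) (lab c m) = lab c (m + f)"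
  by (rule out_conf) simp_all

lemma out_Ed: "fst a \<noteq> fst c \<Longrightarrow> out c (Ed a (lab a m)) (lab c (X a m)) = lab c m"
  by (rule out_conf) (simp_all add: lab_less)

text \<open>The square has the corners \<open>m\<close>, \<open>X a m\<close>, \<open>X c m\<close>
  and \<open>X a (X c m)\<close>. The side \<open>a\<close> at \<open>m\<close> and the side
  \<open>c\<close> at \<open>X a m\<close> determine the side \<open>c\<close> at \<open>m\<close>,
  and then the side \<open>a\<close> at \<open>X c m\<close>.\<close>

lemma nxt_Ed:
  assumes "fst a \<noteq> fst c"
  shows "nxt c (Ed a (lab a m)) (lab c (X a m)) = Ed a (lab a (X c m))"
proof -
  have "(SOME z. \<exists>m'. lab a m' = lab a m \<and> lab c (X a m') = lab c (X a m) \<and> z = lab a (X c m')) =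
    lab a (X c m)"
  proof (rule some_equality)
    fix z assume "\<exists>m'. lab a m' = lab a m \<and> lab c (X a m') = lab c (X a m) \<and> z = lab a (X c m')"
    then obtain m' where m': "lab a m' = lab a m" "lab c (X a m') = lab c (X a m)" "z = lab a (X c m')"
      by blast
    then have "lab c m' = lab c m"
      using lab_X_cong[OF assms] by simp
    then show "z = lab a (X c m)"
      using lab_X_cong[of c a m' m] assms m' by simp
  qed blast
  then show ?thesis by simp
qed

lemma ex_conf:
  assumes "valid (fst c) g" "y < Q (fst c)"
  shows "\<exists>\<mu> m. conf g \<mu> m \<and> lab c \<mu> = y"
proof (cases g)
  case (Sh f)
  then show ?thesis
    using lab_surj[OF assms(2)] by auto
next
  case (Ed a b)
  then obtain m0 where "lab a m0 = b"
    using assms(1) lab_surj[of b a] by auto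
  then show ?thesis
    using ex_lab2_X[of c a y m0] assms Ed by auto
qed

text \<open>As the maps \<open>X\<close> commute and are additive, both ends of a generator can move
  along \<open>c\<close> together. The automaton can thus be computed on configurations.\<close>

lemma nxt_conf:
  assumes "valid (fst c) g" "conf g \<mu> m"
  shows "conf (nxt c g (lab c \<mu>)) (X c \<mu>) (X c m)"
proof (cases g)
  case (Ed a b)
  then have "nxt c g (lab c \<mu>) = Ed a (lab a (X c m))"
    using assms nxt_Ed[of a c m] by auto
  then show ?thesis
    using Ed assms(2) by (simp add: X_comm)
qed (use assms in \<open>simp add: X_add\<close>)

lemma valid_nxt:
  assumes "valid (fst c) g" "y < Q (fst c)"
  shows "valid (fst c) (nxt c g y)"
proof -
  obtain \<mu> m where m: "conf g \<mu> m" "lab c \<mu> = y"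
    using ex_conf[OF assms] by blast
  show ?thesis
  proof (cases g)
    case (Ed a b)
    then have "nxt c g y = Ed a (lab a (X c m))"
      using assms m nxt_Ed[of a c m] by auto
    then show ?thesis
      using Ed assms lab_less by simp
  qed simp
qed

lemma out_less:
  assumes "valid (fst c) g" "y < Q (fst c)"
  shows "out c g y < Q (fst c)"
  using ex_conf[OF assms] out_conf[OF assms(1)] lab_less by metis

lemma out_inj:
  assumes "valid (fst c) g" "y < Q (fst c)" "y' < Q (fst c)" "out c g y = out c g y'"
  shows "y = y'"
proof -
  obtain \<mu> m \<mu>' m' where "conf g \<mu> m" "lab c \<mu> = y" "conf g \<mu>' m'" "lab c \<mu>' = y'"
    using ex_conf[OF assms(1,2)] ex_conf[OF assms(1,3)] by blast
  then show ?thesis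
    using assms(4) out_conf[OF assms(1)] conf_lab[OF assms(1)] by metis
qed

text \<open>Reading the inverse letter right after the letter crosses the same square backwards,
  which also returns the automaton to its state (\<open>nxt_opp\<close>).\<close>

lemma out_opp:
  assumes "valid (fst c) g" "y < Q (fst c)"
  shows "out (opp c) (nxt c g y) y = out c g y"
proof -
  obtain \<mu> m where m: "conf g \<mu> m" "lab c \<mu> = y"
    using ex_conf[OF assms] by blast
  have "out (opp c) (nxt c g y) (lab (opp c) (X c \<mu>)) = lab (opp c) (X c m)"
    by (rule out_conf) (use assms m nxt_conf[OF assms(1) m(1)] valid_nxt[OF assms] in auto)
  then show ?thesis
    using m out_conf[OF assms(1) m(1)] by (simp add: lab_opp)
qed

lemma nxt_opp:
  assumes "valid (fst c) g" "y < Q (fst c)"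
  shows "nxt (opp c) (nxt c g y) y = g"
proof -
  obtain \<mu> m where m: "conf g \<mu> m" "lab c \<mu> = y"
    using ex_conf[OF assms] by blast
  show ?thesis
  proof (cases g)
    case (Sh f)
    then show ?thesis by (simp add: X_opp)
  next
    case (Ed a b)
    then have ac: "fst a \<noteq> fst c" and \<mu>: "\<mu> = X a m" "lab a m = b"
      using assms m by auto
    have "nxt c g y = Ed a (lab a (X c m))"
      using Ed m nxt_Ed[OF ac, of m] by auto
    moreover have "y = lab (opp c) (X a (X c m))"
      using m \<mu> lab_opp[of c "X a m"] by (simp add: X_comm[of a c])
    ultimately show ?thesis
      using nxt_Ed[of a "opp c" "X c m"] ac Ed \<mu> by (simp add: X_opp)
  qed
qed

lemma act_eq_Nil [simp]: "act l g w = [] \<longleftrightarrow> w = []"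
  by (cases w) auto

lemma act_append: "\<exists>h. act l g (u @ w) = act l g u @ act l h w"
  by (induction u arbitrary: g) auto

text \<open>By \<open>out_opp\<close> and \<open>out_inj\<close> a cancelling pair in the output can
  only come from a cancelling pair in the input.\<close>

lemma act_red:
  assumes "valid l g" "w \<in> red_words (Q l)"
  shows "act l g w \<in> red_words (Q l)"
  using assms
proof (induction w arbitrary: g)
  case (Cons p w)
  let ?c = "(l, fst p)"
  let ?g = "nxt ?c g (snd p)"
  have p: "snd p < Q l" and w: "w \<in> red_words (Q l)"
    using Cons.prems by (auto simp: red_words_Cons)
  have v: "valid l ?g"
    using valid_nxt[of ?c g "snd p"] Cons.prems(1) p by simp
  have "hd (act l ?g w) \<noteq> (\<not> fst p, out ?c g (snd p))" if nonempty: "w \<noteq> []"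
  proof
    assume eq: "hd (act l ?g w) = (\<not> fst p, out ?c g (snd p))"
    obtain q u where qu: "w = q # u"
      using nonempty by (meson neq_Nil_conv)
    have q: "snd q < Q l" "q \<noteq> (\<not> fst p, snd p)"
      using Cons.prems(2) qu by (auto simp: red_words_Cons)
    have fq: "fst q = (\<not> fst p)" and "out (opp ?c) ?g (snd q) = out ?c g (snd p)"
      using eq qu by auto
    then have "out (opp ?c) ?g (snd q) = out (opp ?c) ?g (snd p)"
      using out_opp[of ?c g "snd p"] Cons.prems(1) p by simp
    then have "snd q = snd p"
      using out_inj[of "opp ?c" ?g "snd q" "snd p"] v p q by simp
    then show False
      using q(2) fq by (simp add: prod_eq_iff)
  qed
  then show ?case
    using Cons.IH[OF v w] out_less[of ?c g "snd p"] Cons.prems(1) p by (simp add: red_words_Cons)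
qed simp

lemma act_lcons:
  assumes "valid l g" "snd p < Q l" "w \<in> red_words (Q l)"
  shows "act l g (lcons p w) = lcons (fst p, out (l, fst p) g (snd p)) (act l (nxt (l, fst p) g (snd p)) w)"
proof -
  let ?c = "(l, fst p)"
  let ?g = "nxt ?c g (snd p)"
  have v: "valid l ?g"
    using valid_nxt[of ?c g "snd p"] assms by simp
  show ?thesis
  proof (cases w)
    case Nil
    then show ?thesis by (simp add: lcons_def)
  next
    case (Cons q u)
    show ?thesis
    proof (cases "q = (\<not> fst p, snd p)")
      case True
      then show ?thesis
        using Cons out_opp[of ?c g "snd p"] nxt_opp[of ?c g "snd p"] assms
        by (simp add: lcons_def)
    next
      case False
      have "(fst q, out (l, fst q) ?g (snd q)) \<noteq> (\<not> fst p, out ?c g (snd p))"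
      proof
        assume eq: "(fst q, out (l, fst q) ?g (snd q)) = (\<not> fst p, out ?c g (snd p))"
        then have "fst q = (\<not> fst p)" "out (l, fst q) ?g (snd q) = out ?c g (snd p)"
          unfolding prod.inject by blast+
        then have "out (opp ?c) ?g (snd q) = out (opp ?c) ?g (snd p)"
          using out_opp[of ?c g "snd p"] assms by simp
        moreover have "snd q < Q l"
          using assms(3) Cons by (simp add: red_words_Cons)
        ultimately have "snd q = snd p"
          using out_inj[of "opp ?c" ?g "snd q" "snd p"] v assms by simp
        then show False
          using eq False by (metis fst_conv prod.collapse)
      qed
      then show ?thesis
        using Cons False by (simp add: lcons_def)
    qed
  qed
qed

lemma act_Sh_add:
  assumes "w \<in> red_words (Q l)"
  shows "act l (Sh f) (act l (Sh g) w) = act l (Sh (f + g)) w"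
  using assms
proof (induction w arbitrary: f g)
  case (Cons p w)
  let ?c = "(l, fst p)"
  obtain m where m: "lab ?c m = snd p"
    using lab_surj[of "snd p" ?c] Cons.prems by (auto simp: red_words_Cons)
  have "out ?c (Sh f) (out ?c (Sh g) (snd p)) = out ?c (Sh (f + g)) (snd p)"
    unfolding m[symmetric] by (simp add: out_Sh add_ac)
  then show ?case
    using Cons by (simp add: red_words_Cons X_add)
qed simp

lemma act_Sh_0:
  assumes "w \<in> red_words (Q l)"
  shows "act l (Sh 0) w = w"
  using assms
proof (induction w)
  case (Cons p w)
  let ?c = "(l, fst p)"
  obtain m where m: "lab ?c m = snd p"
    using lab_surj[of "snd p" ?c] Cons.prems by (auto simp: red_words_Cons)
  have "out ?c (Sh 0) (snd p) = snd p"
    unfolding m[symmetric] by (simp add: out_Sh)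
  then show ?case
    using Cons by (simp add: red_words_Cons)
qed simp

lemma act_Sh_Ed:
  assumes "fst a \<noteq> l" "w \<in> red_words (Q l)"
  shows "act l (Sh f) (act l (Ed a (lab a m)) w) = act l (Ed a (lab a (m + f))) (act l (Sh (X a f)) w)"
  using assms(2)
proof (induction w arbitrary: f m)
  case (Cons p w)
  let ?c = "(l, fst p)"
  \<comment> \<open>The claim depends on \<open>m\<close> only through \<open>lab a m\<close>. The
    word begins at the far end of the edge, so \<open>m'\<close> is chosen with its first letter as
    label there; the induction then continues with \<open>X ?c m'\<close>.\<close>
  obtain m' where m': "lab a m' = lab a m" "lab ?c (X a m') = snd p"
    using ex_lab2_X[of ?c a "snd p" m] assms(1) Cons.prems by (auto simp: red_words_Cons)
  have eq: "lab a (m + f) = lab a (m' + f)"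
    using lab_add_cong[OF m'(1)] by simp
  have "X a m' + X a f = X a (m' + f)"
    by (simp add: X_add)
  then have "out ?c (Sh (X a f)) (snd p) = lab ?c (X a (m' + f))"
    using out_Sh[of ?c "X a f" "X a m'"] m'(2) by simp
  then show ?case
    unfolding eq m'(1)[symmetric] using assms(1) m'(2) Cons.IH[of "X ?c f" "X ?c m'"] Cons.prems
      out_Ed[of a ?c m'] nxt_Ed[of a ?c m'] out_Ed[of a ?c "m' + f"] nxt_Ed[of a ?c "m' + f"]
    by (simp add: red_words_Cons out_Sh X_add X_comm[of a ?c] del: nxt.simps(2))
qed simp

lemma act_Ed_opp:
  assumes "fst a \<noteq> l" "w \<in> red_words (Q l)"
  shows "act l (Ed a (lab a m)) (act l (Ed (opp a) (lab a m)) w) = w"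
  using assms(2)
proof (induction w arbitrary: m)
  case (Cons p w)
  let ?c = "(l, fst p)"
  \<comment> \<open>The inner edge is crossed backwards, from \<open>X a m'\<close> to
    \<open>m'\<close>, so here the first letter has to be a label of \<open>m'\<close>
    itself.\<close>
  obtain m' where m': "lab a m' = lab a m" "lab ?c m' = snd p"
    using ex_lab2[of ?c a "snd p" m] assms(1) Cons.prems by (auto simp: red_words_Cons)
  have "out ?c (Ed (opp a) (lab a m')) (snd p) = lab ?c (X a m')"
    using out_Ed[of "opp a" ?c "X a m'"] assms(1) m'(2) by (simp add: lab_opp X_opp)
  moreover have "nxt ?c (Ed (opp a) (lab a m')) (snd p) = Ed (opp a) (lab a (X ?c m'))"
    using nxt_Ed[of "opp a" ?c "X a m'"] assms(1) m'(2)
    by (simp add: lab_opp X_opp X_comm[of ?c a] del: nxt.simps(2))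
  ultimately show ?case
    unfolding m'(1)[symmetric] using assms(1) m'(2) Cons.IH[of "X ?c m'"] Cons.prems
      out_Ed[of a ?c m'] nxt_Ed[of a ?c m']
    by (simp add: red_words_Cons del: nxt.simps(2))
qed simp

lemma act_Ed_Ed:
  assumes "fst a \<noteq> l" "fst b \<noteq> l" "fst a \<noteq> fst b" "w \<in> red_words (Q l)"
  shows "act l (Ed a (lab a m)) (act l (Ed b (lab b (X a m))) w) =
    act l (Ed b (lab b m)) (act l (Ed a (lab a (X b m))) w)"
  using assms(4)
proof (induction w arbitrary: m)
  case (Cons p w)
  let ?c = "(l, fst p)"
  \<comment> \<open>The word begins at the corner \<open>X a (X b m)\<close> of the square opposite
    to \<open>m\<close>. All four side labels occur in the claim and must be kept while the first
    letter is realized at that corner.\<close>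
  obtain m' where m': "lab a m' = lab a m" "lab b m' = lab b m" "lab a (X b m') = lab a (X b m)"
    "lab b (X a m') = lab b (X a m)" "lab ?c (X a (X b m')) = snd p"
    using ex_lab3_X[of ?c a b "snd p" m] assms Cons.prems by (auto simp: red_words_Cons)
  have m'': "lab ?c (X b (X a m')) = snd p"
    using m'(5) by (simp add: X_comm)
  have "out ?c (Ed b (lab b (X a m'))) (snd p) = lab ?c (X a m')"
    "nxt ?c (Ed b (lab b (X a m'))) (snd p) = Ed b (lab b (X a (X ?c m')))"
    using out_Ed[of b ?c "X a m'"] nxt_Ed[of b ?c "X a m'"] assms(2) m''
    by (simp_all add: X_comm[of ?c a] del: nxt.simps(2))
  moreover have "out ?c (Ed a (lab a (X b m'))) (snd p) = lab ?c (X b m')"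
    "nxt ?c (Ed a (lab a (X b m'))) (snd p) = Ed a (lab a (X b (X ?c m')))"
    using out_Ed[of a ?c "X b m'"] nxt_Ed[of a ?c "X b m'"] assms(1) m'(5)
    by (simp_all add: X_comm[of ?c b] del: nxt.simps(2))
  ultimately show ?case
    unfolding m'(1-4)[symmetric] using assms(1,2) Cons.IH[of "X ?c m'"] Cons.prems
      out_Ed[of a ?c m'] nxt_Ed[of a ?c m'] out_Ed[of b ?c m'] nxt_Ed[of b ?c m']
    by (simp add: red_words_Cons del: nxt.simps(2))
qed simp

text \<open>On the tree of its own direction an edge acts by translation in the free group; on all
  other trees it acts by the automaton and fixes the root.\<close>

definition gact :: "nat \<Rightarrow> 'c gen \<Rightarrow> (bool \<times> nat) list \<Rightarrow> (bool \<times> nat) list" where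
  "gact l g w = (case g of Sh f \<Rightarrow> act l g w
     | Ed a b \<Rightarrow> if fst a = l then lcons (snd a, b) w else act l g w)"

primrec gvalid :: "'c gen \<Rightarrow> bool" where
  "gvalid (Sh f) \<longleftrightarrow> True"
| "gvalid (Ed a b) \<longleftrightarrow> b < Q (fst a)"

primrec ginv :: "'c gen \<Rightarrow> 'c gen" where
  "ginv (Sh f) = Sh (- f)"
| "ginv (Ed a b) = Ed (opp a) b"

lemma gvalid_ginv [simp]: "gvalid (ginv g) \<longleftrightarrow> gvalid g"
  by (cases g) auto

lemma ginv_ginv [simp]: "ginv (ginv g) = g"
  by (cases g) auto

lemma gact_in:
  assumes "gvalid g" "w \<in> red_words (Q l)"
  shows "gact l g w \<in> red_words (Q l)"
  using assms act_red[of l g w] lcons_in[of w "Q l"] by (cases g) (auto simp: gact_def)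

lemma gact_nbr: "nbr (gact l g w) (gact l g (w @ [p]))"
proof (cases "\<exists>a b. g = Ed a b \<and> fst a = l")
  case True
  then show ?thesis
    by (auto simp: gact_def intro: lcons_nbr)
next
  case False
  then have "gact l g = act l g"
    by (cases g) (auto simp: gact_def)
  moreover obtain h where "act l g (w @ [p]) = act l g w @ act l h [p]"
    using act_append by blast
  ultimately show ?thesis
    by (auto simp: nbr_def)
qed

lemma gact_Sh_add:
  "w \<in> red_words (Q l) \<Longrightarrow> gact l (Sh f) (gact l (Sh g) w) = gact l (Sh (f + g)) w"
  by (simp add: gact_def act_Sh_add)

lemma gact_Sh_0: "w \<in> red_words (Q l) \<Longrightarrow> gact l (Sh 0) w = w"
  by (simp add: gact_def act_Sh_0)

lemma gact_Sh_Ed: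
  assumes "w \<in> red_words (Q l)"
  shows "gact l (Sh f) (gact l (Ed a (lab a m)) w) = gact l (Ed a (lab a (m + f))) (gact l (Sh (X a f)) w)"
proof (cases "fst a = l")
  case True
  then have a: "a = (l, snd a)" by auto
  have "act l (Sh f) (lcons (snd a, lab a m) w) =
      lcons (snd a, out a (Sh f) (lab a m)) (act l (nxt a (Sh f) (lab a m)) w)"
    using act_lcons[of l "Sh f" "(snd a, lab a m)" w] assms lab_less[of a m] True a by simp
  then show ?thesis
    using True by (simp add: gact_def out_Sh)
next
  case False
  then show ?thesis
    using act_Sh_Ed[OF False assms] by (simp add: gact_def)
qed

lemma gact_Ed_opp:
  assumes "b < Q (fst a)" "w \<in> red_words (Q l)"
  shows "gact l (Ed a b) (gact l (Ed (opp a) b) w) = w"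
proof (cases "fst a = l")
  case True
  then show ?thesis
    using lcons_cancel[OF assms(2), of "(snd a, b)"] by (simp add: gact_def)
next
  case False
  obtain m where "lab a m = b"
    using lab_surj assms(1) by blast
  then show ?thesis
    using act_Ed_opp[OF False assms(2), of m] False by (simp add: gact_def)
qed

lemma gact_ginv:
  assumes "gvalid g" "w \<in> red_words (Q l)"
  shows "gact l g (gact l (ginv g) w) = w"
  using assms gact_Ed_opp by (cases g) (auto simp: gact_Sh_add gact_Sh_0)

lemma gact_Ed_Ed_own:
  assumes "fst a = l" "fst b \<noteq> l" "w \<in> red_words (Q l)"
  shows "gact l (Ed a (lab a m)) (gact l (Ed b (lab b (X a m))) w) =
    gact l (Ed b (lab b m)) (gact l (Ed a (lab a (X b m))) w)"
proof -
  have a: "a = (l, snd a)" using assms(1) by auto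
  have "act l (Ed b (lab b m)) (lcons (snd a, lab a (X b m)) w) =
      lcons (snd a, out a (Ed b (lab b m)) (lab a (X b m)))
        (act l (nxt a (Ed b (lab b m)) (lab a (X b m))) w)"
    using act_lcons[of l "Ed b (lab b m)" "(snd a, lab a (X b m))" w] assms
      lab_less[of a "X b m"] lab_less[of b m] a by (simp del: nxt.simps(2))
  also have "\<dots> = lcons (snd a, lab a m) (act l (Ed b (lab b (X a m))) w)"
    using out_Ed[of b a m] nxt_Ed[of b a m] assms by (simp del: nxt.simps(2))
  finally show ?thesis
    using assms by (simp add: gact_def)
qed

lemma gact_Ed_Ed:
  assumes "fst a \<noteq> fst b" "w \<in> red_words (Q l)"
  shows "gact l (Ed a (lab a m)) (gact l (Ed b (lab b (X a m))) w) =
    gact l (Ed b (lab b m)) (gact l (Ed a (lab a (X b m))) w)"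
proof -
  consider "fst a = l" | "fst b = l" | "fst a \<noteq> l" "fst b \<noteq> l" by blast
  then show ?thesis
  proof cases
    case 1
    then show ?thesis using gact_Ed_Ed_own[OF 1 _ assms(2)] assms(1) by simp
  next
    case 2
    then show ?thesis using gact_Ed_Ed_own[of b l a w m] assms by simp
  next
    case 3
    then show ?thesis
      using act_Ed_Ed[OF 3 assms] by (simp add: gact_def)
  qed
qed

end

section \<open>The group generated by edges and shifts, and its normal forms\<close>

locale cube_product = cube X Q lab
  for X :: "nat \<times> bool \<Rightarrow> 'c::ab_group_add \<Rightarrow> 'c" and Q lab +
  fixes n :: nat and I :: "nat set"
  assumes I_eq: "I = {1..n}"
begin

sublocale T: tree_product I "\<lambda>i. 2 * Q i"
  by standard (simp add: I_eq)

abbreviation (input) GG where "GG \<equiv> tree_prod_group I (\<lambda>i. 2 * Q i)"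

definition el :: "'c gen \<Rightarrow> nat \<Rightarrow> nat list \<Rightarrow> nat list" where
  "el g = (\<lambda>i\<in>I. tree_map (Q i) (gact i g))"

lemma el_carrier:
  assumes "gvalid g"
  shows "el g \<in> carrier GG"
  unfolding T.carrier_iff
proof (rule PiE_I)
  fix i assume i: "i \<in> I"
  have "tree_map (Q i) (gact i g) \<in> graph_auts (tree_verts (2 * Q i)) (tree_edges (2 * Q i))"
  proof (rule tree_map_aut[where \<psi> = "gact i (ginv g)"])
    fix w assume w: "w \<in> red_words (Q i)"
    show "gact i g w \<in> red_words (Q i) \<and> gact i (ginv g) w \<in> red_words (Q i) \<and>
        gact i g (gact i (ginv g) w) = w \<and> gact i (ginv g) (gact i g w) = w"
      using gact_in[OF assms w] gact_in[of "ginv g" w] gact_ginv[OF assms w]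
        gact_ginv[of "ginv g" w] assms w by simp
  qed (use gact_nbr in blast)
  then show "el g i \<in> graph_auts (tree_verts (2 * Q i)) (tree_edges (2 * Q i))"
    using i by (simp add: el_def)
qed (simp add: el_def)

lemma el_apply:
  "i \<in> I \<Longrightarrow> w \<in> red_words (Q i) \<Longrightarrow> el g i (encode (Q i) w) = encode (Q i) (gact i g w)"
  by (simp add: el_def tree_map_def encode_in decode_encode)

lemma el_eqI:
  assumes "x \<in> carrier GG" "y \<in> carrier GG"
    and "\<And>i w. i \<in> I \<Longrightarrow> w \<in> red_words (Q i) \<Longrightarrow> x i (encode (Q i) w) = y i (encode (Q i) w)"
  shows "x = y"
proof (rule T.eqI[OF assms(1,2)])
  fix i v assume "i \<in> I" "v \<in> tree_verts (2 * Q i)"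
  then show "x i v = y i v"
    using assms(3)[of i "decode (Q i) v"] by (simp add: decode_in encode_decode)
qed

lemma el_mult_apply:
  assumes "gvalid g" "gvalid h" "i \<in> I" "w \<in> red_words (Q i)"
  shows "(el g \<otimes>\<^bsub>GG\<^esub> el h) i (encode (Q i) w) = encode (Q i) (gact i g (gact i h w))"
  using T.mult_apply[OF el_carrier[OF assms(1)] el_carrier[OF assms(2)] assms(3) encode_in[OF assms(4)]]
    el_apply[OF assms(3,4)] el_apply[OF assms(3) gact_in[OF assms(2,4)]] by simp

lemma el_Sh_add: "el (Sh f) \<otimes>\<^bsub>GG\<^esub> el (Sh g) = el (Sh (f + g))"
  by (rule el_eqI) (simp_all add: el_carrier el_mult_apply el_apply gact_Sh_add)

lemma el_Sh_0: "el (Sh 0) = \<one>\<^bsub>GG\<^esub>"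
  by (rule el_eqI) (simp_all add: el_carrier el_apply gact_Sh_0 T.one_apply encode_in)

lemma el_ginv: "gvalid g \<Longrightarrow> el g \<otimes>\<^bsub>GG\<^esub> el (ginv g) = \<one>\<^bsub>GG\<^esub>"
  by (rule el_eqI) (simp_all add: el_carrier el_mult_apply gact_ginv T.one_apply encode_in)

lemma inv_el: "gvalid g \<Longrightarrow> inv\<^bsub>GG\<^esub> (el g) = el (ginv g)"
  using T.inv_equality[OF el_ginv[of "ginv g"]] by (simp add: el_carrier)

lemma el_Sh_Ed:
  "el (Sh f) \<otimes>\<^bsub>GG\<^esub> el (Ed a (lab a m)) = el (Ed a (lab a (m + f))) \<otimes>\<^bsub>GG\<^esub> el (Sh (X a f))"
  by (rule el_eqI) (simp_all add: el_carrier el_mult_apply lab_less gact_Sh_Ed)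

lemma el_Ed_Ed:
  "fst a \<noteq> fst b \<Longrightarrow> el (Ed a (lab a m)) \<otimes>\<^bsub>GG\<^esub> el (Ed b (lab b (X a m))) =
    el (Ed b (lab b m)) \<otimes>\<^bsub>GG\<^esub> el (Ed a (lab a (X b m)))"
  by (rule el_eqI) (simp_all add: el_carrier el_mult_apply lab_less gact_Ed_Ed)

lemma el_root:
  assumes "i \<in> I"
  shows "el g i [] = encode (Q i) (gact i g [])"
  using el_apply[OF assms, of "[]"] by simp

lemma gact_Sh_Nil [simp]: "gact i (Sh f) [] = []"
  and gact_Ed_Nil [simp]: "gact i (Ed a b) [] = (if fst a = i then [(snd a, b)] else [])"
  by (simp_all add: gact_def lcons_def)

definition wd :: "nat \<Rightarrow> (bool \<times> nat) list \<Rightarrow> nat \<Rightarrow> nat list \<Rightarrow> nat list" where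
  "wd i u = foldr (\<lambda>p h. el (Ed (i, fst p) (snd p)) \<otimes>\<^bsub>GG\<^esub> h) u \<one>\<^bsub>GG\<^esub>"

lemma wd_Nil [simp]: "wd i [] = \<one>\<^bsub>GG\<^esub>"
  and wd_Cons: "wd i (p # u) = el (Ed (i, fst p) (snd p)) \<otimes>\<^bsub>GG\<^esub> wd i u"
  by (simp_all add: wd_def)

lemma Ed_carrier: "b < Q (fst a) \<Longrightarrow> el (Ed a b) \<in> carrier GG"
  and Sh_carrier: "el (Sh f) \<in> carrier GG"
  by (simp_all add: el_carrier)

lemma wd_carrier: "u \<in> red_words (Q i) \<Longrightarrow> wd i u \<in> carrier GG"
proof (induction u)
  case (Cons p u)
  then have "snd p < Q i" "u \<in> red_words (Q i)"
    by (simp_all add: red_words_Cons)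
  then show ?case
    using Cons.IH Ed_carrier[of "snd p" "(i, fst p)"] by (simp add: wd_Cons)
qed simp

lemma wd_lcons:
  assumes "u \<in> red_words (Q i)" "snd p < Q i"
  shows "el (Ed (i, fst p) (snd p)) \<otimes>\<^bsub>GG\<^esub> wd i u = wd i (lcons p u)"
proof (cases "u \<noteq> [] \<and> hd u = (\<not> fst p, snd p)")
  case True
  then obtain u' where u': "u = (\<not> fst p, snd p) # u'"
    by (cases u) auto
  have c: "wd i u' \<in> carrier GG"
    using assms(1) u' by (intro wd_carrier) (simp add: red_words_Cons)
  have e: "el (Ed (i, fst p) (snd p)) \<otimes>\<^bsub>GG\<^esub> el (Ed (i, \<not> fst p) (snd p)) = \<one>\<^bsub>GG\<^esub>"
    using el_ginv[of "Ed (i, fst p) (snd p)"] assms(2) by simp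
  have "el (Ed (i, fst p) (snd p)) \<otimes>\<^bsub>GG\<^esub> wd i u =
      (el (Ed (i, fst p) (snd p)) \<otimes>\<^bsub>GG\<^esub> el (Ed (i, \<not> fst p) (snd p))) \<otimes>\<^bsub>GG\<^esub> wd i u'"
    unfolding u' wd_Cons using c assms(2) by (simp add: T.m_assoc Ed_carrier)
  also have "\<dots> = wd i u'"
    unfolding e using c by simp
  finally show ?thesis
    using u' by (simp add: lcons_def)
next
  case False
  then show ?thesis
    by (auto simp: lcons_def wd_Cons)
qed

lemma wd_root:
  assumes "i \<in> I" "j \<in> I" "u \<in> red_words (Q i)"
  shows "wd i u j [] = (if j = i then encode (Q i) u else [])"
  using assms(3)
proof (induction u)
  case Nil
  then show ?case
    using assms by (simp add: T.one_apply Nil_tree_verts)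
next
  case (Cons p u)
  then have u: "snd p < Q i" "u \<in> red_words (Q i)"
    by (simp_all add: red_words_Cons)
  have "wd i (p # u) j [] = el (Ed (i, fst p) (snd p)) j (wd i u j [])"
    unfolding wd_Cons using T.mult_apply[OF Ed_carrier wd_carrier[OF u(2)] assms(2) Nil_tree_verts] u by simp
  also have "wd i u j [] = encode (Q j) (if j = i then u else [])"
    using Cons.IH[OF u(2)] by simp
  also have "el (Ed (i, fst p) (snd p)) j \<dots> =
      encode (Q j) (gact j (Ed (i, fst p) (snd p)) (if j = i then u else []))"
    using u by (intro el_apply assms) simp
  also have "\<dots> = (if j = i then encode (Q i) (p # u) else [])"
    using Cons.prems by (auto simp: gact_def lcons_def red_words_Cons)
  finally show ?case .
qed

text \<open>Besides being a subgroup, \<open>F\<close> must be stable under every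
  \<open>X a\<close>, since moving a shift past an edge applies \<open>X a\<close> to it.\<close>

definition shift_closed :: "'c set \<Rightarrow> bool" where
  "shift_closed F \<longleftrightarrow> 0 \<in> F \<and> (\<forall>f\<in>F. \<forall>g\<in>F. f + g \<in> F) \<and> (\<forall>f\<in>F. - f \<in> F) \<and> (\<forall>a. \<forall>f\<in>F. X a f \<in> F)"

lemma Sh_wd:
  assumes "shift_closed F" "f \<in> F" "u \<in> red_words (Q i)"
  shows "\<exists>u'\<in>red_words (Q i). \<exists>f'\<in>F. el (Sh f) \<otimes>\<^bsub>GG\<^esub> wd i u = wd i u' \<otimes>\<^bsub>GG\<^esub> el (Sh f')"
  using assms(2,3)
proof (induction u arbitrary: f)
  case Nil
  then show ?case
    using Sh_carrier by (intro bexI[of _ "[]"] bexI[of _ f]) simp_all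
next
  case (Cons p u)
  let ?a = "(i, fst p)"
  have u: "snd p < Q i" "u \<in> red_words (Q i)"
    using Cons.prems by (simp_all add: red_words_Cons)
  obtain m where m: "lab ?a m = snd p"
    using lab_surj[of "snd p" ?a] u by auto
  have Xf: "X ?a f \<in> F"
    using assms(1) Cons.prems by (simp add: shift_closed_def)
  obtain u' f' where u': "u' \<in> red_words (Q i)" "f' \<in> F"
    "el (Sh (X ?a f)) \<otimes>\<^bsub>GG\<^esub> wd i u = wd i u' \<otimes>\<^bsub>GG\<^esub> el (Sh f')"
    using Cons.IH[OF Xf u(2)] by blast
  let ?y = "lab ?a (m + f)"
  have y: "?y < Q i"
    using lab_less[of ?a] by simp
  note c = wd_carrier[OF u(2)] wd_carrier[OF u'(1)] Sh_carrier
    Ed_carrier[of "snd p" ?a] Ed_carrier[of ?y ?a]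
  have "el (Sh f) \<otimes>\<^bsub>GG\<^esub> wd i (p # u) = (el (Sh f) \<otimes>\<^bsub>GG\<^esub> el (Ed ?a (snd p))) \<otimes>\<^bsub>GG\<^esub> wd i u"
    unfolding wd_Cons using c u y by (simp add: T.m_assoc)
  also have "\<dots> = (el (Ed ?a ?y) \<otimes>\<^bsub>GG\<^esub> el (Sh (X ?a f))) \<otimes>\<^bsub>GG\<^esub> wd i u"
    unfolding m[symmetric] el_Sh_Ed ..
  also have "\<dots> = (el (Ed ?a ?y) \<otimes>\<^bsub>GG\<^esub> wd i u') \<otimes>\<^bsub>GG\<^esub> el (Sh f')"
    using c u y u'(3) by (simp add: T.m_assoc)
  also have "el (Ed ?a ?y) \<otimes>\<^bsub>GG\<^esub> wd i u' = wd i (lcons (fst p, ?y) u')"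
    using wd_lcons[OF u'(1), of "(fst p, ?y)"] y by simp
  finally show ?case
    using u' lcons_in[OF u'(1), of "(fst p, ?y)"] y by (metis snd_conv)
qed

lemma Ed_wd:
  assumes "fst a \<noteq> i" "b < Q (fst a)" "u \<in> red_words (Q i)"
  shows "\<exists>u'\<in>red_words (Q i). \<exists>b'<Q (fst a). el (Ed a b) \<otimes>\<^bsub>GG\<^esub> wd i u = wd i u' \<otimes>\<^bsub>GG\<^esub> el (Ed a b')"
  using assms(2,3)
proof (induction u arbitrary: b)
  case Nil
  then have "el (Ed a b) \<otimes>\<^bsub>GG\<^esub> wd i [] = wd i [] \<otimes>\<^bsub>GG\<^esub> el (Ed a b)"
    using Ed_carrier by simp
  then show ?case
    using Nil Nil_red_words by blast
next
  case (Cons p u)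
  let ?c = "(i, fst p)"
  have u: "snd p < Q i" "u \<in> red_words (Q i)"
    using Cons.prems by (simp_all add: red_words_Cons)
  obtain m0 where "lab a m0 = b"
    using lab_surj Cons.prems(1) by blast
  \<comment> \<open>\<open>m\<close> realizes the square that has the given edge at its near corner
    and the letter \<open>p\<close> at the end of that edge; its other two sides give the exchanged
    product.\<close>
  then obtain m where m: "lab a m = b" "lab ?c (X a m) = snd p"
    using ex_lab2_X[of ?c a "snd p" m0] assms(1) u by auto
  let ?b = "lab a (X ?c m)"
  let ?y = "lab ?c m"
  have y: "?y < Q i" "?b < Q (fst a)"
    using lab_less[of ?c] lab_less[of a] by auto
  obtain u' b' where u': "u' \<in> red_words (Q i)" "b' < Q (fst a)"
    "el (Ed a ?b) \<otimes>\<^bsub>GG\<^esub> wd i u = wd i u' \<otimes>\<^bsub>GG\<^esub> el (Ed a b')"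
    using Cons.IH[OF y(2) u(2)] by blast
  note c = wd_carrier[OF u(2)] wd_carrier[OF u'(1)] Ed_carrier[of b a] Ed_carrier[of ?b a]
    Ed_carrier[of b' a] Ed_carrier[of "snd p" ?c] Ed_carrier[of ?y ?c]
  have "el (Ed a b) \<otimes>\<^bsub>GG\<^esub> wd i (p # u) = (el (Ed a b) \<otimes>\<^bsub>GG\<^esub> el (Ed ?c (snd p))) \<otimes>\<^bsub>GG\<^esub> wd i u"
    unfolding wd_Cons using c u y Cons.prems(1) by (simp add: T.m_assoc)
  also have "\<dots> = (el (Ed ?c ?y) \<otimes>\<^bsub>GG\<^esub> el (Ed a ?b)) \<otimes>\<^bsub>GG\<^esub> wd i u"
    using el_Ed_Ed[of a ?c m] assms(1) m by simp
  also have "\<dots> = (el (Ed ?c ?y) \<otimes>\<^bsub>GG\<^esub> wd i u') \<otimes>\<^bsub>GG\<^esub> el (Ed a b')"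
    using c u y u'(2,3) by (simp add: T.m_assoc)
  also have "el (Ed ?c ?y) \<otimes>\<^bsub>GG\<^esub> wd i u' = wd i (lcons (fst p, ?y) u')"
    using wd_lcons[OF u'(1), of "(fst p, ?y)"] y by simp
  finally show ?case
    using u' lcons_in[OF u'(1), of "(fst p, ?y)"] y by (metis snd_conv)
qed

text \<open>Shifts and edges in other directions can be moved past a reduced word in direction \<open>i\<close>, which
  sorts every product of generators by direction. Projecting to one tree after the other then
  shows that a sorted product that fixes the root is a shift.\<close>

primrec norm_forms :: "'c set \<Rightarrow> nat \<Rightarrow> (nat \<Rightarrow> nat list \<Rightarrow> nat list) set" where
  "norm_forms F 0 = (\<lambda>f. el (Sh f)) ` F"
| "norm_forms F (Suc m) = {wd (Suc m) u \<otimes>\<^bsub>GG\<^esub> p |u p. u \<in> red_words (Q (Suc m)) \<and> p \<in> norm_forms F m}"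

lemma norm_forms_carrier: "p \<in> norm_forms F m \<Longrightarrow> p \<in> carrier GG"
  by (induction m arbitrary: p) (auto intro: Sh_carrier wd_carrier)

lemma one_norm_forms: "shift_closed F \<Longrightarrow> \<one>\<^bsub>GG\<^esub> \<in> norm_forms F m"
proof (induction m)
  case 0
  then show ?case
    by (auto simp: shift_closed_def image_iff simp flip: el_Sh_0)
next
  case (Suc m)
  then have "wd (Suc m) [] \<otimes>\<^bsub>GG\<^esub> \<one>\<^bsub>GG\<^esub> \<in> norm_forms F (Suc m)"
    using Nil_red_words unfolding norm_forms.simps by blast
  then show ?case by simp
qed

lemma Sh_norm_forms:
  assumes "shift_closed F" "f \<in> F" "p \<in> norm_forms F m"
  shows "el (Sh f) \<otimes>\<^bsub>GG\<^esub> p \<in> norm_forms F m"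
  using assms(2,3)
proof (induction m arbitrary: f p)
  case 0
  then show ?case
    using assms(1) by (auto simp: el_Sh_add shift_closed_def)
next
  case (Suc m)
  then obtain u p' where p: "p = wd (Suc m) u \<otimes>\<^bsub>GG\<^esub> p'" "u \<in> red_words (Q (Suc m))" "p' \<in> norm_forms F m"
    by auto
  obtain u' f' where u': "u' \<in> red_words (Q (Suc m))" "f' \<in> F"
    "el (Sh f) \<otimes>\<^bsub>GG\<^esub> wd (Suc m) u = wd (Suc m) u' \<otimes>\<^bsub>GG\<^esub> el (Sh f')"
    using Sh_wd[OF assms(1) Suc.prems(1) p(2)] by blast
  note c = Sh_carrier wd_carrier[OF p(2)] wd_carrier[OF u'(1)] norm_forms_carrier[OF p(3)]
  have "el (Sh f) \<otimes>\<^bsub>GG\<^esub> p = (el (Sh f) \<otimes>\<^bsub>GG\<^esub> wd (Suc m) u) \<otimes>\<^bsub>GG\<^esub> p'"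
    unfolding p(1) using c by (simp add: T.m_assoc)
  also have "\<dots> = wd (Suc m) u' \<otimes>\<^bsub>GG\<^esub> (el (Sh f') \<otimes>\<^bsub>GG\<^esub> p')"
    unfolding u'(3) using c by (simp add: T.m_assoc)
  finally show ?case
    using u'(1) Suc.IH[OF u'(2) p(3)] by auto
qed

lemma Ed_norm_forms:
  assumes "shift_closed F" "fst a \<in> {1..m}" "b < Q (fst a)" "p \<in> norm_forms F m"
  shows "el (Ed a b) \<otimes>\<^bsub>GG\<^esub> p \<in> norm_forms F m"
  using assms(2-4)
proof (induction m arbitrary: b p)
  case (Suc m)
  then obtain u p' where p: "p = wd (Suc m) u \<otimes>\<^bsub>GG\<^esub> p'" "u \<in> red_words (Q (Suc m))" "p' \<in> norm_forms F m"
    by auto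
  note c = Ed_carrier[OF Suc.prems(2)] wd_carrier[OF p(2)] norm_forms_carrier[OF p(3)]
  have eq: "el (Ed a b) \<otimes>\<^bsub>GG\<^esub> p = (el (Ed a b) \<otimes>\<^bsub>GG\<^esub> wd (Suc m) u) \<otimes>\<^bsub>GG\<^esub> p'"
    unfolding p(1) using c by (simp add: T.m_assoc)
  show ?case
  proof (cases "fst a = Suc m")
    case True
    then have "el (Ed a b) \<otimes>\<^bsub>GG\<^esub> wd (Suc m) u = wd (Suc m) (lcons (snd a, b) u)"
      using wd_lcons[OF p(2), of "(snd a, b)"] Suc.prems(2) by (metis fst_conv prod.collapse snd_conv)
    moreover have "lcons (snd a, b) u \<in> red_words (Q (Suc m))"
      using lcons_in[OF p(2), of "(snd a, b)"] Suc.prems(2) True by simp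
    ultimately show ?thesis
      unfolding eq norm_forms.simps using p(3) by auto
  next
    case False
    obtain u' b' where u': "u' \<in> red_words (Q (Suc m))" "b' < Q (fst a)"
      "el (Ed a b) \<otimes>\<^bsub>GG\<^esub> wd (Suc m) u = wd (Suc m) u' \<otimes>\<^bsub>GG\<^esub> el (Ed a b')"
      using Ed_wd[OF False Suc.prems(2) p(2)] by blast
    have "el (Ed a b) \<otimes>\<^bsub>GG\<^esub> p = wd (Suc m) u' \<otimes>\<^bsub>GG\<^esub> (el (Ed a b') \<otimes>\<^bsub>GG\<^esub> p')"
      unfolding eq u'(3) using c wd_carrier[OF u'(1)] Ed_carrier[OF u'(2)] by (simp add: T.m_assoc)
    moreover have "el (Ed a b') \<otimes>\<^bsub>GG\<^esub> p' \<in> norm_forms F m"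
      using Suc.IH[OF _ u'(2) p(3)] Suc.prems(1) False by simp
    ultimately show ?thesis
      using u'(1) by auto
  qed
qed simp

lemma Sh_root: "i \<in> I \<Longrightarrow> el (Sh f) i [] = []"
  by (simp add: el_root)

lemma norm_forms_root:
  assumes "p \<in> norm_forms F m" "m < j" "j \<le> n"
  shows "p j [] = []"
  using assms
proof (induction m arbitrary: p)
  case 0
  then have "j \<in> I"
    by (simp add: I_eq)
  then show ?case
    using 0 by (auto simp: Sh_root)
next
  case (Suc m)
  then obtain u p' where p: "p = wd (Suc m) u \<otimes>\<^bsub>GG\<^esub> p'" "u \<in> red_words (Q (Suc m))" "p' \<in> norm_forms F m"
    by auto
  have j: "j \<in> I" "Suc m \<in> I" "j \<noteq> Suc m"
    using Suc.prems by (auto simp: I_eq)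
  show ?case
    unfolding p(1) T.mult_apply[OF wd_carrier[OF p(2)] norm_forms_carrier[OF p(3)] j(1) Nil_tree_verts]
    using Suc.IH[OF p(3)] Suc.prems wd_root[OF j(2,1) p(2)] j by simp
qed

lemma norm_forms_stab:
  assumes "p \<in> norm_forms F m" "m \<le> n" "\<forall>i\<in>{1..m}. p i [] = []"
  shows "p \<in> (\<lambda>f. el (Sh f)) ` F"
  using assms
proof (induction m arbitrary: p)
  case (Suc m)
  then obtain u p' where p: "p = wd (Suc m) u \<otimes>\<^bsub>GG\<^esub> p'" "u \<in> red_words (Q (Suc m))" "p' \<in> norm_forms F m"
    by auto
  have m: "Suc m \<in> I"
    using Suc.prems by (simp add: I_eq)
  have "encode (Q (Suc m)) u = p (Suc m) []"
    unfolding p(1) T.mult_apply[OF wd_carrier[OF p(2)] norm_forms_carrier[OF p(3)] m Nil_tree_verts]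
    using norm_forms_root[OF p(3), of "Suc m"] wd_root[OF m m p(2)] Suc.prems by simp
  then have "encode (Q (Suc m)) u = []"
    using Suc.prems(3) by simp
  then have "u = []"
    using decode_encode[OF p(2)] by simp
  then have "p = p'"
    using p(1) norm_forms_carrier[OF p(3)] by simp
  then show ?case
    using Suc.IH[OF p(3)] Suc.prems by simp
qed simp

definition gens :: "'c set \<Rightarrow> 'c gen set" where
  "gens F = Sh ` F \<union> {Ed a b |a b. fst a \<in> I \<and> b < Q (fst a)}"

definition lattice :: "'c set \<Rightarrow> (nat \<Rightarrow> nat list \<Rightarrow> nat list) set" where
  "lattice F = generate GG (el ` gens F)"

lemma gens_valid: "g \<in> gens F \<Longrightarrow> gvalid g"
  by (auto simp: gens_def)

lemma subgroup_lattice: "subgroup (lattice F) GG"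
  unfolding lattice_def by (rule T.generate_is_subgroup) (auto intro: el_carrier gens_valid)

lemma lattice_mono: "F \<subseteq> F' \<Longrightarrow> lattice F \<subseteq> lattice F'"
  unfolding lattice_def by (rule T.mono_generate) (auto simp: gens_def)

lemma gens_lattice: "g \<in> gens F \<Longrightarrow> el g \<in> lattice F"
  unfolding lattice_def by (rule generate.incl) simp

text \<open>Normal forms contain the identity and are stable under left multiplication by
  generators. Inverses of generators are again generators, because \<open>F\<close> is closed under
  negation.\<close>

lemma lattice_norm_forms:
  assumes "shift_closed F"
  shows "lattice F \<subseteq> norm_forms F n"
proof -
  have gen: "el g \<otimes>\<^bsub>GG\<^esub> p \<in> norm_forms F n" if "g \<in> gens F" "p \<in> norm_forms F n" for g p
    using that Sh_norm_forms[OF assms] Ed_norm_forms[OF assms, of _ n, folded I_eq]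
    by (auto simp: gens_def)
  have inv: "ginv g \<in> gens F" if "g \<in> gens F" for g
    using that assms by (auto simp: gens_def shift_closed_def)
  have mult: "x \<otimes>\<^bsub>GG\<^esub> p \<in> norm_forms F n"
    if "x \<in> generate GG (el ` gens F)" "p \<in> norm_forms F n" for x p
    using that
  proof (induction x arbitrary: p)
    case one
    then show ?case using norm_forms_carrier by simp
  next
    case (incl h)
    then show ?case using gen by auto
  next
    case (inv h)
    then obtain g where "g \<in> gens F" "h = el g" by auto
    then show ?case
      using gen[OF \<open>\<And>g. g \<in> gens F \<Longrightarrow> ginv g \<in> gens F\<close> inv.prems] inv_el[OF gens_valid] by simp
  next
    case (eng h1 h2)
    have c: "h1 \<in> carrier GG" "h2 \<in> carrier GG"
      using eng.hyps T.generate_in_carrier[of "el ` gens F"] el_carrier gens_valid by auto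
    show ?case
      using eng.IH(1)[OF eng.IH(2)[OF eng.prems]] c norm_forms_carrier[OF eng.prems]
      by (simp add: T.m_assoc)
  qed
  show ?thesis
  proof
    fix x assume x: "x \<in> lattice F"
    then have "x \<in> carrier GG"
      using subgroup.mem_carrier[OF subgroup_lattice] by blast
    then show "x \<in> norm_forms F n"
      using mult[OF x[unfolded lattice_def] one_norm_forms[OF assms]] by simp
  qed
qed

lemma lattice_stab:
  assumes "shift_closed F"
  shows "lattice F \<inter> ball_stab I (\<lambda>i. 2 * Q i) 0 = (\<lambda>f. el (Sh f)) ` F"
proof
  show "lattice F \<inter> ball_stab I (\<lambda>i. 2 * Q i) 0 \<subseteq> (\<lambda>f. el (Sh f)) ` F"
  proof
    fix x assume x: "x \<in> lattice F \<inter> ball_stab I (\<lambda>i. 2 * Q i) 0"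
    then have "x \<in> norm_forms F n"
      using lattice_norm_forms[OF assms] by blast
    moreover have "\<forall>i\<in>I. x i [] = []"
      using x Nil_tree_verts unfolding ball_stab_def by simp
    ultimately show "x \<in> (\<lambda>f. el (Sh f)) ` F"
      using norm_forms_stab[of x F n] by (simp add: I_eq)
  qed
  have "el (Sh f) \<in> ball_stab I (\<lambda>i. 2 * Q i) 0" for f
    using Sh_carrier by (auto simp: ball_stab_def Sh_root)
  then show "(\<lambda>f. el (Sh f)) ` F \<subseteq> lattice F \<inter> ball_stab I (\<lambda>i. 2 * Q i) 0"
    by (auto intro!: gens_lattice simp: gens_def)
qed

lemma lattice_transitive_aux:
  "(\<forall>i\<in>I. w i \<in> tree_verts (2 * Q i)) \<Longrightarrow> (\<Sum>i\<in>I. length (w i)) = N \<Longrightarrow>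
    \<exists>\<gamma>\<in>lattice F. \<forall>i\<in>I. \<gamma> i [] = w i"
proof (induction N arbitrary: w)
  case 0
  then have "\<forall>i\<in>I. w i = []"
    using T.finite_I by simp
  then show ?case
    using subgroup.one_closed[OF subgroup_lattice] Nil_tree_verts
    by (intro bexI[of _ "\<one>\<^bsub>GG\<^esub>"]) (auto simp: T.one_apply)
next
  case (Suc N)
  have "\<exists>i\<in>I. w i \<noteq> []"
  proof (rule ccontr)
    assume "\<not> ?thesis"
    then have "(\<Sum>i\<in>I. length (w i)) = 0" by simp
    then show False using Suc.prems by simp
  qed
  then obtain i where i: "i \<in> I" "w i \<noteq> []" by blast
  then obtain x v where xv: "w i = x # v"
    by (meson neq_Nil_conv)
  have wi: "w i \<in> tree_verts (2 * Q i)"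
    using Suc.prems i by blast
  then have v: "v \<in> tree_verts (2 * Q i)"
    using xv tree_verts_ConsD by simp
  have "(\<Sum>j\<in>I. length ((w(i := v)) j)) = N"
    using Suc.prems(2) xv by (intro sum_length_upd[OF T.finite_I i(1)]) auto
  moreover have "\<forall>j\<in>I. (w(i := v)) j \<in> tree_verts (2 * Q j)"
    using Suc.prems(1) v by simp
  ultimately obtain \<gamma> where \<gamma>: "\<gamma> \<in> lattice F" "\<forall>j\<in>I. \<gamma> j [] = (w(i := v)) j"
    using Suc.IH[of "w(i := v)"] by blast
  have \<gamma>c: "\<gamma> \<in> carrier GG"
    using \<gamma>(1) subgroup.mem_carrier[OF subgroup_lattice] by blast
  \<comment> \<open>Pulled back by \<open>\<gamma>\<close>, the target vertex becomes a neighbour of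
    the root, that is a single letter. The edge generator with this letter is then multiplied on the
    right.\<close>
  define z where "z = (inv\<^bsub>GG\<^esub> \<gamma>) i (w i)"
  have \<gamma>z: "\<gamma> i z = w i"
    unfolding z_def by (rule T.inv_apply(2)[OF \<gamma>c i(1) wi])
  have zV: "z \<in> tree_verts (2 * Q i)"
    unfolding z_def by (rule T.apply_in[OF T.inv_closed[OF \<gamma>c] i(1) wi])
  have "(\<gamma> i [], \<gamma> i z) \<in> tree_edges (2 * Q i)"
    using \<gamma>(2) i(1) \<gamma>z xv v wi by (auto simp: tree_edges_def)
  then have "([], z) \<in> tree_edges (2 * Q i)"
    using graph_auts_D(4)[OF T.carrierD[OF \<gamma>c i(1)] Nil_tree_verts zV] by simp
  then have "nbr [] (decode (Q i) z)"
    using decode_nbr[of "[]" z "Q i"] by simp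
  then obtain p where p: "decode (Q i) z = [p]"
    by (auto simp: nbr_def)
  then have zp: "z = encode (Q i) [p]" and pr: "[p] \<in> red_words (Q i)"
    using encode_decode[OF zV] decode_in[OF zV] by simp_all
  let ?e = "Ed (i, fst p) (snd p)"
  have e: "gvalid ?e" "?e \<in> gens F"
    using pr i by (auto simp: gens_def red_words_Cons)
  have "(\<gamma> \<otimes>\<^bsub>GG\<^esub> el ?e) j [] = w j" if j: "j \<in> I" for j
  proof -
    have "(\<gamma> \<otimes>\<^bsub>GG\<^esub> el ?e) j [] = \<gamma> j (el ?e j [])"
      by (rule T.mult_apply[OF \<gamma>c el_carrier[OF e(1)] j Nil_tree_verts])
    also have "el ?e j [] = (if j = i then z else [])"
      using zp j by (auto simp: el_root)
    also have "\<gamma> j \<dots> = w j"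
      using \<gamma>z \<gamma>(2) j by auto
    finally show ?thesis .
  qed
  moreover have "\<gamma> \<otimes>\<^bsub>GG\<^esub> el ?e \<in> lattice F"
    using subgroup.m_closed[OF subgroup_lattice \<gamma>(1) gens_lattice[OF e(2)]] .
  ultimately show ?case by blast
qed

lemma lattice_transitive: "vertex_transitive I (\<lambda>i. 2 * Q i) (lattice F)"
  unfolding T.vertex_transitive_iff[OF subgroup_lattice]
  using lattice_transitive_aux[OF _ refl] by (auto simp: PiE_iff)

lemma cocompact_lattice_lattice:
  assumes "shift_closed F" "finite ((\<lambda>f. el (Sh f)) ` F)"
  shows "cocompact_lattice_in GG (tree_prod_topology I (\<lambda>i. 2 * Q i)) (lattice F)"
proof (rule T.cocompact_lattice_criterion[OF subgroup_lattice subgroup_lattice])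
  \<comment> \<open>Without nonzero shifts the root stabilizer is trivial, so
    \<open>lattice {0}\<close> is the simply transitive complement that the criterion asks
    for.\<close>
  have "shift_closed {0}"
    by (simp add: shift_closed_def)
  then show "ball_stab I (\<lambda>i. 2 * Q i) 0 \<inter> lattice {0} = {\<one>\<^bsub>GG\<^esub>}"
    using lattice_stab[of "{0}"] by (simp add: el_Sh_0 Int_commute)
  show "lattice {0} \<subseteq> lattice F"
    using assms(1) by (intro lattice_mono) (simp add: shift_closed_def)
  show "vertex_transitive I (\<lambda>i. 2 * Q i) (lattice {0})"
    by (rule lattice_transitive)
  show "finite (lattice F \<inter> ball_stab I (\<lambda>i. 2 * Q i) 0)"
    unfolding lattice_stab[OF assms(1)] by (rule assms(2))
qed

section \<open>Rays: recovering configurations from the action on words\<close>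

primrec ray :: "nat \<Rightarrow> 'c \<Rightarrow> nat \<Rightarrow> (bool \<times> nat) list" where
  "ray l m 0 = []"
| "ray l m (Suc r) = (True, lab (l, True) m) # ray l (X (l, True) m) r"

lemma ray_red: "ray l m r \<in> red_words (Q l)"
proof (induction r arbitrary: m)
  case (Suc r)
  have "lab (l, True) m < Q l"
    using lab_less[of "(l, True)" m] by simp
  moreover have "hd (ray l (X (l, True) m) r) \<noteq> (False, lab (l, True) m)"
    if "ray l (X (l, True) m) r \<noteq> []"
    using that by (cases r) auto
  ultimately show ?case
    using Suc.IH by (simp add: red_words_Cons)
qed simp

text \<open>The automaton carries the history of a configuration at the far end to that of the
  corresponding one at the near end. Statements about the action become statements about labels of
  iterates of \<open>X\<close>.\<close>

lemma act_ray:
  assumes "valid l g" "conf g \<mu> m"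
  shows "act l g (ray l \<mu> r) = ray l m r"
  using assms
proof (induction r arbitrary: g \<mu> m)
  case (Suc r)
  let ?c = "(l, True)"
  have "valid l (nxt ?c g (lab ?c \<mu>))"
    using valid_nxt[of ?c g "lab ?c \<mu>"] Suc.prems lab_less[of ?c] by simp
  then show ?case
    using Suc.IH[OF _ nxt_conf[of ?c g \<mu> m]] out_conf[of ?c g \<mu> m] Suc.prems by simp
qed simp

lemma ray_eqD:
  "ray l m r = ray l m' r \<Longrightarrow> k < r \<Longrightarrow>
    lab (l, True) ((X (l, True) ^^ k) m) = lab (l, True) ((X (l, True) ^^ k) m')"
proof (induction r arbitrary: m m' k)
  case (Suc r)
  show ?case
  proof (cases k)
    case (Suc k')
    then show ?thesis
      using Suc.IH[of "X (l, True) m" "X (l, True) m'" k'] Suc.prems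
      by (simp add: funpow_swap1 del: funpow.simps) (simp add: funpow_swap1)
  qed (use Suc.prems in simp)
qed simp

lemma el_eqD:
  assumes "el g = el h" "gvalid g" "gvalid h" "i \<in> I" "w \<in> red_words (Q i)"
  shows "gact i g w = gact i h w"
proof -
  have "encode (Q i) (gact i g w) = encode (Q i) (gact i h w)"
    using el_apply[OF assms(4,5), of g] el_apply[OF assms(4,5), of h] assms(1) by simp
  then show ?thesis
    using decode_encode gact_in assms by metis
qed

lemma el_Sh_eqD:
  assumes "el (Sh f) = el (Sh g)" "i \<in> I"
  shows "lab (i, True) ((X (i, True) ^^ k) f) = lab (i, True) ((X (i, True) ^^ k) g)"
proof -
  \<comment> \<open>Applied to the ray of 0, a shift reveals its own label sequence. Length
    \<open>Suc k\<close> includes the label with index \<open>k\<close>.\<close>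
  have "act i (Sh h) (ray i 0 (Suc k)) = ray i h (Suc k)" for h
    by (rule act_ray) simp_all
  then have "ray i f (Suc k) = ray i g (Suc k)"
    using el_eqD[OF assms(1) _ _ assms(2) ray_red[of i 0 "Suc k"]] by (simp add: gact_def del: ray.simps)
  then show ?thesis
    by (rule ray_eqD) simp
qed

text \<open>A difference in \<open>Z\<close> has zero label and keeps zero label under all moves, so
  the automaton never sees it. In the application \<open>Z\<close> consists of the multiples of
  \<open>q\<close>.\<close>

lemma el_Sh_cong:
  assumes "\<And>f a. f \<in> Z \<Longrightarrow> lab a f = lab a 0 \<and> X a f \<in> Z" "f - g \<in> Z"
  shows "el (Sh f) = el (Sh g)"
proof (rule el_eqI)
  fix i w assume i: "i \<in> I" and w: "w \<in> red_words (Q i)"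
  have "act i (Sh f) w = act i (Sh g) w"
    using assms(2) w
  proof (induction w arbitrary: f g)
    case (Cons p w)
    let ?c = "(i, fst p)"
    obtain m where m: "lab ?c m = snd p"
      using lab_surj[of "snd p" ?c] Cons.prems by (auto simp: red_words_Cons)
    have "lab ?c (m + f) = lab ?c (m + g)"
      using lab_eq[of ?c "m + f" "m + g"] assms(1)[OF Cons.prems(1)] by simp
    then have "out ?c (Sh f) (snd p) = out ?c (Sh g) (snd p)"
      unfolding m[symmetric] out_Sh .
    moreover have "X ?c f - X ?c g \<in> Z"
      using assms(1)[OF Cons.prems(1)] by (simp add: X_diff[symmetric])
    ultimately show ?case
      using Cons.IH Cons.prems by (simp add: red_words_Cons)
  qed simp
  then show "el (Sh f) i (encode (Q i) w) = el (Sh g) i (encode (Q i) w)"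
    using i w by (simp add: el_apply gact_def)
qed (rule Sh_carrier)+

text \<open>The generator \<open>tr\<close> in direction \<open>j\<close> fixes the root of every other tree; it is of infinite
  order there, and its powers become trivial on larger and larger balls.\<close>

lemma gact_pow_ray:
  assumes "i \<noteq> j" "\<forall>k<N. lab (j, True) ((X (j, True) ^^ k) m) = lab (j, True) 0"
  shows "(gact i (Ed (j, True) (lab (j, True) 0)) ^^ N) (ray i ((X (j, True) ^^ N) m) r) = ray i m r"
  using assms(2)
proof (induction N)
  case (Suc N)
  let ?a = "(j, True)"
  let ?m = "(X ?a ^^ N) m"
  have "gact i (Ed ?a (lab ?a 0)) (ray i (X ?a ?m) r) = ray i ?m r"
    using act_ray[of i "Ed ?a (lab ?a 0)" "X ?a ?m" ?m r] Suc.prems assms(1) lab_less[of ?a]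
    by (simp add: gact_def)
  then show ?case
    using Suc.IH Suc.prems by (simp add: funpow_swap1 del: funpow.simps) (simp add: funpow_swap1)
qed simp

context
  fixes j :: nat
  assumes j: "j \<in> I"
begin

definition tr :: "nat \<Rightarrow> nat list \<Rightarrow> nat list" where
  "tr = el (Ed (j, True) (lab (j, True) 0))"

lemma tr_carrier: "tr \<in> carrier GG"
  unfolding tr_def using lab_less[of "(j, True)"] by (intro Ed_carrier) simp

lemma tr_lattice: "tr [^]\<^bsub>GG\<^esub> (N :: nat) \<in> lattice F"
proof (induction N)
  case 0
  show ?case
    using subgroup.one_closed[OF subgroup_lattice] by simp
next
  case (Suc N)
  have "tr \<in> lattice F"
    unfolding tr_def using j lab_less[of "(j, True)"] by (intro gens_lattice) (auto simp: gens_def)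
  then show ?case
    using subgroup.m_closed[OF subgroup_lattice Suc.IH] by simp
qed

lemma tr_pow_encode:
  assumes "i \<in> I" "w \<in> red_words (Q i)"
  shows "(tr [^]\<^bsub>GG\<^esub> (N :: nat)) i (encode (Q i) w) =
    encode (Q i) ((gact i (Ed (j, True) (lab (j, True) 0)) ^^ N) w)"
  using assms(2)
proof (induction N arbitrary: w)
  case 0
  then show ?case
    using assms(1) by (simp add: T.one_apply encode_in)
next
  case (Suc N)
  let ?g = "Ed (j, True) (lab (j, True) 0)"
  have v: "gvalid ?g"
    using lab_less[of "(j, True)"] by simp
  have "(tr [^]\<^bsub>GG\<^esub> Suc N) i (encode (Q i) w) = (tr [^]\<^bsub>GG\<^esub> N) i (tr i (encode (Q i) w))"
    using T.mult_apply[OF T.nat_pow_closed[OF tr_carrier] tr_carrier assms(1) encode_in[OF Suc.prems]]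
    by simp
  also have "\<dots> = encode (Q i) ((gact i ?g ^^ N) (gact i ?g w))"
    using el_apply[OF assms(1) Suc.prems, of ?g] Suc.IH[OF gact_in[OF v Suc.prems]] by (simp add: tr_def)
  finally show ?case
    by (simp add: funpow_swap1)
qed

lemma tr_pow_root:
  assumes "i \<in> I" "i \<noteq> j"
  shows "(tr [^]\<^bsub>GG\<^esub> (N :: nat)) i [] = []"
proof -
  have "(gact i (Ed (j, True) (lab (j, True) 0)) ^^ N) [] = []"
    using assms(2) by (induction N) auto
  then show ?thesis
    using tr_pow_encode[OF assms(1) Nil_red_words, of N] by simp
qed

text \<open>Pigeonhole: the powers of \<open>tr\<close> fix the roots of the trees in
  \<open>I'\<close> and hence permute finite balls there. Two of them agree on these balls, and the
  power by the difference of the exponents acts trivially.\<close>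

lemma ex_tr_pow_ball_stab:
  assumes "I' \<subseteq> I - {j}"
  shows "\<exists>N\<ge>1. \<forall>i\<in>I'. \<forall>v\<in>tree_verts (2 * Q i). length v \<le> r \<longrightarrow> (tr [^]\<^bsub>GG\<^esub> (N :: nat)) i v = v"
proof -
  define B where "B i = {v \<in> tree_verts (2 * Q i). length v \<le> r}" for i
  define f where "f N = (\<lambda>i\<in>I'. \<lambda>v\<in>B i. (tr [^]\<^bsub>GG\<^esub> (N :: nat)) i v)" for N
  have fin: "finite I'"
    using assms T.finite_I finite_subset by blast
  have pc: "tr [^]\<^bsub>GG\<^esub> (N :: nat) \<in> carrier GG" for N
    using tr_carrier by simp
  have "f N \<in> (\<Pi>\<^sub>E i\<in>I'. \<Pi>\<^sub>E v\<in>B i. B i)" for N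
  proof -
    have "(tr [^]\<^bsub>GG\<^esub> N) i v \<in> B i" if "i \<in> I'" "v \<in> B i" for i v
    proof -
      have i: "i \<in> I" "i \<noteq> j" and v: "v \<in> tree_verts (2 * Q i)" "length v \<le> r"
        using that assms by (auto simp: B_def)
      show ?thesis
        using T.apply_in[OF pc[of N] i(1) v(1)] T.length_apply_le[OF pc[of N] i(1) v(1)]
          tr_pow_root[OF i] v(2) by (simp add: B_def)
    qed
    then show ?thesis
      by (auto simp: f_def)
  qed
  then have "range f \<subseteq> (\<Pi>\<^sub>E i\<in>I'. \<Pi>\<^sub>E v\<in>B i. B i)" by blast
  moreover have "finite (\<Pi>\<^sub>E i\<in>I'. \<Pi>\<^sub>E v\<in>B i. B i)"
    unfolding B_def using fin finite_tree_ball by (intro finite_PiE) auto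
  ultimately have "finite (range f)"
    by (rule finite_subset)
  then have "\<not> inj f"
    using finite_imageD infinite_UNIV_nat by blast
  then obtain a b where ab: "f a = f b" "a < b"
    unfolding inj_on_def by (metis UNIV_I linorder_neqE_nat)
  have "(tr [^]\<^bsub>GG\<^esub> (b - a)) i v = v" if i: "i \<in> I'" and v: "v \<in> tree_verts (2 * Q i)" "length v \<le> r" for i v
  proof -
    have iI: "i \<in> I"
      using i assms by blast
    have vB: "v \<in> B i"
      using v by (simp add: B_def)
    have "tr [^]\<^bsub>GG\<^esub> b = tr [^]\<^bsub>GG\<^esub> a \<otimes>\<^bsub>GG\<^esub> tr [^]\<^bsub>GG\<^esub> (b - a)"
      using T.nat_pow_mult[OF tr_carrier, of a "b - a"] ab(2) by simp
    then have "(tr [^]\<^bsub>GG\<^esub> b) i v = (tr [^]\<^bsub>GG\<^esub> a) i ((tr [^]\<^bsub>GG\<^esub> (b - a)) i v)"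
      using T.mult_apply[OF pc pc iI v(1)] by simp
    moreover have "(tr [^]\<^bsub>GG\<^esub> b) i v = (tr [^]\<^bsub>GG\<^esub> a) i v"
      using fun_cong[OF fun_cong[OF ab(1)], of i v] i vB by (simp add: f_def)
    moreover have "inj_on ((tr [^]\<^bsub>GG\<^esub> a) i) (tree_verts (2 * Q i))"
      using graph_auts_D(2)[OF T.carrierD[OF pc iI]] by (rule bij_betw_imp_inj_on)
    ultimately show ?thesis
      using T.apply_in[OF pc iI v(1)] v(1) by (metis inj_onD)
  qed
  then show ?thesis
    using ab(2) by (intro exI[of _ "b - a"]) auto
qed

end

text \<open>A direction \<open>j\<close> outside \<open>I'\<close> supplies the small elements:
  powers of its edge with label \<open>lab (j, True) 0\<close> lie in every ball stabilizer. By
  \<open>free\<close>, no positive power is trivial on a tree \<open>i\<close> in \<open>I'\<close>,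
  since it carries one ray to a different one.\<close>

lemma restrict_lattice_not_discrete:
  assumes "I' \<noteq> {}" "I' \<subset> I"
    and free: "\<And>i j N. i \<noteq> j \<Longrightarrow> N \<ge> 1 \<Longrightarrow> \<exists>m k.
      (\<forall>k<N. lab (j, True) ((X (j, True) ^^ k) m) = lab (j, True) 0) \<and>
      lab (i, True) ((X (i, True) ^^ k) ((X (j, True) ^^ N) m)) \<noteq> lab (i, True) ((X (i, True) ^^ k) m)"
  shows "\<not> discrete_subset (tree_prod_topology I' (\<lambda>i. 2 * Q i)) ((\<lambda>\<gamma>. restrict \<gamma> I') ` lattice F)"
proof -
  interpret T': tree_product I' "\<lambda>i. 2 * Q i"
    by standard (use assms(2) T.finite_I finite_subset in blast)
  let ?G' = "tree_prod_group I' (\<lambda>i. 2 * Q i)"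
  obtain j where j: "j \<in> I" "j \<notin> I'"
    using assms(2) by blast
  have sub: "I' \<subseteq> I - {j}"
    using assms(2) j by blast
  obtain i where i: "i \<in> I'" "i \<in> I" "i \<noteq> j"
    using assms(1) sub by blast
  have rc: "restrict \<gamma> I' \<in> carrier ?G'" if "\<gamma> \<in> carrier GG" for \<gamma>
    unfolding T'.carrier_iff
  proof (rule restrict_PiE_iff[THEN iffD2], rule ballI)
    fix i assume "i \<in> I'"
    then show "\<gamma> i \<in> graph_auts (tree_verts (2 * Q i)) (tree_edges (2 * Q i))"
      using T.carrierD[OF that] sub by blast
  qed
  show ?thesis
  proof (rule T'.not_discrete_subset)
    have "restrict \<one>\<^bsub>GG\<^esub> I' = \<one>\<^bsub>?G'\<^esub>"
      by (rule T'.eqI) (use rc sub in \<open>auto simp: T.one_apply T'.one_apply subset_iff\<close>)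
    then show "\<one>\<^bsub>?G'\<^esub> \<in> (\<lambda>\<gamma>. restrict \<gamma> I') ` lattice F"
      using subgroup.one_closed[OF subgroup_lattice] by (metis image_eqI)
    fix r
    obtain N :: nat where N: "N \<ge> 1"
      "\<forall>i\<in>I'. \<forall>v\<in>tree_verts (2 * Q i). length v \<le> r \<longrightarrow> (tr j [^]\<^bsub>GG\<^esub> N) i v = v"
      using ex_tr_pow_ball_stab[OF j(1) sub] by blast
    let ?s = "restrict (tr j [^]\<^bsub>GG\<^esub> N) I'"
    have "tr j [^]\<^bsub>GG\<^esub> N \<in> carrier GG"
      using tr_carrier[OF j(1)] by simp
    then have "?s \<in> ball_stab I' (\<lambda>i. 2 * Q i) r"
      using rc N(2) by (simp add: ball_stab_def)
    moreover have "?s \<noteq> \<one>\<^bsub>?G'\<^esub>"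
    proof
      assume eq: "?s = \<one>\<^bsub>?G'\<^esub>"
      obtain m k where m: "\<forall>k<N. lab (j, True) ((X (j, True) ^^ k) m) = lab (j, True) 0"
        "lab (i, True) ((X (i, True) ^^ k) ((X (j, True) ^^ N) m)) \<noteq> lab (i, True) ((X (i, True) ^^ k) m)"
        using free[OF i(3) N(1)] by blast
      let ?w = "ray i ((X (j, True) ^^ N) m) (Suc k)"
      have "encode (Q i) (ray i m (Suc k)) = (tr j [^]\<^bsub>GG\<^esub> N) i (encode (Q i) ?w)"
        using tr_pow_encode[OF j(1) i(2) ray_red] gact_pow_ray[OF i(3) m(1)] by (simp del: ray.simps)
      also have "\<dots> = ?s i (encode (Q i) ?w)"
        using i(1) by simp
      also have "\<dots> = encode (Q i) ?w"
        unfolding eq by (rule T'.one_apply[OF i(1) encode_in[OF ray_red]])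
      finally have "ray i m (Suc k) = ?w"
        by (metis decode_encode ray_red)
      then show False
        using ray_eqD[of i m "Suc k" _ k] m(2) by (simp del: ray.simps)
    qed
    ultimately show "\<exists>s\<in>(\<lambda>\<gamma>. restrict \<gamma> I') ` lattice F \<inter> ball_stab I' (\<lambda>i. 2 * Q i) r. s \<noteq> \<one>\<^bsub>?G'\<^esub>"
      using tr_lattice[OF j(1), of N F] by blast
  qed
qed

text \<open>The shift by \<open>g\<close> fixes the root. If it were in \<open>lattice F\<close> it
  would equal the shift by some \<open>f\<close> in \<open>F\<close>, and the labels along a ray
  tell the two apart.\<close>

lemma lattice_strict_mono:
  assumes "shift_closed F" "F \<subseteq> F'" "g \<in> F'" "i \<in> I"
    and "\<And>f. f \<in> F \<Longrightarrow> \<exists>k. lab (i, True) ((X (i, True) ^^ k) g) \<noteq> lab (i, True) ((X (i, True) ^^ k) f)"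
  shows "lattice F \<subset> lattice F'"
proof
  show "lattice F \<subseteq> lattice F'"
    using assms(2) by (rule lattice_mono)
  have "el (Sh g) \<in> ball_stab I (\<lambda>i. 2 * Q i) 0"
    using Sh_carrier by (auto simp: ball_stab_def Sh_root)
  then have "el (Sh g) \<notin> lattice F"
    using lattice_stab[OF assms(1)] assms(4,5) el_Sh_eqD by blast
  moreover have "el (Sh g) \<in> lattice F'"
    using assms(3) by (intro gens_lattice) (simp add: gens_def)
  ultimately show "lattice F \<noteq> lattice F'" by blast
qed

end

section \<open>Configurations given by polynomials\<close>

text \<open>The polynomial part of \<open>d f / e\<close>: for monic \<open>e\<close> of positive
  degree the remaining fraction has a numerator of degree below that of \<open>e\<close> for exactly
  one \<open>h\<close>. With \<open>d = 1\<close> this is ordinary division with remainder.\<close>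

definition quo :: "int poly \<Rightarrow> int poly \<Rightarrow> int poly \<Rightarrow> int poly" where
  "quo d e f = (THE h. degree (d * f - e * h) < degree e)"

lemma monic_small:
  fixes e :: "int poly"
  assumes "lead_coeff e = 1" "degree (e * h) < degree e"
  shows "h = 0"
proof (rule ccontr)
  assume "h \<noteq> 0"
  moreover have "e \<noteq> 0"
    using assms(1) by auto
  ultimately show False
    using assms(2) by (simp add: degree_mult_eq)
qed

lemma ex_monic_quotient:
  fixes e :: "int poly"
  assumes "lead_coeff e = 1" "degree e > 0"
  shows "\<exists>h. degree (f - e * h) < degree e"
proof -
  \<comment> \<open>Pseudo-division by a monic polynomial is genuine division, also over the
    integers.\<close>
  obtain h r where hr: "pseudo_divmod f e = (h, r)"
    by (cases "pseudo_divmod f e")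
  have "e \<noteq> 0"
    using assms by auto
  then have "f = e * h + r" "r = 0 \<or> degree r < degree e"
    using pseudo_divmod[OF _ hr] assms(1) by auto
  then show ?thesis
    using assms(2) by (intro exI[of _ h]) auto
qed

lemma quo_eqI:
  assumes "lead_coeff e = 1" "degree (d * f - e * h) < degree e"
  shows "quo d e f = h"
  unfolding quo_def
proof (rule the_equality)
  fix h' assume "degree (d * f - e * h') < degree e"
  then have "degree ((d * f - e * h) - (d * f - e * h')) < degree e"
    by (rule degree_diff_less[OF assms(2)])
  moreover have "(d * f - e * h) - (d * f - e * h') = e * (h' - h)"
    by (simp add: algebra_simps)
  ultimately have "h' - h = 0"
    using monic_small[OF assms(1)] by metis
  then show "h' = h" by simp
qed (rule assms(2))

lemma degree_quo:
  assumes "lead_coeff e = 1" "degree e > 0"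
  shows "degree (d * f - e * quo d e f) < degree e"
proof -
  obtain h where h: "degree (d * f - e * h) < degree e"
    using ex_monic_quotient[OF assms] by blast
  then show ?thesis
    using quo_eqI[OF assms(1) h] by simp
qed

section \<open>A family of pairwise comaximal monic polynomials\<close>

definition comaximal :: "int poly \<Rightarrow> int poly \<Rightarrow> bool" where
  "comaximal a b \<longleftrightarrow> (\<exists>s t. s * a + t * b = 1)"

lemma comaximalI: "s * a + t * b = 1 \<Longrightarrow> comaximal a b"
  by (auto simp: comaximal_def)

lemma comaximal_commute: "comaximal a b \<Longrightarrow> comaximal b a"
  unfolding comaximal_def by (metis add.commute)

lemma comaximal_mult:
  assumes "comaximal a c" "comaximal b c"
  shows "comaximal (a * b) c"
proof -
  obtain s t s' t' where 1: "s * a + t * c = 1" "s' * b + t' * c = 1"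
    using assms by (auto simp: comaximal_def)
  have "(s * s') * (a * b) + (s * a * t' + t * (s' * b) + t * t' * c) * c =
      (s * a + t * c) * (s' * b + t' * c)"
    by (simp add: algebra_simps)
  then have "(s * s') * (a * b) + (s * a * t' + t * (s' * b) + t * t' * c) * c = 1"
    unfolding 1 by simp
  then show ?thesis
    by (rule comaximalI)
qed

lemma comaximal_power: "comaximal a c \<Longrightarrow> comaximal (a ^ k) c"
proof (induction k)
  case 0
  show ?case by (rule comaximalI[of 1 _ 0]) simp
next
  case (Suc k)
  then show ?case by (simp add: comaximal_mult)
qed

text \<open>A recursion in the manner of Euclid's proof that there are infinitely many primes:
  \<open>base_poly k\<close> is the product of all earlier \<open>dir_poly\<close>, and the next
  pair is 1 modulo that product. The resulting degrees are the powers of 3, starting with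
  \<open>3^0 = 1\<close>.\<close>

primrec base_poly :: "nat \<Rightarrow> int poly" where
  "base_poly 0 = 1"
| "base_poly (Suc k) = base_poly k * (([:0, 1:] * base_poly k + 1) * ([:1, 1:] * base_poly k + 1))"

definition dir_poly :: "bool \<Rightarrow> nat \<Rightarrow> int poly" where
  "dir_poly b k = (if b then [:0, 1:] else [:1, 1:]) * base_poly k + 1"

lemma base_poly_Suc: "base_poly (Suc k) = base_poly k * (dir_poly True k * dir_poly False k)"
  by (simp add: dir_poly_def)

lemma monic_linear_plus_1:
  fixes p :: "int poly"
  assumes "lead_coeff p = 1"
  shows "lead_coeff ([:c, 1:] * p + 1) = 1" "degree ([:c, 1:] * p + 1) = Suc (degree p)"
proof -
  have "p \<noteq> 0"
    using assms by auto
  then have d: "degree ([:c, 1:] * p) = Suc (degree p)"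
    by (subst degree_mult_eq) auto
  have l: "lead_coeff ([:c, 1:] * p) = 1"
    using assms by (subst lead_coeff_mult) simp
  have less: "degree (1 :: int poly) < degree ([:c, 1:] * p)"
    using d by simp
  show "degree ([:c, 1:] * p + 1) = Suc (degree p)"
    using degree_add_eq_left[OF less] d by simp
  then show "lead_coeff ([:c, 1:] * p + 1) = 1"
    using l d by (simp del: mult_pCons_left)
qed

lemma lead_coeff_base_poly: "lead_coeff (base_poly k) = 1"
proof (induction k)
  case (Suc k)
  then show ?case
    using monic_linear_plus_1(1)[OF Suc, of 0] monic_linear_plus_1(1)[OF Suc, of 1]
    by (simp only: base_poly.simps lead_coeff_mult)
qed simp

lemma lead_coeff_dir_poly: "lead_coeff (dir_poly b k) = 1"
  and degree_dir_poly: "degree (dir_poly b k) = Suc (degree (base_poly k))"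
proof -
  show "lead_coeff (dir_poly b k) = 1"
    unfolding dir_poly_def using monic_linear_plus_1(1)[OF lead_coeff_base_poly] by (cases b) (simp_all only: if_True if_False)
  show "degree (dir_poly b k) = Suc (degree (base_poly k))"
    unfolding dir_poly_def using monic_linear_plus_1(2)[OF lead_coeff_base_poly] by (cases b) (simp_all only: if_True if_False)
qed

text \<open>With \<open>B = base_poly k\<close> the identity is
  \<open>(v + 1) (v B + 1) - v ((v + 1) B + 1) = 1\<close>. The coefficients are integers, so it
  survives reduction modulo any \<open>q\<close>.\<close>

lemma comaximal_dir_poly_same: "comaximal (dir_poly True k) (dir_poly False k)"
proof (rule comaximalI)
  have "[:1, 1:] = [:0, 1:] + (1 :: int poly)"
    by (simp add: one_pCons)
  then show "([:0, 1:] + 1) * dir_poly True k + (- [:0, 1:]) * dir_poly False k = 1"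
    unfolding dir_poly_def if_True if_False by (simp only: algebra_simps)
qed

lemma dir_poly_dvd_base_poly: "i < j \<Longrightarrow> dir_poly b i dvd base_poly j"
proof (induction j)
  case (Suc j)
  show ?case
  proof (cases "i = j")
    case True
    have "dir_poly b j dvd dir_poly True j * dir_poly False j"
      by (cases b) auto
    then show ?thesis
      unfolding True base_poly_Suc by (rule dvd_mult)
  next
    case False
    then show ?thesis
      unfolding base_poly_Suc using Suc by (intro dvd_mult2) simp
  qed
qed simp

text \<open>The later polynomial is 1 modulo \<open>base_poly j\<close>, which the earlier one
  divides.\<close>

lemma comaximal_dir_poly_less:
  assumes "i < j"
  shows "comaximal (dir_poly b i) (dir_poly b' j)"
proof -
  obtain y where y: "base_poly j = dir_poly b i * y"
    using dir_poly_dvd_base_poly[OF assms] by (auto elim: dvdE)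
  let ?c = "if b' then [:0, 1:] else [:1, 1:]"
  have "(- ?c * y) * dir_poly b i + 1 * dir_poly b' j = 1"
    unfolding dir_poly_def[of b' j] y by (simp only: algebra_simps)
  then show ?thesis
    by (rule comaximalI)
qed

text \<open>The transposition of 0 and 1 puts the polynomials of degree 1 at index 1.\<close>

definition dpoly :: "nat \<times> bool \<Rightarrow> int poly" where
  "dpoly a = dir_poly (snd a) (if fst a = 0 then 1 else if fst a = 1 then 0 else fst a)"

lemma lead_coeff_dpoly: "lead_coeff (dpoly a) = 1"
  and degree_dpoly_pos: "degree (dpoly a) > 0"
  and degree_dpoly_opp: "degree (dpoly (opp a)) = degree (dpoly a)"
  and degree_dpoly_1: "degree (dpoly (1, b)) = 1"
proof -
  show "lead_coeff (dpoly a) = 1"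
    unfolding dpoly_def by (rule lead_coeff_dir_poly)
  show "degree (dpoly a) > 0" "degree (dpoly (opp a)) = degree (dpoly a)"
    unfolding dpoly_def degree_dir_poly by simp_all
  show "degree (dpoly (1, b)) = 1"
    unfolding dpoly_def degree_dir_poly by simp
qed

lemma comaximal_dpoly:
  assumes "fst a \<noteq> fst b"
  shows "comaximal (dpoly a) (dpoly b)"
proof -
  let ?s = "\<lambda>i::nat. if i = 0 then 1 else if i = 1 then 0 else i"
  have "?s (fst a) \<noteq> ?s (fst b)"
    using assms by auto
  then consider "?s (fst a) < ?s (fst b)" | "?s (fst b) < ?s (fst a)"
    by linarith
  then show ?thesis
    unfolding dpoly_def
    by cases (auto intro: comaximal_dir_poly_less comaximal_commute[OF comaximal_dir_poly_less]
        simp del: base_poly.simps)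
qed

lemma comaximal_dpoly_opp: "comaximal (dpoly (opp a)) (dpoly a)"
  using comaximal_dir_poly_same comaximal_commute by (cases "snd a") (auto simp: dpoly_def)

section \<open>The commuting operators on polynomials\<close>

definition shiftX :: "nat \<times> bool \<Rightarrow> int poly \<Rightarrow> int poly" where
  "shiftX a f = quo (dpoly (opp a)) (dpoly a) f"

lemma shiftX_eqI: "degree (dpoly (opp a) * f - dpoly a * h) < degree (dpoly a) \<Longrightarrow> shiftX a f = h"
  unfolding shiftX_def by (rule quo_eqI[OF lead_coeff_dpoly])

lemma degree_shiftX: "degree (dpoly (opp a) * f - dpoly a * shiftX a f) < degree (dpoly a)"
  unfolding shiftX_def by (rule degree_quo[OF lead_coeff_dpoly degree_dpoly_pos])

lemma shiftX_add: "shiftX a (f + g) = shiftX a f + shiftX a g"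
proof (rule shiftX_eqI)
  have "dpoly (opp a) * (f + g) - dpoly a * (shiftX a f + shiftX a g) =
      (dpoly (opp a) * f - dpoly a * shiftX a f) + (dpoly (opp a) * g - dpoly a * shiftX a g)"
    by (simp add: algebra_simps)
  then show "degree (dpoly (opp a) * (f + g) - dpoly a * (shiftX a f + shiftX a g)) < degree (dpoly a)"
    using degree_shiftX[of a f] degree_shiftX[of a g] by (simp add: degree_add_less)
qed

text \<open>Exchanging numerator and denominator only changes the sign of the remainder, and the
  bound on its degree is the same because \<open>dpoly a\<close> and \<open>dpoly (opp a)\<close>
  have equal degree.\<close>

lemma shiftX_opp: "shiftX (opp a) (shiftX a f) = f"
proof (rule shiftX_eqI)
  have "degree (dpoly a * shiftX a f - dpoly (opp a) * f) = degree (dpoly (opp a) * f - dpoly a * shiftX a f)"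
    by (metis degree_minus minus_diff_eq)
  then show "degree (dpoly (opp (opp a)) * shiftX a f - dpoly (opp a) * f) < degree (dpoly (opp a))"
    using degree_shiftX[of a f] degree_dpoly_opp[of a] by simp
qed

text \<open>The two remainders, each multiplied by the other fraction's numerator or denominator,
  stay below the degree of the product of the denominators. So the composite is the polynomial part
  for the product of the fractions, which is symmetric in \<open>a\<close> and
  \<open>b\<close>.\<close>

lemma shiftX_shiftX_eq:
  "degree (dpoly (opp a) * dpoly (opp b) * f - dpoly a * dpoly b * shiftX a (shiftX b f)) <
    degree (dpoly a) + degree (dpoly b)"
proof -
  let ?g = "shiftX b f"
  have pos: "degree (p * q) < m + k" if "degree p < m" "degree q = k" for p q :: "int poly" and m k
    using that degree_mult_le[of p q] by simp
  have eq: "dpoly (opp a) * dpoly (opp b) * f - dpoly a * dpoly b * shiftX a ?g =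
      (dpoly (opp b) * f - dpoly b * ?g) * dpoly (opp a) + (dpoly (opp a) * ?g - dpoly a * shiftX a ?g) * dpoly b"
    by (simp add: algebra_simps)
  have "degree ((dpoly (opp b) * f - dpoly b * ?g) * dpoly (opp a)) < degree (dpoly b) + degree (dpoly a)"
    by (rule pos[OF degree_shiftX degree_dpoly_opp])
  moreover have "degree ((dpoly (opp a) * ?g - dpoly a * shiftX a ?g) * dpoly b) < degree (dpoly a) + degree (dpoly b)"
    by (rule pos[OF degree_shiftX refl])
  ultimately show ?thesis
    unfolding eq by (intro degree_add_less) auto
qed

lemma shiftX_comm: "shiftX a (shiftX b f) = shiftX b (shiftX a f)"
proof -
  let ?h = "shiftX a (shiftX b f)" and ?h' = "shiftX b (shiftX a f)"
  let ?e = "dpoly a * dpoly b" and ?d = "dpoly (opp a) * dpoly (opp b) * f"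
  have nz: "dpoly c \<noteq> 0" for c
    using degree_dpoly_pos[of c] by auto
  have deg: "degree ?e = degree (dpoly a) + degree (dpoly b)"
    by (rule degree_mult_eq[OF nz nz])
  have "degree (?d - ?e * ?h') < degree (dpoly a) + degree (dpoly b)"
    using shiftX_shiftX_eq[of b a f] by (simp add: ac_simps)
  then have "degree ((?d - ?e * ?h') - (?d - ?e * ?h)) < degree ?e"
    unfolding deg by (rule degree_diff_less[OF _ shiftX_shiftX_eq])
  moreover have "(?d - ?e * ?h') - (?d - ?e * ?h) = ?e * (?h - ?h')"
    by (simp add: algebra_simps)
  moreover have "lead_coeff ?e = 1"
    by (simp add: lead_coeff_mult lead_coeff_dpoly)
  ultimately have "?h - ?h' = 0"
    using monic_small[of ?e "?h - ?h'"] by simp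
  then show ?thesis by simp
qed

lemma shiftX_mult: "shiftX a (dpoly a * g) = dpoly (opp a) * g"
  by (rule shiftX_eqI) (simp add: mult.left_commute degree_dpoly_pos)

lemma shiftX_const: "shiftX a ([:c:] * f) = [:c:] * shiftX a f"
proof (rule shiftX_eqI)
  have "dpoly (opp a) * ([:c:] * f) - dpoly a * ([:c:] * shiftX a f) =
      smult c (dpoly (opp a) * f - dpoly a * shiftX a f)"
    by (simp add: algebra_simps smult_diff_right)
  then show "degree (dpoly (opp a) * ([:c:] * f) - dpoly a * ([:c:] * shiftX a f)) < degree (dpoly a)"
    using degree_shiftX[of a f] degree_smult_le[of c] by (metis le_less_trans)
qed

lemma shiftX_0 [simp]: "shiftX a 0 = 0"
  using shiftX_add[of a 0 0] by simp

lemma shiftX_diff: "shiftX a (f - g) = shiftX a f - shiftX a g"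
  using shiftX_add[of a "f - g" g] by simp

lemma shiftX_pow_diff: "(shiftX a ^^ k) (f - g) = (shiftX a ^^ k) f - (shiftX a ^^ k) g"
  by (induction k) (simp_all add: shiftX_diff)

section \<open>Residues modulo a monic polynomial and an integer\<close>

definition rmd :: "int poly \<Rightarrow> int poly \<Rightarrow> int poly" where
  "rmd e f = f - e * quo 1 e f"

lemma degree_rmd: "lead_coeff e = 1 \<Longrightarrow> degree e > 0 \<Longrightarrow> degree (rmd e f) < degree e"
  using degree_quo[of e 1 f] by (simp add: rmd_def)

lemma rmd_eqI:
  assumes "lead_coeff e = 1" "degree r < degree e" "f = e * h + r"
  shows "rmd e f = r"
proof -
  have "1 * f - e * h = r"
    unfolding assms(3) by simp
  then have "quo 1 e f = h"
    using assms(2) by (intro quo_eqI[OF assms(1)]) simp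
  then show ?thesis
    unfolding rmd_def using assms(3) by simp
qed

definition in_ideal :: "int \<Rightarrow> int poly \<Rightarrow> int poly \<Rightarrow> bool" where
  "in_ideal q e f \<longleftrightarrow> (\<exists>g h. f = e * g + [:q:] * h)"

lemma in_ideal_rmd:
  assumes "lead_coeff e = 1" "degree e > 0"
  shows "in_ideal q e f \<longleftrightarrow> [:q:] dvd rmd e f"
proof
  assume "in_ideal q e f"
  then obtain g h where f: "f = e * g + [:q:] * h"
    by (auto simp: in_ideal_def)
  have "rmd e f = [:q:] * rmd e h"
  proof (rule rmd_eqI[OF assms(1), where h = "g + [:q:] * quo 1 e h"])
    show "degree ([:q:] * rmd e h) < degree e"
      using degree_smult_le[of q "rmd e h"] degree_rmd[OF assms, of h] by simp
    show "f = e * (g + [:q:] * quo 1 e h) + [:q:] * rmd e h"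
      unfolding f rmd_def by (simp add: algebra_simps smult_diff_right)
  qed
  then show "[:q:] dvd rmd e f" by (metis dvd_triv_left)
next
  assume "[:q:] dvd rmd e f"
  then obtain h where "rmd e f = [:q:] * h"
    by (auto elim: dvdE)
  then have "f = e * quo 1 e f + [:q:] * h"
    by (simp add: rmd_def algebra_simps)
  then show "in_ideal q e f"
    unfolding in_ideal_def by blast
qed

lemma in_ideal_small:
  assumes "lead_coeff e = 1" "degree f < degree e" "in_ideal q e f"
  shows "[:q:] dvd f"
proof -
  have "rmd e f = f"
    by (rule rmd_eqI[OF assms(1,2), where h = 0]) simp
  moreover have "degree e > 0"
    using assms(2) by simp
  ultimately show ?thesis
    using in_ideal_rmd[OF assms(1), of q f] assms(3) by simp
qed

text \<open>Comaximality makes \<open>u\<close> a unit modulo \<open>e\<close>, with inverse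
  \<open>s\<close>, and multiples of \<open>q\<close> lie in the ideal anyway.\<close>

lemma in_ideal_unit:
  assumes "comaximal u e"
  shows "in_ideal q e (u * g + [:q:] * h) \<longleftrightarrow> in_ideal q e g"
proof
  assume "in_ideal q e g"
  then obtain x y where "g = e * x + [:q:] * y"
    by (auto simp: in_ideal_def)
  then have "u * g + [:q:] * h = e * (u * x) + [:q:] * (u * y + h)"
    by (simp add: algebra_simps)
  then show "in_ideal q e (u * g + [:q:] * h)"
    unfolding in_ideal_def by blast
next
  assume "in_ideal q e (u * g + [:q:] * h)"
  then obtain x y where xy: "u * g + [:q:] * h = e * x + [:q:] * y"
    by (auto simp: in_ideal_def)
  then have ug: "u * g = e * x + [:q:] * (y - h)"
    unfolding right_diff_distrib by (metis add_diff_cancel_right' add_diff_eq)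
  obtain s t where st: "s * u + t * e = 1"
    using assms by (auto simp: comaximal_def)
  have "g = (s * u + t * e) * g"
    unfolding st by simp
  also have "\<dots> = s * (u * g) + t * e * g"
    by (simp add: algebra_simps)
  also have "\<dots> = e * (s * x + t * g) + [:q:] * (s * (y - h))"
    unfolding ug distrib_left distrib_right by (simp only: ac_simps)
  finally show "in_ideal q e g"
    unfolding in_ideal_def by blast
qed

lemma in_ideal_const: "in_ideal q e ([:q:] * h)"
  unfolding in_ideal_def by (intro exI[of _ 0] exI[of _ h]) simp

lemma in_ideal_mult: "in_ideal q e (e * g)"
  unfolding in_ideal_def by (intro exI[of _ g] exI[of _ 0]) simp

lemma in_ideal_shiftX_opp: "in_ideal q (dpoly a) f \<Longrightarrow> in_ideal q (dpoly (opp a)) (shiftX a f)"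
proof -
  assume "in_ideal q (dpoly a) f"
  then obtain g h where "f = dpoly a * g + [:q:] * h"
    by (auto simp: in_ideal_def)
  then have "shiftX a f = dpoly (opp a) * g + [:q:] * shiftX a h"
    by (simp only: shiftX_add shiftX_mult shiftX_const)
  then show ?thesis
    unfolding in_ideal_def by blast
qed

lemma in_ideal_shiftX_opp_iff: "in_ideal q (dpoly (opp a)) (shiftX a f) \<longleftrightarrow> in_ideal q (dpoly a) f"
proof
  assume "in_ideal q (dpoly (opp a)) (shiftX a f)"
  then have "in_ideal q (dpoly (opp (opp a))) (shiftX (opp a) (shiftX a f))"
    by (rule in_ideal_shiftX_opp)
  then show "in_ideal q (dpoly a) f"
    by (simp add: shiftX_opp)
qed (rule in_ideal_shiftX_opp)

text \<open>Modulo \<open>q\<close>, \<open>f\<close> is \<open>dpoly a\<close> times some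
  \<open>g\<close> and \<open>shiftX a f\<close> is \<open>dpoly (opp a)\<close> times the same
  \<open>g\<close>. Both factors are units modulo \<open>dpoly b\<close>, so either membership
  reduces to that of \<open>g\<close>.\<close>

lemma in_ideal_shiftX:
  assumes "fst a \<noteq> fst b" "in_ideal q (dpoly a) f"
  shows "in_ideal q (dpoly b) (shiftX a f) \<longleftrightarrow> in_ideal q (dpoly b) f"
proof -
  obtain g h where f: "f = dpoly a * g + [:q:] * h"
    using assms(2) by (auto simp: in_ideal_def)
  then have X: "shiftX a f = dpoly (opp a) * g + [:q:] * shiftX a h"
    by (simp only: shiftX_add shiftX_mult shiftX_const)
  have "comaximal (dpoly (opp a)) (dpoly b)" "comaximal (dpoly a) (dpoly b)"
    using assms(1) comaximal_dpoly by simp_all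
  then show ?thesis
    unfolding X unfolding f by (simp only: in_ideal_unit)
qed

lemma in_ideal_crt:
  assumes "fst c \<noteq> fst a" "fst c \<noteq> fst b"
  shows "\<exists>g. in_ideal q (dpoly a) g \<and> in_ideal q (dpoly b) g \<and> in_ideal q (dpoly c) (g - f)"
proof -
  have "comaximal (dpoly a * dpoly b) (dpoly c)"
    using assms by (intro comaximal_mult comaximal_dpoly) auto
  then obtain s t where st: "s * (dpoly a * dpoly b) + t * dpoly c = 1"
    by (auto simp: comaximal_def)
  \<comment> \<open>The multiplier of \<open>f\<close> is 0 modulo \<open>dpoly a\<close> and
    \<open>dpoly b\<close>, and 1 modulo \<open>dpoly c\<close>.\<close>
  define g where "g = f * (s * (dpoly a * dpoly b))"
  have "g = dpoly a * (f * s * dpoly b)" "g = dpoly b * (f * s * dpoly a)"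
    by (simp_all add: g_def ac_simps)
  moreover have "g - f = dpoly c * (- f * t)"
  proof -
    have "g - f = g - f * (s * (dpoly a * dpoly b) + t * dpoly c)"
      unfolding st by simp
    then show ?thesis
      by (simp add: g_def algebra_simps)
  qed
  ultimately show ?thesis
    using in_ideal_mult by metis
qed

text \<open>Each application of \<open>shiftX a\<close> exchanges one factor \<open>dpoly a\<close>
  for \<open>dpoly (opp a)\<close>. The powers of the latter are units modulo
  \<open>dpoly a\<close>, so a vanishing label of the iterate splits a further factor
  \<open>dpoly a\<close> off \<open>g\<close>.\<close>

lemma in_ideal_pow:
  assumes "\<forall>k. in_ideal q (dpoly a) ((shiftX a ^^ k) f)"
  shows "\<exists>g h h'. f = dpoly a ^ r * g + [:q:] * h \<and> (shiftX a ^^ r) f = dpoly (opp a) ^ r * g + [:q:] * h'"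
proof (induction r)
  case 0
  show ?case by (intro exI[of _ f] exI[of _ 0]) simp
next
  case (Suc r)
  then obtain g h h' where g: "f = dpoly a ^ r * g + [:q:] * h"
    "(shiftX a ^^ r) f = dpoly (opp a) ^ r * g + [:q:] * h'" by blast
  have "in_ideal q (dpoly a) (dpoly (opp a) ^ r * g + [:q:] * h')"
    using assms g(2) by metis
  then have "in_ideal q (dpoly a) g"
    using in_ideal_unit[OF comaximal_power[OF comaximal_dpoly_opp]] by blast
  then obtain x y where xy: "g = dpoly a * x + [:q:] * y"
    by (auto simp: in_ideal_def)
  have "f = dpoly a ^ Suc r * x + [:q:] * (dpoly a ^ r * y + h)"
    unfolding g(1) xy by (simp add: algebra_simps)
  moreover have "(shiftX a ^^ r) f = dpoly a * (dpoly (opp a) ^ r * x) + [:q:] * (dpoly (opp a) ^ r * y + h')"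
    unfolding g(2) xy by (simp add: algebra_simps)
  then have "(shiftX a ^^ Suc r) f = dpoly (opp a) ^ Suc r * x + [:q:] * shiftX a (dpoly (opp a) ^ r * y + h')"
    by (simp only: funpow.simps o_apply shiftX_add shiftX_mult shiftX_const power_Suc mult.assoc)
  ultimately show ?case by blast
qed

lemma in_ideal_pow_dvd:
  assumes "\<forall>k. in_ideal q (dpoly a) ((shiftX a ^^ k) f)"
  shows "[:q:] dvd f"
proof -
  \<comment> \<open>Each factor has degree at least 1, so this exponent pushes the degree of the
    divisor above that of \<open>f\<close>.\<close>
  let ?e = "dpoly a ^ Suc (degree f)"
  have "in_ideal q ?e f"
    using in_ideal_pow[OF assms, of "Suc (degree f)"] unfolding in_ideal_def by blast
  moreover have "lead_coeff ?e = 1"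
    by (simp only: lead_coeff_power lead_coeff_dpoly power_one)
  moreover have "degree f < degree ?e"
  proof -
    have "dpoly a \<noteq> 0"
      using degree_dpoly_pos[of a] by auto
    then have "degree ?e = Suc (degree f) * degree (dpoly a)"
      by (rule degree_power_eq)
    moreover have "Suc (degree f) * 1 \<le> Suc (degree f) * degree (dpoly a)"
      using degree_dpoly_pos[of a] by (intro mult_le_mono2) simp
    ultimately show ?thesis by simp
  qed
  ultimately show ?thesis
    by (intro in_ideal_small)
qed

lemma shiftX_pow_dpoly:
  "k \<le> N \<Longrightarrow> (shiftX a ^^ k) (dpoly a ^ N) = dpoly (opp a) ^ k * dpoly a ^ (N - k)"
proof (induction k)
  case (Suc k)
  have "dpoly a ^ (N - k) = dpoly a * dpoly a ^ (N - Suc k)"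
    using Suc.prems by (metis Suc_diff_le diff_Suc_Suc power_Suc)
  then have "(shiftX a ^^ k) (dpoly a ^ N) = dpoly a * (dpoly (opp a) ^ k * dpoly a ^ (N - Suc k))"
    using Suc by (simp add: ac_simps)
  then show ?case
    by (simp only: funpow.simps o_apply shiftX_mult power_Suc mult.assoc)
qed simp

text \<open>Otherwise the unit \<open>dpoly (opp a) ^ N\<close> would vanish modulo
  \<open>dpoly a ^ N\<close> and \<open>q\<close>, so 1 would lie in that ideal and, being of small
  degree, be divisible by \<open>q\<close>.\<close>

lemma not_dvd_dpoly_pow_diff:
  assumes "q \<ge> 2" "N \<ge> 1"
  shows "\<not> [:q:] dvd dpoly (opp a) ^ N - dpoly a ^ N"
proof
  assume "[:q:] dvd dpoly (opp a) ^ N - dpoly a ^ N"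
  then obtain h where "dpoly (opp a) ^ N - dpoly a ^ N = [:q:] * h"
    by (auto elim: dvdE)
  then have "dpoly (opp a) ^ N * 1 + [:q:] * 0 = dpoly a ^ N * 1 + [:q:] * h"
    by (simp add: algebra_simps)
  then have "in_ideal q (dpoly a ^ N) (dpoly (opp a) ^ N * 1 + [:q:] * 0)"
    unfolding in_ideal_def by blast
  moreover have "comaximal (dpoly (opp a) ^ N) (dpoly a ^ N)"
    using comaximal_power[OF comaximal_commute[OF comaximal_power[OF comaximal_dpoly_opp]]]
      comaximal_commute by blast
  ultimately have "in_ideal q (dpoly a ^ N) 1"
    using in_ideal_unit by blast
  moreover have "lead_coeff (dpoly a ^ N) = 1"
    by (simp only: lead_coeff_power lead_coeff_dpoly power_one)
  moreover have "degree (1 :: int poly) < degree (dpoly a ^ N)"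
  proof -
    have "dpoly a \<noteq> 0"
      using degree_dpoly_pos[of a] by auto
    then show ?thesis
      using degree_dpoly_pos[of a] assms(2) by (simp add: degree_power_eq)
  qed
  ultimately have "[:q:] dvd 1"
    by (intro in_ideal_small)
  then have "q dvd coeff 1 0"
    unfolding const_poly_dvd_iff by blast
  then show False
    using assms(1) by (simp add: zdvd_not_zless)
qed

text \<open>A residue class is given by the coefficients of the remainder modulo \<open>q\<close>,
  one digit for each exponent below \<open>degree e\<close>; any numbering of these digit vectors
  serves as label.\<close>

lemma ex_label:
  assumes "lead_coeff e = 1" "degree e > 0" "q \<ge> 1"
  shows "\<exists>l. range l = {..<q ^ degree e} \<and>
    (\<forall>f g. l f = (l g :: nat) \<longleftrightarrow> in_ideal (int q) e (f - g))"
proof -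
  define P where "P = (\<Pi>\<^sub>E k\<in>{..<degree e}. {..<q})"
  define \<phi> where "\<phi> f = (\<lambda>k\<in>{..<degree e}. nat (coeff (rmd e f) k mod int q))" for f
  have fin: "finite P"
    unfolding P_def by (intro finite_PiE) auto
  have "card P = q ^ degree e"
    unfolding P_def by (subst card_PiE) auto
  then obtain \<beta> where \<beta>: "bij_betw \<beta> P {..<q ^ degree e}"
    using ex_bij_betw_finite_nat[OF fin] by (auto simp: atLeast0LessThan)
  have \<phi>P: "\<phi> f \<in> P" for f
  proof -
    have "nat (coeff (rmd e f) k mod int q) < q" for k
      using assms(3) pos_mod_bound[of "int q" "coeff (rmd e f) k"] by (simp add: nat_less_iff)
    then show ?thesis
      unfolding P_def \<phi>_def by auto
  qed
  have "range \<phi> = P"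
  proof
    show "P \<subseteq> range \<phi>"
    proof
      fix t assume t: "t \<in> P"
      define r where "r = Poly (map (\<lambda>k. int (t k)) [0..<degree e])"
      have c: "coeff r k = (if k < degree e then int (t k) else 0)" for k
        by (simp add: r_def coeff_Poly_eq nth_default_def)
      have "degree r < degree e"
        using assms(2) by (intro degree_lessI) (auto simp: c)
      then have "rmd e r = r"
        by (intro rmd_eqI[OF assms(1), where h = 0]) simp_all
      then have "\<phi> r = t"
        using t by (intro ext) (auto simp: \<phi>_def c P_def PiE_iff extensional_def)
      then show "t \<in> range \<phi>" by blast
    qed
  qed (use \<phi>P in blast)
  moreover have "\<phi> f = \<phi> g \<longleftrightarrow> in_ideal (int q) e (f - g)" for f g
  proof -
    have deg: "degree (rmd e f - rmd e g) < degree e"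
      using degree_rmd[OF assms(1,2)] by (intro degree_diff_less)
    have "rmd e (f - g) = rmd e f - rmd e g"
      by (rule rmd_eqI[OF assms(1) deg, where h = "quo 1 e f - quo 1 e g"])
        (simp add: rmd_def algebra_simps)
    then have "in_ideal (int q) e (f - g) \<longleftrightarrow> (\<forall>k. int q dvd coeff (rmd e f - rmd e g) k)"
      using in_ideal_rmd[OF assms(1,2)] by (simp add: const_poly_dvd_iff)
    also have "\<dots> \<longleftrightarrow> (\<forall>k<degree e. int q dvd coeff (rmd e f) k - coeff (rmd e g) k)"
      using coeff_eq_0[of "rmd e f - rmd e g"] deg
      by (metis coeff_diff dvd_0_right linorder_not_less order_less_le_trans)
    also have "\<dots> \<longleftrightarrow> (\<forall>k<degree e. coeff (rmd e f) k mod int q = coeff (rmd e g) k mod int q)"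
      by (simp add: mod_eq_dvd_iff)
    also have "\<dots> \<longleftrightarrow> \<phi> f = \<phi> g"
    proof
      assume eq: "\<phi> f = \<phi> g"
      have "nat (coeff (rmd e f) k mod int q) = nat (coeff (rmd e g) k mod int q)" if "k < degree e" for k
        using fun_cong[OF eq, of k] that unfolding \<phi>_def by simp
      then show "\<forall>k<degree e. coeff (rmd e f) k mod int q = coeff (rmd e g) k mod int q"
        using assms(3) by (simp add: eq_nat_nat_iff)
    qed (auto simp: \<phi>_def)
    finally show ?thesis ..
  qed
  ultimately show ?thesis
  proof (intro exI[of _ "\<beta> \<circ> \<phi>"] conjI allI)
    assume \<phi>: "range \<phi> = P" "\<And>f g. \<phi> f = \<phi> g \<longleftrightarrow> in_ideal (int q) e (f - g)"
    show "range (\<beta> \<circ> \<phi>) = {..<q ^ degree e}"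
      unfolding image_comp[symmetric] \<phi>(1) by (rule bij_betw_imp_surj_on[OF \<beta>])
    fix f g
    show "(\<beta> \<circ> \<phi>) f = (\<beta> \<circ> \<phi>) g \<longleftrightarrow> in_ideal (int q) e (f - g)"
      using \<phi>(2) inj_on_eq_iff[OF bij_betw_imp_inj_on[OF \<beta>] \<phi>P \<phi>P] by simp
  qed
qed

definition base_label :: "nat \<Rightarrow> nat \<Rightarrow> int poly \<Rightarrow> nat" where
  "base_label q i = (SOME l. range l = {..<q ^ degree (dpoly (i, True))} \<and>
    (\<forall>f g. l f = (l g :: nat) \<longleftrightarrow> in_ideal (int q) (dpoly (i, True)) (f - g)))"

text \<open>In the negative direction the label is read at the other end of the edge. Both ends thus
  agree by construction, up to \<open>shiftX_opp\<close>.\<close>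

definition label :: "nat \<Rightarrow> nat \<times> bool \<Rightarrow> int poly \<Rightarrow> nat" where
  "label q a f = base_label q (fst a) (if snd a then f else shiftX a f)"

lemma base_label:
  assumes "q \<ge> 1"
  shows "range (base_label q i) = {..<q ^ degree (dpoly (i, True))} \<and>
    (\<forall>f g. base_label q i f = base_label q i g \<longleftrightarrow> in_ideal (int q) (dpoly (i, True)) (f - g))"
  unfolding base_label_def by (rule someI_ex[OF ex_label[OF lead_coeff_dpoly degree_dpoly_pos assms]])

lemma label_eq_iff:
  assumes "q \<ge> 1"
  shows "label q a f = label q a g \<longleftrightarrow> in_ideal (int q) (dpoly a) (f - g)"
proof (cases "snd a")
  case True
  then have "a = (fst a, True)"
    by (simp add: prod_eq_iff)
  then show ?thesis
    using base_label[OF assms, of "fst a"] True by (simp add: label_def)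
next
  case False
  then have "opp a = (fst a, True)"
    by simp
  then show ?thesis
    using base_label[OF assms, of "fst a"] False in_ideal_shiftX_opp_iff[of "int q" a "f - g"]
    by (simp add: label_def shiftX_diff)
qed

lemma label_eq_0_iff:
  "q \<ge> 1 \<Longrightarrow> label q a f = label q a 0 \<longleftrightarrow> in_ideal (int q) (dpoly a) f"
  using label_eq_iff[of q a f 0] by simp

lemma cube_label:
  assumes "q \<ge> 2"
  shows "cube shiftX (\<lambda>i. q ^ degree (dpoly (i, True))) (label q)"
proof
  have q: "q \<ge> 1"
    using assms by simp
  fix a b c :: "nat \<times> bool" and f g :: "int poly" and y
  show "shiftX a (f + g) = shiftX a f + shiftX a g"
    by (rule shiftX_add)
  show "shiftX (opp a) (shiftX a f) = f"
    by (rule shiftX_opp)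
  show "shiftX a (shiftX b f) = shiftX b (shiftX a f)"
    by (rule shiftX_comm)
  have "base_label q (fst a) h \<in> {..<q ^ degree (dpoly (fst a, True))}" for h
    using base_label[OF q, of "fst a"] by blast
  then show "label q a f < q ^ degree (dpoly (fst a, True))"
    by (simp add: label_def)
  show "\<exists>f. label q a f = y" if "y < q ^ degree (dpoly (fst a, True))"
  proof -
    have "y \<in> range (base_label q (fst a))"
      using base_label[OF q, of "fst a"] that by simp
    then obtain h where h: "base_label q (fst a) h = y"
      by blast
    show ?thesis
    proof (cases "snd a")
      case True
      then show ?thesis
        using h by (intro exI[of _ h]) (simp add: label_def)
    next
      case False
      have "shiftX a (shiftX (opp a) h) = h"
        using shiftX_opp[of "opp a" h] by simp
      then show ?thesis
        using h False by (intro exI[of _ "shiftX (opp a) h"]) (simp add: label_def)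
    qed
  qed
  show "label q a f = label q a g \<longleftrightarrow> label q a (f - g) = label q a 0"
    using label_eq_iff[OF q] label_eq_0_iff[OF q] by simp
  show "label q (opp a) (shiftX a f) = label q a f"
  proof (cases "snd a")
    case True
    then have "(fst a, False) = opp a"
      by simp
    then show ?thesis
      using shiftX_opp[of a f] True by (simp add: label_def)
  qed (simp add: label_def)
  show "label q b (shiftX a f) = label q b 0 \<longleftrightarrow> label q b f = label q b 0"
    if "fst a \<noteq> fst b" "label q a f = label q a 0"
    using that(2) unfolding label_eq_0_iff[OF q] by (rule in_ideal_shiftX[OF that(1)])
  show "\<exists>g. label q a g = label q a 0 \<and> label q b g = label q b 0 \<and> label q c g = label q c f"
    if "fst c \<noteq> fst a" "fst c \<noteq> fst b"
    using in_ideal_crt[OF that, of "int q" f] unfolding label_eq_0_iff[OF q] label_eq_iff[OF q, of c] .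
qed

lemma ex_label_shiftX_pow_neq:
  assumes "q \<ge> 1" "\<not> [:int q:] dvd f - g"
  shows "\<exists>k. label q a ((shiftX a ^^ k) f) \<noteq> label q a ((shiftX a ^^ k) g)"
proof (rule ccontr)
  assume "\<not> ?thesis"
  then have "in_ideal (int q) (dpoly a) ((shiftX a ^^ k) (f - g))" for k
    using label_eq_iff[OF assms(1)] by (simp add: shiftX_pow_diff)
  then show False
    using in_ideal_pow_dvd[of "int q" a "f - g"] assms(2) by blast
qed

text \<open>Stated by coefficients because the zero polynomial has \<open>degree\<close> 0: for
  \<open>k = 0\<close> only 0 remains.\<close>

definition low_degree :: "nat \<Rightarrow> int poly set" where
  "low_degree k = {f. \<forall>j\<ge>k. coeff f j = 0}"

text \<open>Numerator and denominator have equal degree. If \<open>?h\<close> had larger degree than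
  \<open>f\<close>, then \<open>dpoly a * ?h\<close> would dominate the remainder and push its
  degree too high.\<close>

lemma shiftX_low_degree:
  assumes "f \<in> low_degree k"
  shows "shiftX a f \<in> low_degree k"
proof (rule ccontr)
  let ?h = "shiftX a f"
  assume "?h \<notin> low_degree k"
  then obtain j where j: "j \<ge> k" "coeff ?h j \<noteq> 0"
    by (auto simp: low_degree_def)
  then have h: "degree ?h \<ge> k" "?h \<noteq> 0"
    using le_degree[OF j(2)] by auto
  have f0: "f \<noteq> 0"
    using h(2) by auto
  have nz: "dpoly c \<noteq> 0" for c
    using degree_dpoly_pos[of c] by auto
  have "degree f < k"
  proof (rule ccontr)
    assume "\<not> degree f < k"
    then have "coeff f (degree f) = 0"
      using assms by (simp add: low_degree_def)
    then show False
      using f0 by simp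
  qed
  moreover have "degree (dpoly (opp a) * f) = degree (dpoly a) + degree f"
    using degree_mult_eq[OF nz f0] degree_dpoly_opp by simp
  moreover have eh: "degree (dpoly a * ?h) = degree (dpoly a) + degree ?h"
    by (rule degree_mult_eq[OF nz h(2)])
  ultimately have "degree (dpoly (opp a) * f) < degree (dpoly a * ?h)"
    using h(1) by simp
  then have "degree (dpoly (opp a) * f - dpoly a * ?h) = degree (dpoly a * ?h)"
    by (metis degree_add_eq_right degree_minus diff_conv_add_uminus)
  then show False
    using degree_shiftX[of a f] eh by simp
qed

theorem theorem1p1:
  fixes n q :: nat
  assumes "n \<ge> 2" and "primepow q"
  shows "\<exists>qs :: nat \<Rightarrow> nat.
    qs 1 = q \<and> (\<forall>i\<in>{1..n}. \<exists>e\<ge>1. qs i = q ^ e) \<and>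
    (\<exists>\<Gamma> :: nat \<Rightarrow> (nat \<Rightarrow> nat list \<Rightarrow> nat list) set.
       (\<forall>k. \<Gamma> k \<subset> \<Gamma> (Suc k)) \<and>
       (\<forall>k. cocompact_lattice_in (tree_prod_group {1..n} (\<lambda>i. 2 * qs i))
              (tree_prod_topology {1..n} (\<lambda>i. 2 * qs i)) (\<Gamma> k)) \<and>
       (\<forall>k. vertex_transitive {1..n} (\<lambda>i. 2 * qs i) (\<Gamma> k)) \<and>
       (\<forall>k I. I \<noteq> {} \<and> I \<subset> {1..n} \<longrightarrow>
          \<not> discrete_subset (tree_prod_topology I (\<lambda>i. 2 * qs i)) ((\<lambda>\<gamma>. restrict \<gamma> I) ` \<Gamma> k)))"
proof -
  have q2: "q \<ge> 2" and q1: "q \<ge> 1"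
    using primepow_gt_Suc_0[OF assms(2)] by simp_all
  define qs where "qs i = q ^ degree (dpoly (i, True))" for i
  have "cube_product shiftX qs (label q) n {1..n}"
    using cube_label[OF q2] unfolding qs_def
    by (intro cube_product.intro cube_product_axioms.intro refl)
  then interpret C: cube_product shiftX qs "label q" n "{1..n}" .
  define \<Gamma> where "\<Gamma> k = C.lattice (low_degree k)" for k
  have closed: "C.shift_closed (low_degree k)" for k
    unfolding C.shift_closed_def using shiftX_low_degree by (auto simp: low_degree_def)
  have finite: "finite ((\<lambda>f. C.el (Sh f)) ` low_degree k)" for k
  proof -
    \<comment> \<open>A shift depends on its polynomial only modulo \<open>q\<close>, so
      coefficients in \<open>{0..<int q}\<close> represent all of them.\<close>
    define red where "red f = Poly (map (\<lambda>j. coeff f j mod int q) [0..<k])" for f :: "int poly"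
    let ?L = "{xs. set xs \<subseteq> {0..<int q} \<and> length xs = k}"
    have "C.el (Sh f) \<in> (\<lambda>xs. C.el (Sh (Poly xs))) ` ?L" if f: "f \<in> low_degree k" for f
    proof -
      have "C.el (Sh f) = C.el (Sh (red f))"
      proof (rule C.el_Sh_cong[where Z = "{h. [:int q:] dvd h}"])
        fix h a assume "h \<in> {h. [:int q:] dvd h}"
        then obtain x where x: "h = [:int q:] * x"
          by (auto elim: dvdE)
        show "label q a h = label q a 0 \<and> shiftX a h \<in> {h. [:int q:] dvd h}"
          unfolding label_eq_0_iff[OF q1] x shiftX_const mem_Collect_eq
          using in_ideal_const dvd_triv_left by blast
      next
        have "int q dvd coeff (f - red f) j" for j
          using f by (cases "j < k")
            (auto simp: red_def low_degree_def coeff_Poly_eq nth_default_def simp flip: mod_eq_dvd_iff)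
        then show "f - red f \<in> {h. [:int q:] dvd h}"
          unfolding mem_Collect_eq const_poly_dvd_iff by blast
      qed
      moreover have "map (\<lambda>j. coeff f j mod int q) [0..<k] \<in> ?L"
        using q1 by auto
      ultimately show ?thesis
        unfolding red_def by blast
    qed
    then have "(\<lambda>f. C.el (Sh f)) ` low_degree k \<subseteq> (\<lambda>xs. C.el (Sh (Poly xs))) ` ?L"
      by blast
    then show ?thesis
      by (rule finite_subset) (intro finite_imageI finite_lists_length_eq, simp)
  qed
  have one: "1 \<in> {1..n}"
    using assms(1) by simp
  have strict: "\<Gamma> k \<subset> \<Gamma> (Suc k)" for k
    unfolding \<Gamma>_def
  proof (rule C.lattice_strict_mono[OF closed _ _ one])
    \<comment> \<open>The new monomial has coefficient 1 at exponent \<open>k\<close>, which no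
      polynomial of lower degree cancels modulo \<open>q\<close>.\<close>
    show "low_degree k \<subseteq> low_degree (Suc k)" "monom 1 k \<in> low_degree (Suc k)"
      by (auto simp: low_degree_def)
    fix f assume "f \<in> low_degree k"
    then have "coeff (monom 1 k - f) k = 1"
      by (simp add: low_degree_def)
    then have "\<not> int q dvd coeff (monom 1 k - f) k"
      using q2 by (simp add: zdvd_not_zless)
    then have "\<not> [:int q:] dvd monom 1 k - f"
      unfolding const_poly_dvd_iff by blast
    then show "\<exists>j. label q (1, True) ((shiftX (1, True) ^^ j) (monom 1 k)) \<noteq>
        label q (1, True) ((shiftX (1, True) ^^ j) f)"
      by (rule ex_label_shiftX_pow_neq[OF q1])
  qed
  have nondiscrete: "\<not> discrete_subset (tree_prod_topology I (\<lambda>i. 2 * qs i)) ((\<lambda>\<gamma>. restrict \<gamma> I) ` \<Gamma> k)"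
    if "I \<noteq> {}" "I \<subset> {1..n}" for k I
    unfolding \<Gamma>_def
  proof (rule C.restrict_lattice_not_discrete[OF that])
    fix i j N :: nat assume "i \<noteq> j" and N: "N \<ge> 1"
    let ?a = "(j, True)"
    \<comment> \<open>Each step trades one factor \<open>dpoly ?a\<close> for
      \<open>dpoly (opp ?a)\<close>, so the label is zero for exactly the \<open>N\<close> steps
      needed, and the end point \<open>dpoly (opp ?a) ^ N\<close> differs from the start modulo
      \<open>q\<close>.\<close>
    let ?m = "dpoly ?a ^ N"
    have "label q ?a ((shiftX ?a ^^ k) ?m) = label q ?a 0" if "k < N" for k
    proof -
      have "dpoly ?a ^ (N - k) = dpoly ?a * dpoly ?a ^ (N - Suc k)"
        using that by (metis Suc_diff_Suc power_Suc)
      then have "(shiftX ?a ^^ k) ?m = dpoly ?a * (dpoly (opp ?a) ^ k * dpoly ?a ^ (N - Suc k))"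
        using shiftX_pow_dpoly[of k N ?a] that by (simp add: ac_simps)
      then show ?thesis
        unfolding label_eq_0_iff[OF q1] using in_ideal_mult by metis
    qed
    moreover have "(shiftX ?a ^^ N) ?m = dpoly (opp ?a) ^ N"
      using shiftX_pow_dpoly[of N N ?a] by simp
    moreover have "\<not> [:int q:] dvd dpoly (opp ?a) ^ N - ?m"
      by (rule not_dvd_dpoly_pow_diff) (use q2 N in simp_all)
    then have "\<exists>k. label q (i, True) ((shiftX (i, True) ^^ k) (dpoly (opp ?a) ^ N)) \<noteq>
        label q (i, True) ((shiftX (i, True) ^^ k) ?m)"
      by (rule ex_label_shiftX_pow_neq[OF q1])
    ultimately show "\<exists>m k. (\<forall>k<N. label q ?a ((shiftX ?a ^^ k) m) = label q ?a 0) \<and>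
        label q (i, True) ((shiftX (i, True) ^^ k) ((shiftX ?a ^^ N) m)) \<noteq>
        label q (i, True) ((shiftX (i, True) ^^ k) m)"
      by metis
  qed
  have "qs 1 = q"
    unfolding qs_def degree_dpoly_1 by simp
  moreover have "\<exists>e\<ge>1. qs i = q ^ e" for i
    using degree_dpoly_pos[of "(i, True)"] unfolding qs_def
    by (intro exI[of _ "degree (dpoly (i, True))"]) simp
  moreover have "cocompact_lattice_in (tree_prod_group {1..n} (\<lambda>i. 2 * qs i))
      (tree_prod_topology {1..n} (\<lambda>i. 2 * qs i)) (\<Gamma> k)" for k
    unfolding \<Gamma>_def by (rule C.cocompact_lattice_lattice[OF closed finite])
  moreover have "vertex_transitive {1..n} (\<lambda>i. 2 * qs i) (\<Gamma> k)" for k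
    unfolding \<Gamma>_def by (rule C.lattice_transitive)
  ultimately show ?thesis
    using strict nondiscrete by (intro exI[of _ qs] exI[of _ \<Gamma>] conjI ballI allI impI) simp_all
qed

end
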